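(* Let $(\mathcal X,\mathcal S)$ be a hierarchically hyperbolic space with factor spaces $\{\mathcal C U\}_{U\in\mathcal S}$, projection maps $\lambda_U\colon\mathcal X\to\mathcal C U$ and consistency constraint sets $\mathcal R_{UV}\subseteq\mathcal C U\times\mathcal C V$. Assume that: - $\alpha_U\colon\mathcal C U\to\mathcal C'U$, for $U\in\mathcal S$, is a family of uniformly coarsely Lipschitz retractions to subspaces $\mathcal C'U\subseteq\mathcal C U$ (that is, the $\alpha_U$ admit a common affine upper control and there is $K\ge0$ with $d_{\mathcal C U}(\alpha_Ux,x)\le K$ for all $U$ and $x\in\mathcal C'U$); and - for all distinct $U,V\in\mathcal S$, whenever $(x_U,x_V)\in\mathcal C U\times\mathcal C V$ is consistent (lies in $\mathcal R_{UV}$), then $(\alpha_Ux_U,\alpha_Vx_V)$ is consistent up to uniform error (that is, there is $c\ge0$, independent of $U,V$, such that $(\alpha_Ux_U,\alpha_Vx_V)$ lies in the $c$-neighbourhood of $\mathcal R_{UV}$ in $\mathcal C U\times\mathcal C V$). Then there exists a canonical (up to closeness) coarsely Lipschitz retraction $\tilde\alpha\colon\mathcal X\to\mathcal X'$ onto a subspace $\mathcal X'\subseteq\mathcal X$ induced by the $\alpha_U$. Moreover, $\mathcal X'$ is a total space over $\{\mathcal C'U\}_{U\in\mathcal S}$ with the inherited pairwise consistency constraints $\mathcal R'_{UV}:=(\alpha_U\times\alpha_V)(\mathcal R_{UV})$.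
   Context: General conventions. Metric spaces are extended (distances may be $\infty$) unless said otherwise. Maps $f,f'$ into $Y$ are $\kappa$-close if $d_Y(fx,f'x)\le\kappa$ for all $x$, and close if $\kappa$-close for some $\kappa$. A map $f\colon X\to Y$ is coarsely Lipschitz with affine upper control $t\mapsto at+b$ if $d_Y(fx,fx')\le a\,d_X(x,x')+b$ whenever $d_X(x,x')<\infty$. A coarsely Lipschitz retraction of $X$ onto a subspace $X'$ is a coarsely Lipschitz map $r\colon X\to X'$ with $r|_{X'}$ close to the identity. A space is quasigeodesic if it is quasi-isometric to a graph with its combinatorial metric. Products carry $\ell^\infty$-metrics. Total spaces. Given metric spaces $\{\mathcal C U\}_{U\in\mathcal S}$ and subsets $\mathcal R_{UV}\subseteq\mathcal C U\times\mathcal C V$ for unordered pairs of distinct $U,V$, let $D$ be the diagram with objects $\mathcal C U$ (one for each $U$) and $\mathcal R_{UV}$ with the $\ell^\infty$-metric (one for each unordered pair) and arrows the coordinate projections $\mathcal R_{UV}\to\mathcal C U$, $\mathcal R_{UV}\to\mathcal C V$. A quasigeodesic uniformly controlled (u.c.) cone over $D$ is a family of maps $\mu_j\colon W\to D_j$, one for each object $j$, from a quasigeodesic space $W$, with a common affine upper control, commuting with the arrows up to an error uniform over all arrows. Such a cone $\lambda$ with apex $X$ is universal if for every quasigeodesic u.c. cone $\mu$ with apex $W$ there is a coarsely Lipschitz $f\colon W\to X$, unique up to closeness, such that $\mu_j$ and $\lambda_jf$ are $\kappa$-close for all $j$, for some $\kappa$ independent of $j$. A total space is (the apex of) a universal quasigeodesic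 u.c. cone over $D$. In the statement, "induced by the $\alpha_U$" means that the universal cone over the diagram of $(\{\mathcal C'U\},\{\mathcal R'_{UV}\})$ with apex $\mathcal X'$ has primary legs $\lambda'_U\colon\mathcal X'\to\mathcal C'U$ such that $\lambda'_U\tilde\alpha$ and $\alpha_U\lambda_U$ are close uniformly in $U$, and the inclusion $i\colon \mathcal X'\hookrightarrow\mathcal X$ is such that $\lambda_Ui$ and $\lambda'_U$ (viewed in $\mathcal C U$) are close uniformly in $U$. HHS. A (normalised) hierarchically hyperbolic space consists of a nonempty quasigeodesic metric space $\mathcal X$ (with finite distances), an index set $\mathcal S$, $\delta\ge 0$, and $\delta$-hyperbolic geodesic spaces $\mathcal C W$ $(W\in\mathcal S)$ such that: (1) There are $\xi,K_0\ge 0$ and maps $\pi_W$ from $\mathcal X$ to nonempty subsets of $\mathcal C W$ of diameter $\le\xi$, each $(K_0,K_0)$-coarsely Lipschitz, with $\pi_W(\mathcal X)$ $K_0$-dense in $\mathcal C W$ (normalisation). (2) $\mathcal S$ has a partial order $\sqsubseteq$ (nesting), and is empty or has a unique $\sqsubseteq$-maximal element; $\mathcal S_W=\{V: V\sqsubseteq W\}$. For $V\sqsubsetneq W$ there are a nonempty subset $\rho^V_W\subseteq\mathcal C W$ of diameter $\le\xi$ and a map $\rho^W_V$ from $\mathcal C W$ to nonempty subsets of $\mathcal C V$. (3) $\mathcal S$ has a symmetric antireflexive relation $\perp$ (orthogonality): if $V\sqsubseteq W$ and $W\perp U$ then $V\perp U$; for each $T\in\mathcal S$ and $U\in\mathcal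 S_T$ with $\{V\in\mathcal S_T: V\perp U\}\ne\emptyset$ there is $W\in\mathcal S_T\setminus\{T\}$ such that $V\sqsubseteq W$ whenever $V\perp U$ and $V\sqsubseteq T$; if $V\perp W$ then $V,W$ are not $\sqsubseteq$-comparable. (4) Distinct $V,W$ which are neither orthogonal nor nested are transverse, $V\pitchfork W$. There is $\kappa_0\ge 0$ such that for $V\pitchfork W$ there are nonempty sets $\rho^V_W\subseteq\mathcal C W$, $\rho^W_V\subseteq\mathcal C V$ of diameter $\le\xi$ with $\min\{d_{\mathcal C W}(\pi_W(x),\rho^V_W),d_{\mathcal C V}(\pi_V(x),\rho^W_V)\}\le\kappa_0$ for all $x\in\mathcal X$; for $V\sqsubsetneq W$ and $x\in\mathcal X$, $\min\{d_{\mathcal C W}(\pi_W(x),\rho^V_W),\operatorname{diam}_{\mathcal C V}(\pi_V(x)\cup\rho^W_V(\pi_W(x)))\}\le\kappa_0$; and if $U\sqsubseteq V$ then $d_{\mathcal C W}(\rho^U_W,\rho^V_W)\le\kappa_0$ whenever $V\sqsubsetneq W$, or $V\pitchfork W$ and $W\not\perp U$. (5) There is $n$ such that any set of pairwise $\sqsubseteq$-comparable elements has at most $n$ elements. (6) There are $\ell\ge 1$, $E\ge\max\{\xi,\kappa_0\}$ such that for $W\in\mathcal S$, $x,x'\in\mathcal X$ and $N=\ell\, d_{\mathcal C W}(\pi_W(x),\pi_W(x'))+\ell$ there are $T_1,\dots,T_{\lfloor N\rfloor}\in\mathcal S_W\setminus\{W\}$ such that each $T\in\mathcal S_W\setminus\{W\}$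 satisfies $T\sqsubseteq T_i$ for some $i$ or $d_{\mathcal C T}(\pi_T(x),\pi_T(x'))<E$; also $d_{\mathcal C W}(\pi_W(x),\rho^{T_i}_W)\le N$ for each $i$. (7) For $V\sqsubsetneq W$ and every geodesic $\gamma$ of $\mathcal C W$, either $\operatorname{diam}_{\mathcal C V}\rho^W_V(\gamma)\le E$ or $\gamma$ meets the $E$-neighbourhood of $\rho^V_W$. (8) There is $\alpha_0$ such that for any family $\{V_j\}$ of pairwise orthogonal elements and $p_j\in\pi_{V_j}(\mathcal X)$ there is $x\in\mathcal X$ with $d_{\mathcal C V_j}(\pi_{V_j}(x),p_j)\le\alpha_0$ for all $j$, and $d_{\mathcal C V}(\pi_V(x),\rho^{V_j}_V)\le\alpha_0$ whenever $V_j\sqsubsetneq V$ or $V\pitchfork V_j$. (9) (Uniqueness) For each $\kappa\ge 0$ there is $\theta(\kappa)$ such that $d(x,y)\ge\theta(\kappa)$ implies $d_{\mathcal C V}(\pi_V(x),\pi_V(y))\ge\kappa$ for some $V\in\mathcal S$. Choose $\lambda_U(x)\in\pi_U(x)$; the $\lambda_U\colon\mathcal X\to\mathcal C U$ are uniformly coarsely Lipschitz. Fix an error $\epsilon\ge 0$ large enough that $(\lambda_U x,\lambda_V x)\in\mathcal R_{UV}$ for all $x\in\mathcal X$ and distinct $U,V$, where $\mathcal R_{UV}\subseteq\mathcal C U\times\mathcal C V$ is the set of pairs $(x_U,x_V)$ with: $\min\{d_{\mathcal C U}(x_U,\rho^V_U),d_{\mathcal C V}(x_V,\rho^U_V)\}\le\epsilon$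 if $U\pitchfork V$ (Behrstock inequality); $\min\{d_{\mathcal C V}(x_V,\rho^U_V),\operatorname{diam}_{\mathcal C U}(\{x_U\}\cup\rho^V_U(x_V))\}\le\epsilon$ if $U\sqsubsetneq V$ (bounded geodesic image inequality), and symmetrically if $V\sqsubsetneq U$; no condition if $U\perp V$. *)

theory Defs
  imports "HOL-Analysis.Analysis"
begin

section \<open>Extended metric spaces and coarse maps\<close>

text \<open>
  A space is a carrier set together with an \<open>ennreal\<close>-valued distance; only the values
  of the distance on the carrier matter, so a subspace is just a smaller carrier with the same
  distance.
\<close>

definition ext_metric :: "'a set \<Rightarrow> ('a \<Rightarrow> 'a \<Rightarrow> ennreal) \<Rightarrow> bool" where
  "ext_metric M d \<longleftrightarrow>
     (\<forall>x\<in>M. \<forall>y\<in>M. d x y = 0 \<longleftrightarrow> x = y) \<and>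
     (\<forall>x\<in>M. \<forall>y\<in>M. d x y = d y x) \<and>
     (\<forall>x\<in>M. \<forall>y\<in>M. \<forall>z\<in>M. d x z \<le> d x y + d y z)"

definition dist_sets :: "('a \<Rightarrow> 'a \<Rightarrow> ennreal) \<Rightarrow> 'a set \<Rightarrow> 'a set \<Rightarrow> ennreal" where
  "dist_sets d A B = (INF a\<in>A. INF b\<in>B. d a b)"

definition diam :: "('a \<Rightarrow> 'a \<Rightarrow> ennreal) \<Rightarrow> 'a set \<Rightarrow> ennreal" where
  "diam d A = (SUP a\<in>A. SUP b\<in>A. d a b)"

definition linf_dist ::
  "('a \<Rightarrow> 'a \<Rightarrow> ennreal) \<Rightarrow> ('b \<Rightarrow> 'b \<Rightarrow> ennreal) \<Rightarrow> 'a \<times> 'b \<Rightarrow> 'a \<times> 'b \<Rightarrow> ennreal" where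
  "linf_dist d e p q = max (d (fst p) (fst q)) (e (snd p) (snd q))"

definition close_on ::
  "real \<Rightarrow> 'a set \<Rightarrow> ('b \<Rightarrow> 'b \<Rightarrow> ennreal) \<Rightarrow> ('a \<Rightarrow> 'b) \<Rightarrow> ('a \<Rightarrow> 'b) \<Rightarrow> bool" where
  "close_on \<kappa> A d f g \<longleftrightarrow> (\<forall>x\<in>A. d (f x) (g x) \<le> ennreal \<kappa>)"

definition affine_control ::
  "real \<Rightarrow> real \<Rightarrow> 'a set \<Rightarrow> ('a \<Rightarrow> 'a \<Rightarrow> ennreal) \<Rightarrow> ('b \<Rightarrow> 'b \<Rightarrow> ennreal) \<Rightarrow> ('a \<Rightarrow> 'b) \<Rightarrow> bool" where
  "affine_control a b A d e f \<longleftrightarrow>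
     (\<forall>x\<in>A. \<forall>y\<in>A. d x y < \<infinity> \<longrightarrow> e (f x) (f y) \<le> ennreal a * d x y + ennreal b)"

definition coarsely_lipschitz ::
  "'a set \<Rightarrow> ('a \<Rightarrow> 'a \<Rightarrow> ennreal) \<Rightarrow> 'b set \<Rightarrow> ('b \<Rightarrow> 'b \<Rightarrow> ennreal) \<Rightarrow> ('a \<Rightarrow> 'b) \<Rightarrow> bool" where
  "coarsely_lipschitz A d B e f \<longleftrightarrow>
     f \<in> A \<rightarrow> B \<and> (\<exists>a\<ge>0. \<exists>b\<ge>0. affine_control a b A d e f)"

definition coarse_retraction ::
  "'a set \<Rightarrow> ('a \<Rightarrow> 'a \<Rightarrow> ennreal) \<Rightarrow> 'a set \<Rightarrow> ('a \<Rightarrow> 'a) \<Rightarrow> bool" where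
  "coarse_retraction A d A' r \<longleftrightarrow>
     A' \<subseteq> A \<and> coarsely_lipschitz A d A' d r \<and> (\<exists>K\<ge>0. close_on K A' d r (\<lambda>x. x))"

definition uniform_coarse_retractions ::
  "'i set \<Rightarrow> ('i \<Rightarrow> 'c set) \<Rightarrow> ('i \<Rightarrow> 'c \<Rightarrow> 'c \<Rightarrow> ennreal) \<Rightarrow> ('i \<Rightarrow> 'c set) \<Rightarrow> ('i \<Rightarrow> 'c \<Rightarrow> 'c) \<Rightarrow> bool" where
  "uniform_coarse_retractions S C d C' \<alpha> \<longleftrightarrow>
     (\<forall>U\<in>S. C' U \<subseteq> C U \<and> \<alpha> U \<in> C U \<rightarrow> C' U) \<and>
     (\<exists>a\<ge>0. \<exists>b\<ge>0. \<forall>U\<in>S. affine_control a b (C U) (d U) (d U) (\<alpha> U)) \<and>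
     (\<exists>K\<ge>0. \<forall>U\<in>S. close_on K (C' U) (d U) (\<alpha> U) (\<lambda>x. x))"

definition quasi_isometry ::
  "'a set \<Rightarrow> ('a \<Rightarrow> 'a \<Rightarrow> ennreal) \<Rightarrow> 'b set \<Rightarrow> ('b \<Rightarrow> 'b \<Rightarrow> ennreal) \<Rightarrow> ('a \<Rightarrow> 'b) \<Rightarrow> bool" where
  "quasi_isometry A d B e f \<longleftrightarrow>
     f \<in> A \<rightarrow> B \<and>
     (\<exists>a\<ge>1. \<exists>b\<ge>0.
        (\<forall>x\<in>A. \<forall>y\<in>A. e (f x) (f y) \<le> ennreal a * d x y + ennreal b \<and>
                     d x y \<le> ennreal a * e (f x) (f y) + ennreal b) \<and>
        (\<forall>z\<in>B. \<exists>x\<in>A. e z (f x) \<le> ennreal b))"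

text \<open>
  The infimum over the empty set is \<open>\<infinity>\<close>, so distinct components of the graph are at
  infinite distance.
\<close>

definition graph_dist :: "('a \<times> 'a) set \<Rightarrow> 'a \<Rightarrow> 'a \<Rightarrow> ennreal" where
  "graph_dist E x y = (INF n\<in>{n. (x, y) \<in> E ^^ n}. of_nat n)"

text \<open>
  The vertices of the graph are taken in the same type as the space. This loses no generality:
  if a space is quasi-isometric to a graph, then it is quasi-isometric to the graph on its own
  points in which points at distance at most \<open>r\<close> are adjacent, for a suitable finite \<open>r\<close>.
\<close>

definition quasigeodesic :: "'a set \<Rightarrow> ('a \<Rightarrow> 'a \<Rightarrow> ennreal) \<Rightarrow> bool" where
  "quasigeodesic A d \<longleftrightarrow>
     (\<exists>(V :: 'a set) E f. E \<subseteq> V \<times> V \<and> sym E \<and> irrefl E \<and> quasi_isometry A d V (graph_dist E) f)"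


section \<open>Hyperbolic geodesic spaces\<close>

definition geodesic_seg ::
  "'a set \<Rightarrow> ('a \<Rightarrow> 'a \<Rightarrow> ennreal) \<Rightarrow> real \<Rightarrow> (real \<Rightarrow> 'a) \<Rightarrow> bool" where
  "geodesic_seg M d L \<gamma> \<longleftrightarrow>
     0 \<le> L \<and> \<gamma> \<in> {0..L} \<rightarrow> M \<and> (\<forall>s\<in>{0..L}. \<forall>t\<in>{0..L}. d (\<gamma> s) (\<gamma> t) = ennreal \<bar>s - t\<bar>)"

definition geodesic_image_between ::
  "'a set \<Rightarrow> ('a \<Rightarrow> 'a \<Rightarrow> ennreal) \<Rightarrow> 'a \<Rightarrow> 'a \<Rightarrow> 'a set \<Rightarrow> bool" where
  "geodesic_image_between M d x y G \<longleftrightarrow>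
     (\<exists>L \<gamma>. geodesic_seg M d L \<gamma> \<and> \<gamma> 0 = x \<and> \<gamma> L = y \<and> G = \<gamma> ` {0..L})"

text \<open>Hyperbolicity is expressed by slim geodesic triangles.\<close>

definition hyperbolic_geodesic_space ::
  "real \<Rightarrow> 'a set \<Rightarrow> ('a \<Rightarrow> 'a \<Rightarrow> ennreal) \<Rightarrow> bool" where
  "hyperbolic_geodesic_space \<delta> M d \<longleftrightarrow>
     ext_metric M d \<and>
     (\<forall>x\<in>M. \<forall>y\<in>M. \<exists>G. geodesic_image_between M d x y G) \<and>
     (\<forall>x y z G1 G2 G3.
        geodesic_image_between M d x y G1 \<longrightarrow> geodesic_image_between M d y z G2 \<longrightarrow>
        geodesic_image_between M d x z G3 \<longrightarrow>
        (\<forall>p\<in>G1. \<exists>q\<in>G2 \<union> G3. d p q \<le> ennreal \<delta>))"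


section \<open>Cones and total spaces\<close>

text \<open>
  The diagram has one object \<open>R\<^bsub>UV\<^esub>\<close> for every unordered pair of distinct indices.
  It is presented by a family indexed by ordered pairs in which \<open>R V U\<close> is
  \<open>R U V\<close> with the coordinates exchanged; a leg to this object is likewise given in
  both orders, and the two are required to agree up to this exchange.
\<close>

definition total_diagram ::
  "'i set \<Rightarrow> ('i \<Rightarrow> 'c set) \<Rightarrow> ('i \<Rightarrow> 'c \<Rightarrow> 'c \<Rightarrow> ennreal) \<Rightarrow> ('i \<Rightarrow> 'i \<Rightarrow> ('c \<times> 'c) set) \<Rightarrow> bool" where
  "total_diagram S C d R \<longleftrightarrow>
     (\<forall>U\<in>S. ext_metric (C U) (d U)) \<and>
     (\<forall>U\<in>S. \<forall>V\<in>S. U \<noteq> V \<longrightarrow> R U V \<subseteq> C U \<times> C V \<and> R V U = prod.swap ` R U V)"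

definition qg_uc_cone ::
  "'i set \<Rightarrow> ('i \<Rightarrow> 'c set) \<Rightarrow> ('i \<Rightarrow> 'c \<Rightarrow> 'c \<Rightarrow> ennreal) \<Rightarrow> ('i \<Rightarrow> 'i \<Rightarrow> ('c \<times> 'c) set) \<Rightarrow>
   'w set \<Rightarrow> ('w \<Rightarrow> 'w \<Rightarrow> ennreal) \<Rightarrow> ('i \<Rightarrow> 'w \<Rightarrow> 'c) \<Rightarrow> ('i \<Rightarrow> 'i \<Rightarrow> 'w \<Rightarrow> 'c \<times> 'c) \<Rightarrow> bool" where
  "qg_uc_cone S C d R W dW \<mu> \<mu>2 \<longleftrightarrow>
     ext_metric W dW \<and> quasigeodesic W dW \<and>
     (\<forall>U\<in>S. \<mu> U \<in> W \<rightarrow> C U) \<and>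
     (\<forall>U\<in>S. \<forall>V\<in>S. U \<noteq> V \<longrightarrow>
        \<mu>2 U V \<in> W \<rightarrow> R U V \<and> (\<forall>w\<in>W. \<mu>2 V U w = prod.swap (\<mu>2 U V w))) \<and>
     (\<exists>a\<ge>0. \<exists>b\<ge>0.
        (\<forall>U\<in>S. affine_control a b W dW (d U) (\<mu> U)) \<and>
        (\<forall>U\<in>S. \<forall>V\<in>S. U \<noteq> V \<longrightarrow> affine_control a b W dW (linf_dist (d U) (d V)) (\<mu>2 U V))) \<and>
     (\<exists>\<kappa>\<ge>0. \<forall>U\<in>S. \<forall>V\<in>S. U \<noteq> V \<longrightarrow>
        close_on \<kappa> W (d U) (fst \<circ> \<mu>2 U V) (\<mu> U) \<and> close_on \<kappa> W (d V) (snd \<circ> \<mu>2 U V) (\<mu> V))"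

definition cone_factorisation ::
  "'i set \<Rightarrow> ('i \<Rightarrow> 'c \<Rightarrow> 'c \<Rightarrow> ennreal) \<Rightarrow>
   'x set \<Rightarrow> ('x \<Rightarrow> 'x \<Rightarrow> ennreal) \<Rightarrow> ('i \<Rightarrow> 'x \<Rightarrow> 'c) \<Rightarrow> ('i \<Rightarrow> 'i \<Rightarrow> 'x \<Rightarrow> 'c \<times> 'c) \<Rightarrow>
   'w set \<Rightarrow> ('w \<Rightarrow> 'w \<Rightarrow> ennreal) \<Rightarrow> ('i \<Rightarrow> 'w \<Rightarrow> 'c) \<Rightarrow> ('i \<Rightarrow> 'i \<Rightarrow> 'w \<Rightarrow> 'c \<times> 'c) \<Rightarrow>
   ('w \<Rightarrow> 'x) \<Rightarrow> bool" where
  "cone_factorisation S d X dX lam lam2 W dW \<mu> \<mu>2 f \<longleftrightarrow>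
     coarsely_lipschitz W dW X dX f \<and>
     (\<exists>\<kappa>\<ge>0.
        (\<forall>U\<in>S. close_on \<kappa> W (d U) (\<mu> U) (lam U \<circ> f)) \<and>
        (\<forall>U\<in>S. \<forall>V\<in>S. U \<noteq> V \<longrightarrow>
           close_on \<kappa> W (linf_dist (d U) (d V)) (\<mu>2 U V) (lam2 U V \<circ> f)))"

text \<open>
  The universal property ranges over all cones whose apex is carried by a set of elements of
  the type given by the first argument. A fact about this predicate with a type variable there
  speaks about cones with arbitrary apex.
\<close>

definition universal_qg_uc_cone ::
  "'w itself \<Rightarrow> 'i set \<Rightarrow> ('i \<Rightarrow> 'c set) \<Rightarrow> ('i \<Rightarrow> 'c \<Rightarrow> 'c \<Rightarrow> ennreal) \<Rightarrow>
   ('i \<Rightarrow> 'i \<Rightarrow> ('c \<times> 'c) set) \<Rightarrow>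
   'x set \<Rightarrow> ('x \<Rightarrow> 'x \<Rightarrow> ennreal) \<Rightarrow> ('i \<Rightarrow> 'x \<Rightarrow> 'c) \<Rightarrow> ('i \<Rightarrow> 'i \<Rightarrow> 'x \<Rightarrow> 'c \<times> 'c) \<Rightarrow> bool" where
  "universal_qg_uc_cone (_ :: 'w itself) S C d R X dX lam lam2 \<longleftrightarrow>
     total_diagram S C d R \<and>
     qg_uc_cone S C d R X dX lam lam2 \<and>
     (\<forall>(W :: 'w set) dW \<mu> \<mu>2. qg_uc_cone S C d R W dW \<mu> \<mu>2 \<longrightarrow>
        (\<exists>f. cone_factorisation S d X dX lam lam2 W dW \<mu> \<mu>2 f) \<and>
        (\<forall>f g. cone_factorisation S d X dX lam lam2 W dW \<mu> \<mu>2 f \<longrightarrow>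
               cone_factorisation S d X dX lam lam2 W dW \<mu> \<mu>2 g \<longrightarrow>
               (\<exists>\<kappa>\<ge>0. close_on \<kappa> W dX f g)))"


section \<open>Hierarchically hyperbolic spaces\<close>

definition transverse :: "('i \<Rightarrow> 'i \<Rightarrow> bool) \<Rightarrow> ('i \<Rightarrow> 'i \<Rightarrow> bool) \<Rightarrow> 'i \<Rightarrow> 'i \<Rightarrow> bool" where
  "transverse nest orth V W \<longleftrightarrow> V \<noteq> W \<and> \<not> nest V W \<and> \<not> nest W V \<and> \<not> orth V W"

text \<open>
  \<open>\<rho> V W\<close> is the subset \<open>\<rho>\<^sup>V\<^sub>W\<close> of \<open>C W\<close> (for \<open>V\<close> properly nested in, or transverse
  to, \<open>W\<close>), and \<open>\<rho>m W V\<close> is the map \<open>\<rho>\<^sup>W\<^sub>V\<close> from \<open>C W\<close> to subsets of \<open>C V\<close> (for \<open>V\<close>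
  properly nested in \<open>W\<close>). The constants whose existence is required in the definition of a
  hierarchically hyperbolic space are parameters of the locale.

  In \<open>large_links\<close> the domains \<open>T\<^sub>i\<close> form a set of at most \<open>\<lfloor>N\<rfloor>\<close> elements. As \<open>N \<ge> 1\<close>,
  insisting on exactly \<open>\<lfloor>N\<rfloor>\<close> of them would be contradictory for a minimal \<open>W\<close>.
\<close>

locale hierarchically_hyperbolic_space =
  fixes X :: "'x set" and dX :: "'x \<Rightarrow> 'x \<Rightarrow> ennreal"
    and S :: "'i set" and \<delta> :: real
    and C :: "'i \<Rightarrow> 'c set" and d :: "'i \<Rightarrow> 'c \<Rightarrow> 'c \<Rightarrow> ennreal"
    and \<pi> :: "'i \<Rightarrow> 'x \<Rightarrow> 'c set"
    and nest :: "'i \<Rightarrow> 'i \<Rightarrow> bool" (infix "\<sqsubseteq>" 50)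
    and orth :: "'i \<Rightarrow> 'i \<Rightarrow> bool" (infix "\<bottom>" 50)
    and \<rho> :: "'i \<Rightarrow> 'i \<Rightarrow> 'c set" and \<rho>m :: "'i \<Rightarrow> 'i \<Rightarrow> 'c \<Rightarrow> 'c set"
    and \<xi> K0 \<kappa>0 :: real and n :: nat and l E \<alpha>0 :: real and \<theta> :: "real \<Rightarrow> real"
  assumes space: "ext_metric X dX" "X \<noteq> {}" "quasigeodesic X dX"
      "\<And>x y. \<lbrakk>x \<in> X; y \<in> X\<rbrakk> \<Longrightarrow> dX x y < \<infinity>"
    and constants: "0 \<le> \<delta>" "0 \<le> \<xi>" "0 \<le> K0" "0 \<le> \<kappa>0" "1 \<le> l" "max \<xi> \<kappa>0 \<le> E" "0 \<le> \<alpha>0"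
    and hyperbolic: "\<And>W. W \<in> S \<Longrightarrow> hyperbolic_geodesic_space \<delta> (C W) (d W)"
    and projections:
      "\<And>W x. \<lbrakk>W \<in> S; x \<in> X\<rbrakk> \<Longrightarrow> \<pi> W x \<noteq> {} \<and> \<pi> W x \<subseteq> C W \<and> diam (d W) (\<pi> W x) \<le> ennreal \<xi>"
      "\<And>W x y. \<lbrakk>W \<in> S; x \<in> X; y \<in> X\<rbrakk> \<Longrightarrow>
         dist_sets (d W) (\<pi> W x) (\<pi> W y) \<le> ennreal K0 * dX x y + ennreal K0"
      "\<And>W p. \<lbrakk>W \<in> S; p \<in> C W\<rbrakk> \<Longrightarrow> \<exists>x\<in>X. \<exists>q\<in>\<pi> W x. d W p q \<le> ennreal K0"
    and nesting:
      "reflp_on S (\<sqsubseteq>)" "antisymp_on S (\<sqsubseteq>)" "transp_on S (\<sqsubseteq>)"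
      "S = {} \<or> (\<exists>!M. M \<in> S \<and> (\<forall>V\<in>S. M \<sqsubseteq> V \<longrightarrow> V = M))"
      "\<And>V W. \<lbrakk>V \<in> S; W \<in> S; V \<sqsubseteq> W; V \<noteq> W\<rbrakk> \<Longrightarrow>
         \<rho> V W \<noteq> {} \<and> \<rho> V W \<subseteq> C W \<and> diam (d W) (\<rho> V W) \<le> ennreal \<xi>"
      "\<And>V W p. \<lbrakk>V \<in> S; W \<in> S; V \<sqsubseteq> W; V \<noteq> W; p \<in> C W\<rbrakk> \<Longrightarrow> \<rho>m W V p \<noteq> {} \<and> \<rho>m W V p \<subseteq> C V"
    and orthogonality:
      "symp_on S (\<bottom>)" "irreflp_on S (\<bottom>)"
      "\<And>V W U. \<lbrakk>V \<in> S; W \<in> S; U \<in> S; V \<sqsubseteq> W; W \<bottom> U\<rbrakk> \<Longrightarrow> V \<bottom> U"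
      "\<And>T U. \<lbrakk>T \<in> S; U \<in> S; U \<sqsubseteq> T; \<exists>V\<in>S. V \<sqsubseteq> T \<and> V \<bottom> U\<rbrakk> \<Longrightarrow>
         \<exists>W\<in>S. W \<sqsubseteq> T \<and> W \<noteq> T \<and> (\<forall>V\<in>S. V \<bottom> U \<and> V \<sqsubseteq> T \<longrightarrow> V \<sqsubseteq> W)"
      "\<And>V W. \<lbrakk>V \<in> S; W \<in> S; V \<bottom> W\<rbrakk> \<Longrightarrow> \<not> V \<sqsubseteq> W \<and> \<not> W \<sqsubseteq> V"
    and transversality:
      "\<And>V W. \<lbrakk>V \<in> S; W \<in> S; transverse (\<sqsubseteq>) (\<bottom>) V W\<rbrakk> \<Longrightarrow>
         \<rho> V W \<noteq> {} \<and> \<rho> V W \<subseteq> C W \<and> diam (d W) (\<rho> V W) \<le> ennreal \<xi>"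
    and consistency:
      "\<And>V W x. \<lbrakk>V \<in> S; W \<in> S; transverse (\<sqsubseteq>) (\<bottom>) V W; x \<in> X\<rbrakk> \<Longrightarrow>
         min (dist_sets (d W) (\<pi> W x) (\<rho> V W)) (dist_sets (d V) (\<pi> V x) (\<rho> W V)) \<le> ennreal \<kappa>0"
      "\<And>V W x. \<lbrakk>V \<in> S; W \<in> S; V \<sqsubseteq> W; V \<noteq> W; x \<in> X\<rbrakk> \<Longrightarrow>
         min (dist_sets (d W) (\<pi> W x) (\<rho> V W))
             (diam (d V) (\<pi> V x \<union> (\<Union>p\<in>\<pi> W x. \<rho>m W V p))) \<le> ennreal \<kappa>0"
      "\<And>U V W. \<lbrakk>U \<in> S; V \<in> S; W \<in> S; U \<sqsubseteq> V;
                (V \<sqsubseteq> W \<and> V \<noteq> W) \<or> (transverse (\<sqsubseteq>) (\<bottom>) V W \<and> \<not> W \<bottom> U)\<rbrakk> \<Longrightarrow>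
         dist_sets (d W) (\<rho> U W) (\<rho> V W) \<le> ennreal \<kappa>0"
    and finite_complexity:
      "\<And>A. \<lbrakk>A \<subseteq> S; \<forall>V\<in>A. \<forall>W\<in>A. V \<sqsubseteq> W \<or> W \<sqsubseteq> V\<rbrakk> \<Longrightarrow> finite A \<and> card A \<le> n"
    and large_links:
      "\<And>W x x' N. \<lbrakk>W \<in> S; x \<in> X; x' \<in> X;
                   N = l * enn2real (dist_sets (d W) (\<pi> W x) (\<pi> W x')) + l\<rbrakk> \<Longrightarrow>
         \<exists>\<T>. \<T> \<subseteq> {V \<in> S. V \<sqsubseteq> W} - {W} \<and> finite \<T> \<and> int (card \<T>) \<le> \<lfloor>N\<rfloor> \<and>
             (\<forall>T\<in>{V \<in> S. V \<sqsubseteq> W} - {W}.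
                (\<exists>T'\<in>\<T>. T \<sqsubseteq> T') \<or> dist_sets (d T) (\<pi> T x) (\<pi> T x') < ennreal E) \<and>
             (\<forall>T'\<in>\<T>. dist_sets (d W) (\<pi> W x) (\<rho> T' W) \<le> ennreal N)"
    and bounded_geodesic_image:
      "\<And>V W L \<gamma>. \<lbrakk>V \<in> S; W \<in> S; V \<sqsubseteq> W; V \<noteq> W; geodesic_seg (C W) (d W) L \<gamma>\<rbrakk> \<Longrightarrow>
         diam (d V) (\<Union>t\<in>{0..L}. \<rho>m W V (\<gamma> t)) \<le> ennreal E \<or>
         (\<exists>t\<in>{0..L}. dist_sets (d W) {\<gamma> t} (\<rho> V W) \<le> ennreal E)"
    and partial_realisation:
      "\<And>F p. \<lbrakk>F \<subseteq> S; \<forall>V\<in>F. \<forall>W\<in>F. V \<noteq> W \<longrightarrow> V \<bottom> W; \<forall>V\<in>F. p V \<in> (\<Union>x\<in>X. \<pi> V x)\<rbrakk> \<Longrightarrow>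
         \<exists>x\<in>X. (\<forall>V\<in>F. dist_sets (d V) (\<pi> V x) {p V} \<le> ennreal \<alpha>0) \<and>
             (\<forall>V\<in>F. \<forall>W\<in>S. (V \<sqsubseteq> W \<and> V \<noteq> W) \<or> transverse (\<sqsubseteq>) (\<bottom>) W V \<longrightarrow>
                dist_sets (d W) (\<pi> W x) (\<rho> V W) \<le> ennreal \<alpha>0)"
    and uniqueness:
      "\<And>\<kappa> x y. \<lbrakk>0 \<le> \<kappa>; x \<in> X; y \<in> X; ennreal (\<theta> \<kappa>) \<le> dX x y\<rbrakk> \<Longrightarrow>
         \<exists>V\<in>S. ennreal \<kappa> \<le> dist_sets (d V) (\<pi> V x) (\<pi> V y)"

definition consistent_pairs ::
  "('i \<Rightarrow> 'c set) \<Rightarrow> ('i \<Rightarrow> 'c \<Rightarrow> 'c \<Rightarrow> ennreal) \<Rightarrow> ('i \<Rightarrow> 'i \<Rightarrow> bool) \<Rightarrow> ('i \<Rightarrow> 'i \<Rightarrow> bool) \<Rightarrow>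
   ('i \<Rightarrow> 'i \<Rightarrow> 'c set) \<Rightarrow> ('i \<Rightarrow> 'i \<Rightarrow> 'c \<Rightarrow> 'c set) \<Rightarrow> real \<Rightarrow> 'i \<Rightarrow> 'i \<Rightarrow> ('c \<times> 'c) set" where
  "consistent_pairs C d nest orth \<rho> \<rho>m \<epsilon> U V =
     {(x, y) \<in> C U \<times> C V.
        (transverse nest orth U V \<longrightarrow>
           min (dist_sets (d U) {x} (\<rho> V U)) (dist_sets (d V) {y} (\<rho> U V)) \<le> ennreal \<epsilon>) \<and>
        (nest U V \<and> U \<noteq> V \<longrightarrow>
           min (dist_sets (d V) {y} (\<rho> U V)) (diam (d U) ({x} \<union> \<rho>m V U y)) \<le> ennreal \<epsilon>) \<and>
        (nest V U \<and> U \<noteq> V \<longrightarrow>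
           min (dist_sets (d U) {x} (\<rho> V U)) (diam (d V) ({y} \<union> \<rho>m U V x)) \<le> ennreal \<epsilon>)}"


section \<open>Induced retractions\<close>

definition consistent_up_to_error ::
  "'i set \<Rightarrow> ('i \<Rightarrow> 'c \<Rightarrow> 'c \<Rightarrow> ennreal) \<Rightarrow> ('i \<Rightarrow> 'i \<Rightarrow> ('c \<times> 'c) set) \<Rightarrow> ('i \<Rightarrow> 'c \<Rightarrow> 'c) \<Rightarrow> bool" where
  "consistent_up_to_error S d R \<alpha> \<longleftrightarrow>
     (\<exists>c\<ge>0. \<forall>U\<in>S. \<forall>V\<in>S. U \<noteq> V \<longrightarrow>
        (\<forall>(x, y)\<in>R U V. \<exists>q\<in>R U V. linf_dist (d U) (d V) (\<alpha> U x, \<alpha> V y) q \<le> ennreal c))"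

definition image_constraints ::
  "('i \<Rightarrow> 'c \<Rightarrow> 'c) \<Rightarrow> ('i \<Rightarrow> 'i \<Rightarrow> ('c \<times> 'c) set) \<Rightarrow> 'i \<Rightarrow> 'i \<Rightarrow> ('c \<times> 'c) set" where
  "image_constraints \<alpha> R U V = map_prod (\<alpha> U) (\<alpha> V) ` R U V"

text \<open>
  The map \<open>r\<close> is a coarsely Lipschitz retraction of \<open>X\<close> onto \<open>X'\<close>, and \<open>lam'\<close>, \<open>lam2'\<close> are the
  legs of a cone with apex \<open>X'\<close> over the restricted diagram, compatible with \<open>r\<close> and with the
  inclusion of \<open>X'\<close> in \<open>X\<close>. Universality of that cone is not part of this definition: HOL cannot
  quantify over types of test apices under an existential quantifier, so one asserts that an
  induced retraction exists and, separately and polymorphically in the apex type, that the cone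
  of every induced retraction is universal.
\<close>

definition induced_retraction ::
  "'x set \<Rightarrow> ('x \<Rightarrow> 'x \<Rightarrow> ennreal) \<Rightarrow> 'i set \<Rightarrow> ('i \<Rightarrow> 'c \<Rightarrow> 'c \<Rightarrow> ennreal) \<Rightarrow>
   ('i \<Rightarrow> 'i \<Rightarrow> ('c \<times> 'c) set) \<Rightarrow> ('i \<Rightarrow> 'x \<Rightarrow> 'c) \<Rightarrow> ('i \<Rightarrow> 'c set) \<Rightarrow> ('i \<Rightarrow> 'c \<Rightarrow> 'c) \<Rightarrow>
   'x set \<Rightarrow> ('x \<Rightarrow> 'x) \<Rightarrow> ('i \<Rightarrow> 'x \<Rightarrow> 'c) \<Rightarrow> ('i \<Rightarrow> 'i \<Rightarrow> 'x \<Rightarrow> 'c \<times> 'c) \<Rightarrow> bool" where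
  "induced_retraction X dX S d R lam C' \<alpha> X' r lam' lam2' \<longleftrightarrow>
     coarse_retraction X dX X' r \<and>
     qg_uc_cone S C' d (image_constraints \<alpha> R) X' dX lam' lam2' \<and>
     (\<exists>\<kappa>\<ge>0. \<forall>U\<in>S. close_on \<kappa> X (d U) (lam' U \<circ> r) (\<alpha> U \<circ> lam U)) \<and>
     (\<exists>\<kappa>\<ge>0. \<forall>U\<in>S. close_on \<kappa> X' (d U) (lam U) (lam' U))"

end

(*
  The heart of the matter is the realisation theorem: a tuple b that is consistent up to a uniform
  error is, up to a uniform error, the tuple of coordinates of a point.  Maintain a family of
  pairwise orthogonal domains U such that b looks like a point of the product region of each U, and
  let x be a partial realisation of b on the family.  If x does not realise b, consider the
  nest-maximal domains T on which x and b differ.  As in the Behrstock order, two transverse ones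
  are ordered along the way from x to b.  By the large links axiom a domain has boundedly many
  predecessors, so there is a last T, and b looks like a point of its product region.  Either T is
  orthogonal to the whole family and is added to it, or T is properly nested in a single member,
  which it replaces.  Both moves increase the sum of the depths of the members, which is at most
  n^2, so the procedure stops after at most n^2 moves.

  Given realisation, let r x realise the tuple of the alpha_U (lam_U x).  By the uniqueness axiom
  closeness in X is detected by coordinates, and a map out of a quasigeodesic space is coarsely
  Lipschitz as soon as it distorts bounded distances boundedly.  A test cone over the retracted
  constraints is a nearly consistent tuple of maps; it factors through X by realisation and then
  through X' by composing with r.
*)

theory Submission
  imports Defs
begin

text \<open>The main obstacle is that \<open>b\<close> is not a point, while large links and the
  uniqueness axiom compare points only. Comparisons that involve several domains therefore pass
  through auxiliary points \<open>y\<close>, obtained by partial realisation on one or two domains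
  and agreeing with \<open>b\<close> where it matters. No bound on the number of maximal bad domains
  is at hand, only on the number of predecessors of each, and this is what provides a last one. The
  order between them is transitive because the threshold for disagreement is at least four times the
  consistency error: a rough estimate then improves itself to the sharp one. Each move of the
  procedure costs five times the consistency error, so the final error depends on that error and
  \<open>n\<close> but not on \<open>b\<close>. This uniformity turns pointwise realisation into
  maps with controlled coordinates. The function \<open>\<theta>\<close> of the uniqueness axiom may
  grow arbitrarily, so coordinates control distances only scale by scale. Affine control has to come
  from chains in quasigeodesic spaces. Chains also show that \<open>X'\<close> is quasigeodesic,
  which is part of being the apex of a cone.\<close>

section \<open>Realisation of consistent tuples\<close>

text \<open>
  A coordinate system with real distances \<open>e\<close>, in which the sets \<open>\<rho> V W\<close> and \<open>\<rho>m W V p\<close> are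
  replaced by points \<open>r V W\<close> and \<open>s W V p\<close> and all errors by a single constant \<open>A\<close>.
\<close>

locale coarse_hierarchy =
  fixes X :: "'x set" and S :: "'i set" and C :: "'i \<Rightarrow> 'c set" and e :: "'i \<Rightarrow> 'c \<Rightarrow> 'c \<Rightarrow> real"
    and L :: "'i \<Rightarrow> 'x \<Rightarrow> 'c"
    and nest :: "'i \<Rightarrow> 'i \<Rightarrow> bool" (infix "\<sqsubseteq>" 50)
    and orth :: "'i \<Rightarrow> 'i \<Rightarrow> bool" (infix "\<bottom>" 50)
    and r :: "'i \<Rightarrow> 'i \<Rightarrow> 'c" and s :: "'i \<Rightarrow> 'i \<Rightarrow> 'c \<Rightarrow> 'c"
    and A :: real and n :: nat and l :: real
  assumes const: "0 \<le> A" "0 \<le> l"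
    and e_sym: "\<And>U p q. \<lbrakk>U \<in> S; p \<in> C U; q \<in> C U\<rbrakk> \<Longrightarrow> e U p q = e U q p"
    and e_tri: "\<And>U p q t. \<lbrakk>U \<in> S; p \<in> C U; q \<in> C U; t \<in> C U\<rbrakk> \<Longrightarrow> e U p t \<le> e U p q + e U q t"
    and L_in: "\<And>U x. \<lbrakk>U \<in> S; x \<in> X\<rbrakk> \<Longrightarrow> L U x \<in> C U"
    and nest_refl: "\<And>V. V \<in> S \<Longrightarrow> V \<sqsubseteq> V"
    and nest_antisym: "\<And>V W. \<lbrakk>V \<in> S; W \<in> S; V \<sqsubseteq> W; W \<sqsubseteq> V\<rbrakk> \<Longrightarrow> V = W"
    and nest_trans: "\<And>U V W. \<lbrakk>U \<in> S; V \<in> S; W \<in> S; U \<sqsubseteq> V; V \<sqsubseteq> W\<rbrakk> \<Longrightarrow> U \<sqsubseteq> W"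
    and unique_max: "\<And>M M'. \<lbrakk>M \<in> S; M' \<in> S; \<forall>V\<in>S. M \<sqsubseteq> V \<longrightarrow> V = M; \<forall>V\<in>S. M' \<sqsubseteq> V \<longrightarrow> V = M'\<rbrakk> \<Longrightarrow> M = M'"
    and orth_sym: "\<And>V W. \<lbrakk>V \<in> S; W \<in> S; V \<bottom> W\<rbrakk> \<Longrightarrow> W \<bottom> V"
    and orth_irrefl: "\<And>V. V \<in> S \<Longrightarrow> \<not> V \<bottom> V"
    and orth_nest: "\<And>V W U. \<lbrakk>V \<in> S; W \<in> S; U \<in> S; V \<sqsubseteq> W; W \<bottom> U\<rbrakk> \<Longrightarrow> V \<bottom> U"
    and container: "\<And>T U V. \<lbrakk>T \<in> S; U \<in> S; U \<sqsubseteq> T; V \<in> S; V \<sqsubseteq> T; V \<bottom> U\<rbrakk> \<Longrightarrow>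
         \<exists>W\<in>S. W \<sqsubseteq> T \<and> W \<noteq> T \<and> (\<forall>V\<in>S. V \<bottom> U \<and> V \<sqsubseteq> T \<longrightarrow> V \<sqsubseteq> W)"
    and orth_incomparable: "\<And>V W. \<lbrakk>V \<in> S; W \<in> S; V \<bottom> W\<rbrakk> \<Longrightarrow> \<not> V \<sqsubseteq> W \<and> \<not> W \<sqsubseteq> V"
    and r_in: "\<And>V W. \<lbrakk>V \<in> S; W \<in> S; (V \<sqsubseteq> W \<and> V \<noteq> W) \<or> transverse (\<sqsubseteq>) (\<bottom>) V W\<rbrakk> \<Longrightarrow> r V W \<in> C W"
    and s_in: "\<And>V W p. \<lbrakk>V \<in> S; W \<in> S; V \<sqsubseteq> W; V \<noteq> W; p \<in> C W\<rbrakk> \<Longrightarrow> s W V p \<in> C V"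
    and L_transverse: "\<And>V W x. \<lbrakk>V \<in> S; W \<in> S; transverse (\<sqsubseteq>) (\<bottom>) V W; x \<in> X\<rbrakk> \<Longrightarrow>
         e W (L W x) (r V W) \<le> A \<or> e V (L V x) (r W V) \<le> A"
    and L_nested: "\<And>V W x. \<lbrakk>V \<in> S; W \<in> S; V \<sqsubseteq> W; V \<noteq> W; x \<in> X\<rbrakk> \<Longrightarrow>
         e W (L W x) (r V W) \<le> A \<or> e V (L V x) (s W V (L W x)) \<le> A"
    and r_nested: "\<And>U V W. \<lbrakk>U \<in> S; V \<in> S; W \<in> S; U \<sqsubseteq> V; transverse (\<sqsubseteq>) (\<bottom>) V W; \<not> W \<bottom> U\<rbrakk> \<Longrightarrow>
         e W (r U W) (r V W) \<le> A"
    and finite_complexity: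
      "\<And>B. \<lbrakk>B \<subseteq> S; \<forall>V\<in>B. \<forall>W\<in>B. V \<sqsubseteq> W \<or> W \<sqsubseteq> V\<rbrakk> \<Longrightarrow> finite B \<and> card B \<le> n"
    and large_links:
      "\<And>W x x' D. \<lbrakk>W \<in> S; x \<in> X; x' \<in> X; e W (L W x) (L W x') \<le> D\<rbrakk> \<Longrightarrow>
         \<exists>\<T>. \<T> \<subseteq> {V \<in> S. V \<sqsubseteq> W} - {W} \<and> finite \<T> \<and> card \<T> \<le> nat \<lfloor>l * D + l\<rfloor> \<and>
             (\<forall>T\<in>{V \<in> S. V \<sqsubseteq> W} - {W}. A < e T (L T x) (L T x') \<longrightarrow> (\<exists>T'\<in>\<T>. T \<sqsubseteq> T'))"
    and bounded_geodesic_image: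
      "\<And>V W p q. \<lbrakk>V \<in> S; W \<in> S; V \<sqsubseteq> W; V \<noteq> W; p \<in> C W; q \<in> C W\<rbrakk> \<Longrightarrow>
         e W p (r V W) \<le> e W p q + A \<or> e V (s W V p) (s W V q) \<le> A"
    and partial_realisation:
      "\<And>F p. \<lbrakk>F \<subseteq> S; \<forall>V\<in>F. \<forall>W\<in>F. V \<noteq> W \<longrightarrow> V \<bottom> W; \<forall>V\<in>F. p V \<in> C V\<rbrakk> \<Longrightarrow>
         \<exists>x\<in>X. (\<forall>V\<in>F. e V (L V x) (p V) \<le> A) \<and>
             (\<forall>V\<in>F. \<forall>W\<in>S. (V \<sqsubseteq> W \<and> V \<noteq> W) \<or> transverse (\<sqsubseteq>) (\<bottom>) V W \<longrightarrow>
                e W (L W x) (r V W) \<le> A)"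
begin

abbreviation properly_nested (infix "\<sqsubset>" 50) where "V \<sqsubset> W \<equiv> V \<sqsubseteq> W \<and> V \<noteq> W"
abbreviation trans_to (infix "\<pitchfork>" 50) where "V \<pitchfork> W \<equiv> transverse (\<sqsubseteq>) (\<bottom>) V W"

lemma transverse_sym: "\<lbrakk>V \<in> S; W \<in> S; V \<pitchfork> W\<rbrakk> \<Longrightarrow> W \<pitchfork> V"
  unfolding transverse_def using orth_sym by blast

section \<open>Depth of domains, maximal domains and orthogonal families\<close>

definition chains_above :: "'i \<Rightarrow> 'i set set" where
  "chains_above U = {B. B \<subseteq> S \<and> U \<in> B \<and> (\<forall>V\<in>B. U \<sqsubseteq> V) \<and> (\<forall>V\<in>B. \<forall>W\<in>B. V \<sqsubseteq> W \<or> W \<sqsubseteq> V)}"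

text \<open>Measured from the top, so that passing to a properly nested domain increases it. This is
  the direction in which the realisation procedure moves.\<close>

definition depth :: "'i \<Rightarrow> nat" where
  "depth U = Max (card ` chains_above U)"

lemma finite_cards: "finite (card ` chains_above U)"
proof -
  have "card ` chains_above U \<subseteq> {..n}"
    using finite_complexity unfolding chains_above_def by auto
  then show ?thesis using finite_subset by blast
qed

lemma singleton_chain: "U \<in> S \<Longrightarrow> {U} \<in> chains_above U"
  unfolding chains_above_def using nest_refl by auto

lemma depth_pos: "U \<in> S \<Longrightarrow> 1 \<le> depth U"
  using Max_ge[OF finite_cards, of "card {U}" U] singleton_chain[of U] unfolding depth_def by force

lemma depth_le: assumes "U \<in> S" shows "depth U \<le> n"
proof -
  have "depth U \<in> card ` chains_above U"
    unfolding depth_def using finite_cards singleton_chain[OF assms] by (intro Max_in) auto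
  then show ?thesis
    using finite_complexity unfolding chains_above_def by auto
qed

lemma depth_less: assumes "T \<in> S" "U \<in> S" "T \<sqsubset> U" shows "depth U < depth T"
proof -
  have "depth U \<in> card ` chains_above U"
    unfolding depth_def using finite_cards singleton_chain[OF assms(2)] by (intro Max_in) auto
  then obtain B where B: "B \<in> chains_above U" "depth U = card B" by auto
  have fin: "finite B" using B finite_complexity unfolding chains_above_def by auto
  have "T \<notin> B" using B assms nest_antisym unfolding chains_above_def by auto
  moreover have "insert T B \<in> chains_above T"
  proof -
    have above: "T \<sqsubseteq> V" if "V \<in> B" for V
      using B that assms nest_trans[of T U V] unfolding chains_above_def by auto
    then show ?thesis using B assms nest_refl[of T] unfolding chains_above_def by auto
  qed
  ultimately show ?thesis
    using Max_ge[OF finite_cards, OF imageI, of "insert T B" T] fin B(2) unfolding depth_def[of T] by auto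
qed

text \<open>\<open>B\<close> may be infinite, but depths are natural numbers: an element of
  \<open>B\<close> above \<open>T\<close> of least depth is maximal in \<open>B\<close>.\<close>

lemma maximal_above:
  assumes "B \<subseteq> S" "T \<in> B"
  obtains M where "M \<in> B" "T \<sqsubseteq> M" "\<And>V. V \<in> B \<Longrightarrow> M \<sqsubseteq> V \<Longrightarrow> V = M"
proof -
  let ?P = "\<lambda>V. V \<in> B \<and> T \<sqsubseteq> V"
  have "?P T" using assms nest_refl by auto
  then obtain M where M: "?P M" "\<And>V. ?P V \<Longrightarrow> depth M \<le> depth V"
    using ex_has_least_nat[of ?P T depth] by auto
  have "V = M" if "V \<in> B" "M \<sqsubseteq> V" for V
  proof (rule ccontr)
    assume "V \<noteq> M"
    then have "depth V < depth M" using depth_less[of M V] that M assms by auto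
    moreover have "?P V" using that M assms nest_trans[of T M V] by auto
    ultimately show False using M(2) by fastforce
  qed
  then show ?thesis using that M(1) by blast
qed

text \<open>The axiom provides only a unique maximal element. It dominates all domains because each
  of them lies below some maximal one, which has to be this element.\<close>

lemma maximum:
  assumes "S \<noteq> {}"
  obtains M where "M \<in> S" "\<And>V. V \<in> S \<Longrightarrow> V \<sqsubseteq> M"
proof -
  obtain T where "T \<in> S" using assms by auto
  then obtain M where M: "M \<in> S" "\<And>V. V \<in> S \<Longrightarrow> M \<sqsubseteq> V \<Longrightarrow> V = M"
    using maximal_above[of S T] by blast
  have "V \<sqsubseteq> M" if V: "V \<in> S" for V
  proof -
    obtain M' where M': "M' \<in> S" "V \<sqsubseteq> M'" "\<And>V. V \<in> S \<Longrightarrow> M' \<sqsubseteq> V \<Longrightarrow> V = M'"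
      using maximal_above[of S V] V by blast
    have "M = M'" using unique_max[of M M'] M M' by blast
    then show ?thesis using M' by simp
  qed
  then show ?thesis using that M(1) by blast
qed

text \<open>After removal of one member \<open>U\<close>, the others are orthogonal to
  \<open>U\<close> and hence nested in a container properly below \<open>T\<close>. Each removal
  thus gains a unit of depth, and depth is at most \<open>n\<close>.\<close>

lemma card_orthogonal_below:
  assumes "finite F" "F \<subseteq> S" "\<forall>V\<in>F. \<forall>W\<in>F. V \<noteq> W \<longrightarrow> V \<bottom> W" "T \<in> S" "\<forall>V\<in>F. V \<sqsubseteq> T" "F \<noteq> {}"
  shows "card F + depth T \<le> n + 1"
  using assms
proof (induction F arbitrary: T rule: finite_induct)
  case empty
  then show ?case by simp
next
  case (insert U F)
  show ?case
  proof (cases "F = {}")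
    case True
    then show ?thesis using depth_le[OF insert.prems(3)] by simp
  next
    case False
    have orth: "V \<bottom> U" if "V \<in> F" for V using insert.prems(2) insert.hyps that by auto
    obtain V where "V \<in> F" using False by auto
    then obtain W where W: "W \<in> S" "W \<sqsubset> T" "\<forall>V\<in>S. V \<bottom> U \<and> V \<sqsubseteq> T \<longrightarrow> V \<sqsubseteq> W"
      using container[of T U V] insert.prems orth by auto
    have "card F + depth W \<le> n + 1"
    proof (rule insert.IH)
      show "\<forall>V\<in>F. V \<sqsubseteq> W" using W(3) orth insert.prems by auto
    qed (use insert.prems W False in auto)
    then show ?thesis
      using depth_less[OF W(1) insert.prems(3) W(2)] insert.hyps by simp
  qed
qed

lemma card_orthogonal:
  assumes "finite F" "F \<subseteq> S" "\<forall>V\<in>F. \<forall>W\<in>F. V \<noteq> W \<longrightarrow> V \<bottom> W"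
  shows "card F \<le> n"
proof (cases "F = {}")
  case False
  then obtain M where M: "M \<in> S" "\<And>V. V \<in> S \<Longrightarrow> V \<sqsubseteq> M" using maximum assms by auto
  then have "card F + depth M \<le> n + 1"
    using card_orthogonal_below[OF assms M(1)] assms(2) False by blast
  then show ?thesis using depth_pos[OF M(1)] by simp
qed simp

lemma sum_depth_orthogonal:
  assumes "finite F" "F \<subseteq> S" "\<forall>V\<in>F. \<forall>W\<in>F. V \<noteq> W \<longrightarrow> V \<bottom> W"
  shows "sum depth F \<le> n * n"
proof -
  have "sum depth F \<le> of_nat (card F) * n"
    using depth_le assms(2) by (intro sum_bounded_above) auto
  also have "\<dots> \<le> n * n" using card_orthogonal[OF assms] by simp
  finally show ?thesis .
qed

section \<open>Counting the domains on which two points differ\<close>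

definition link_bound :: "real \<Rightarrow> nat" where
  "link_bound D = Suc (nat \<lfloor>l * D + l\<rfloor>)"

text \<open>Induction on \<open>k\<close>, which bounds how far the depth of \<open>W\<close> falls
  short of \<open>n\<close>. If \<open>W\<close> itself is not in the antichain \<open>Z'\<close>,
  the few domains given by large links in \<open>W\<close> cover \<open>Z'\<close>, and they are
  deeper than \<open>W\<close>. The bound \<open>D\<close> on the distance in \<open>W\<close> is
  available as soon as some member of \<open>Z'\<close> is properly nested in
  \<open>W\<close>.\<close>

lemma card_relevant_below:
  assumes x: "x \<in> X" "x' \<in> X"
    and Z: "Z \<subseteq> S" "\<And>T. T \<in> Z \<Longrightarrow> A < e T (L T x) (L T x')"
      "\<And>T W. \<lbrakk>T \<in> Z; W \<in> S; T \<sqsubset> W\<rbrakk> \<Longrightarrow> e W (L W x) (L W x') \<le> D"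
      "\<And>T T'. \<lbrakk>T \<in> Z; T' \<in> Z; T \<sqsubseteq> T'\<rbrakk> \<Longrightarrow> T = T'"
  shows "\<lbrakk>W \<in> S; n \<le> depth W + k; \<forall>T\<in>Z'. T \<sqsubseteq> W; Z' \<subseteq> Z\<rbrakk> \<Longrightarrow>
    finite Z' \<and> card Z' \<le> link_bound D ^ k"
proof (induction k arbitrary: W Z')
  case 0
  \<comment> \<open>For \<open>k = 0\<close> the domain \<open>W\<close> has the largest possible
    depth \<open>n\<close>, so nothing is properly nested in it.\<close>
  have "T = W" if "T \<in> Z'" for T
    using depth_less[of T W] depth_le[of T] 0 that Z(1) by (metis add_0_right not_less order.trans subsetD)
  then have "Z' \<subseteq> {W}" by auto
  then show ?case using card_mono[of "{W}" Z'] finite_subset[of Z' "{W}"] by simp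
next
  case (Suc k)
  show ?case
  proof (cases "W \<in> Z' \<or> Z' = {}")
    case True
    then have "Z' \<subseteq> {W}" using Suc.prems Z(4)[of _ W] by blast
    \<comment> \<open>The \<open>Suc\<close> in \<open>link_bound\<close> keeps the base positive
      even when the floor contributes 0.\<close>
    moreover have "1 \<le> link_bound D ^ Suc k" unfolding link_bound_def by (rule one_le_power) simp
    moreover have "finite Z' \<and> card Z' \<le> 1"
      using calculation(1) card_mono[of "{W}" Z'] finite_subset[of Z' "{W}"] by simp
    ultimately show ?thesis by linarith
  next
    case False
    then obtain T0 where "T0 \<in> Z'" by auto
    then have "e W (L W x) (L W x') \<le> D" using Z(3)[of T0 W] Suc.prems False by auto
    from large_links[OF Suc.prems(1) x this]
    obtain \<T> where \<T>: "\<T> \<subseteq> {V \<in> S. V \<sqsubseteq> W} - {W}" "finite \<T>" "card \<T> \<le> nat \<lfloor>l * D + l\<rfloor>"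
      "\<forall>T\<in>{V \<in> S. V \<sqsubseteq> W} - {W}. A < e T (L T x) (L T x') \<longrightarrow> (\<exists>T'\<in>\<T>. T \<sqsubseteq> T')"
      by auto
    let ?Y = "\<lambda>T'. {T \<in> Z'. T \<sqsubseteq> T'}"
    have IH: "finite (?Y T') \<and> card (?Y T') \<le> link_bound D ^ k" if "T' \<in> \<T>" for T'
    proof (rule Suc.IH)
      show "T' \<in> S" using that \<T> by auto
      have "depth W < depth T'" using depth_less[of T' W] that \<T> Suc.prems by auto
      then show "n \<le> depth T' + k" using Suc.prems(2) by simp
    qed (use Suc.prems in auto)
    have "\<exists>T'\<in>\<T>. T \<sqsubseteq> T'" if "T \<in> Z'" for T
    proof -
      have "T \<noteq> W" using False that by auto
      then have "T \<in> {V \<in> S. V \<sqsubseteq> W} - {W}" using that Suc.prems Z(1) by auto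
      then show ?thesis using \<T>(4) Z(2)[of T] that Suc.prems by auto
    qed
    then have eq: "Z' = (\<Union>T'\<in>\<T>. ?Y T')" by auto
    then have "finite Z'" using \<T>(2) IH by (metis (no_types, lifting) finite_UN)
    moreover have "card Z' \<le> (\<Sum>T'\<in>\<T>. card (?Y T'))"
      using card_UN_le[OF \<T>(2), of ?Y] eq by simp
    moreover have "(\<Sum>T'\<in>\<T>. card (?Y T')) \<le> of_nat (card \<T>) * link_bound D ^ k"
      using IH by (intro sum_bounded_above) auto
    moreover have "of_nat (card \<T>) * link_bound D ^ k \<le> link_bound D * link_bound D ^ k"
      using \<T>(3) unfolding link_bound_def by (intro mult_right_mono) auto
    ultimately show ?thesis unfolding of_nat_id power_Suc by linarith
  qed
qed

lemma card_relevant: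
  assumes "x \<in> X" "x' \<in> X"
    and "Z \<subseteq> S" "\<And>T. T \<in> Z \<Longrightarrow> A < e T (L T x) (L T x')"
      "\<And>T W. \<lbrakk>T \<in> Z; W \<in> S; T \<sqsubset> W\<rbrakk> \<Longrightarrow> e W (L W x) (L W x') \<le> D"
      "\<And>T T'. \<lbrakk>T \<in> Z; T' \<in> Z; T \<sqsubseteq> T'\<rbrakk> \<Longrightarrow> T = T'"
  shows "finite Z \<and> card Z \<le> link_bound D ^ n"
proof (cases "Z = {}")
  case False
  then obtain M where M: "M \<in> S" "\<And>V. V \<in> S \<Longrightarrow> V \<sqsubseteq> M" using maximum assms by auto
  show ?thesis
  proof (rule card_relevant_below[where Z = Z and W = M and x = x and x' = x'])
    show "e W (L W x) (L W x') \<le> D" if "T \<in> Z" "W \<in> S" "T \<sqsubset> W" for T W using assms(5) that .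
    show "\<And>T T'. \<lbrakk>T \<in> Z; T' \<in> Z; T \<sqsubseteq> T'\<rbrakk> \<Longrightarrow> T = T'" using assms(6) .
  qed (use assms M in auto)
qed simp

section \<open>The order on the domains where a point and a tuple differ\<close>

definition consistent_tuple :: "real \<Rightarrow> ('i \<Rightarrow> 'c) \<Rightarrow> bool" where
  "consistent_tuple \<kappa> b \<longleftrightarrow>
     (\<forall>U\<in>S. b U \<in> C U) \<and>
     (\<forall>V\<in>S. \<forall>W\<in>S. V \<pitchfork> W \<longrightarrow> e W (b W) (r V W) \<le> \<kappa> \<or> e V (b V) (r W V) \<le> \<kappa>) \<and>
     (\<forall>V\<in>S. \<forall>W\<in>S. V \<sqsubset> W \<longrightarrow> e W (b W) (r V W) \<le> \<kappa> \<or> e V (b V) (s W V (b W)) \<le> \<kappa>)"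

text \<open>The standard product region of \<open>U\<close> consists, up to bounded error, of the
  points whose coordinates satisfy these inequalities in place of \<open>b\<close>. Domains nested
  in \<open>U\<close> or orthogonal to \<open>U\<close> are left unconstrained.\<close>

definition near_product_region :: "('i \<Rightarrow> 'c) \<Rightarrow> real \<Rightarrow> 'i \<Rightarrow> bool" where
  "near_product_region b K U \<longleftrightarrow> (\<forall>W\<in>S. U \<sqsubset> W \<or> U \<pitchfork> W \<longrightarrow> e W (b W) (r U W) \<le> K)"

end

text \<open>\<open>K\<close> is the threshold beyond which \<open>x\<close> and \<open>b\<close>
  count as different, \<open>\<kappa>\<close> the consistency error. The factor four comes from
  transitivity of the order: its proof produces an estimate of size \<open>3 * \<kappa>\<close>,
  which must not exceed the lower bound \<open>K - \<kappa>\<close> of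
  \<open>before_far\<close>.\<close>

locale approximate_realisation = coarse_hierarchy +
  fixes b :: "'b \<Rightarrow> 'c" and \<kappa> K :: real and x :: 'a
  assumes b: "consistent_tuple \<kappa> b" and \<kappa>: "A \<le> \<kappa>" and K: "4 * \<kappa> \<le> K" and x: "x \<in> X"
begin

definition bad :: "'b set" where
  "bad = {T \<in> S. K < e T (L T x) (b T)}"

definition max_bad :: "'b set" where
  "max_bad = {T \<in> bad. \<forall>V\<in>bad. T \<sqsubseteq> V \<longrightarrow> V = T}"

text \<open>\<open>T\<close> lies before \<open>T'\<close> on the way from \<open>x\<close> to \<open>b\<close>.\<close>

definition before :: "'b \<Rightarrow> 'b \<Rightarrow> bool" where
  "before T T' \<longleftrightarrow> T \<pitchfork> T' \<and> e T (b T) (r T' T) \<le> \<kappa>"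

lemma \<kappa>_nonneg: "0 \<le> \<kappa>" using \<kappa> const by simp

lemma bad_S: "T \<in> bad \<Longrightarrow> T \<in> S" unfolding bad_def by auto
lemma max_bad_bad: "T \<in> max_bad \<Longrightarrow> T \<in> bad" unfolding max_bad_def by auto
lemma max_bad_S: "T \<in> max_bad \<Longrightarrow> T \<in> S" using max_bad_bad bad_S by auto

lemma b_in: "U \<in> S \<Longrightarrow> b U \<in> C U" using b unfolding consistent_tuple_def by auto

lemma b_transverse: "\<lbrakk>V \<in> S; W \<in> S; V \<pitchfork> W\<rbrakk> \<Longrightarrow> e W (b W) (r V W) \<le> \<kappa> \<or> e V (b V) (r W V) \<le> \<kappa>"
  using b unfolding consistent_tuple_def by auto

lemma b_nested: "\<lbrakk>V \<in> S; W \<in> S; V \<sqsubset> W\<rbrakk> \<Longrightarrow> e W (b W) (r V W) \<le> \<kappa> \<or> e V (b V) (s W V (b W)) \<le> \<kappa>"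
  using b unfolding consistent_tuple_def by auto

lemma common_point:
  assumes "U \<in> S" "p \<in> C U" "q \<in> C U" "t \<in> C U" "e U p t \<le> u" "e U q t \<le> v"
  shows "e U p q \<le> u + v"
  using e_tri[of U p t q] e_sym[of U q t] assms by linarith

lemma bad_not_close:
  assumes "T \<in> bad" "t \<in> C T" "e T (L T x) t \<le> u" "e T (b T) t \<le> v" "u + v \<le> K"
  shows False
proof -
  have "T \<in> S" "K < e T (L T x) (b T)" using assms(1) unfolding bad_def by auto
  then show ?thesis
    using common_point[of T "L T x" "b T" t u v] L_in[of T x] b_in[of T] x assms(2-5) by simp
qed

text \<open>At \<open>W\<close> the point and the tuple nearly agree, so it suffices that one of
  them is near \<open>r T W\<close>. If neither is, consistency makes the
  \<open>W\<close>-coordinates determine the \<open>T\<close>-coordinates of both up to error, and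
  \<open>x\<close> and \<open>b\<close> would agree at \<open>T\<close>.\<close>

lemma close_of_not_bad:
  assumes T: "T \<in> bad" and W: "W \<in> S" "W \<notin> bad" and TW: "T \<sqsubset> W \<or> T \<pitchfork> W"
  shows "e W (b W) (r T W) \<le> K + \<kappa>"
proof -
  have TS: "T \<in> S" using T bad_S by simp
  have xb: "e W (L W x) (b W) \<le> K" using W unfolding bad_def by auto
  have in_C: "L W x \<in> C W" "b W \<in> C W" "r T W \<in> C W" "L T x \<in> C T" "b T \<in> C T"
    using L_in x b_in W TS r_in TW by auto
  have first: ?thesis if "e W (L W x) (r T W) \<le> \<kappa>"
    using e_tri[of W "b W" "L W x" "r T W"] e_sym[of W "b W" "L W x"] xb in_C W that by simp
  have second: ?thesis if "e W (b W) (r T W) \<le> \<kappa>"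
    using that K \<kappa>_nonneg by simp
  show ?thesis
  proof (cases "T \<pitchfork> W")
    case True
    then show ?thesis
      using first second b_transverse[OF TS W(1) True] L_transverse[OF TS W(1) True x]
        bad_not_close[OF T, of "r W T" \<kappa> \<kappa>] r_in[of W T] transverse_sym[OF TS W(1) True] W(1) TS \<kappa> K \<kappa>_nonneg
      by force
  next
    case False
    then have nest: "T \<sqsubseteq> W" "T \<noteq> W" using TW by auto
    have s: "s W T (b W) \<in> C T" "s W T (L W x) \<in> C T" using s_in TS W(1) nest in_C by auto
    \<comment> \<open>In the fourth case both \<open>T\<close>-coordinates are near images under
      \<open>s W T\<close>, and bounded geodesic image makes these images close. Its other
      alternative is the third case, where \<open>b W\<close> is near \<open>r T W\<close> because
      \<open>x\<close> and \<open>b\<close> nearly agree at \<open>W\<close>.\<close>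
    consider "e W (b W) (r T W) \<le> \<kappa>" | "e W (L W x) (r T W) \<le> \<kappa>"
      | "e W (b W) (r T W) \<le> e W (b W) (L W x) + A"
      | "e T (b T) (s W T (b W)) \<le> \<kappa>" "e T (L T x) (s W T (L W x)) \<le> \<kappa>"
        "e T (s W T (b W)) (s W T (L W x)) \<le> A"
      using b_nested[OF TS W(1)] L_nested[OF TS W(1) nest x] nest \<kappa>
        bounded_geodesic_image[OF TS W(1) nest in_C(2,1)] by force
    then show ?thesis
    proof cases
      case 3
      then show ?thesis using xb e_sym[of W "b W" "L W x"] in_C W \<kappa> by simp
    next
      case 4
      then have "e T (b T) (s W T (L W x)) \<le> \<kappa> + A"
        using e_tri[of T "b T" "s W T (b W)" "s W T (L W x)"] TS in_C s by simp
      then show ?thesis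
        using bad_not_close[OF T s(2) 4(2)] \<kappa> \<kappa>_nonneg K by fastforce
    qed (use first second in auto)
  qed
qed

text \<open>\<open>b\<close> is near \<open>r T' T\<close> at \<open>T\<close>. If \<open>x\<close>
  were too, \<open>T\<close> would not be bad, so the Behrstock inequality for \<open>x\<close>
  yields its other alternative.\<close>

lemma before_reverse:
  assumes T: "T \<in> bad" "T' \<in> S" and bef: "before T T'"
  shows "e T' (L T' x) (r T T') \<le> \<kappa>"
proof (rule ccontr)
  assume "\<not> ?thesis"
  then have "e T (L T x) (r T' T) \<le> \<kappa>"
    using L_transverse[of T T' x] bef T bad_S x \<kappa> unfolding before_def by fastforce
  then show False
    using bad_not_close[OF T(1), of "r T' T" \<kappa> \<kappa>] r_in[of T' T] bad_S[OF T(1)] T(2) bef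
      transverse_sym[of T T'] K \<kappa>_nonneg unfolding before_def by auto
qed

text \<open>At \<open>T'\<close> the point \<open>x\<close> is near \<open>r T T'\<close>, and
  \<open>b\<close> is further than \<open>K\<close> from \<open>x\<close>.\<close>

lemma before_far:
  assumes T: "T \<in> bad" "T' \<in> bad" and bef: "before T T'"
  shows "K - \<kappa> < e T' (b T') (r T T')"
proof (rule ccontr)
  assume "\<not> ?thesis"
  moreover have "e T' (L T' x) (r T T') \<le> \<kappa>" using before_reverse[OF T(1) bad_S[OF T(2)] bef] .
  moreover have "r T T' \<in> C T'" using r_in T bad_S bef unfolding before_def by blast
  ultimately show False using bad_not_close[OF T(2), of "r T T'" \<kappa> "K - \<kappa>"] by simp
qed

text \<open>Self-improvement: if the estimate did not hold with \<open>\<kappa>\<close>, consistency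
  of \<open>b\<close> would give the opposite order, and \<open>before_far\<close> would put
  \<open>b\<close> further than \<open>K - \<kappa>\<close> from \<open>r T' T\<close>,
  contradicting even the rough estimate.\<close>

lemma before_total:
  assumes T: "T \<in> bad" "T' \<in> bad" and tr: "T \<pitchfork> T'" and close: "e T (b T) (r T' T) \<le> 3 * \<kappa>"
  shows "before T T'"
proof (rule ccontr)
  assume "\<not> before T T'"
  then have "before T' T"
    using b_transverse[of T T'] T bad_S tr transverse_sym[of T T'] unfolding before_def by auto
  from before_far[OF T(2,1) this] show False using close K by simp
qed

text \<open>At \<open>T2\<close> both \<open>y\<close> and \<open>b\<close> are near
  \<open>r T3 T2\<close>, and \<open>b\<close> is far from \<open>r T1 T2\<close>. So
  \<open>y\<close> is far from it too, and the Behrstock inequality for \<open>y\<close> puts its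
  \<open>T1\<close>-coordinate near \<open>r T2 T1\<close>, where \<open>b\<close> also
  lies.\<close>

lemma before_propagates:
  assumes T: "T1 \<in> bad" "T2 \<in> bad" "T3 \<in> S" and bef: "before T1 T2" "before T2 T3"
    and y: "y \<in> X" "e T2 (L T2 y) (r T3 T2) \<le> A"
  shows "e T1 (L T1 y) (b T1) \<le> 2 * \<kappa>"
proof -
  have S: "T1 \<in> S" "T2 \<in> S" "T3 \<in> S" using T bad_S by auto
  have tr: "T1 \<pitchfork> T2" "T2 \<pitchfork> T1" "T3 \<pitchfork> T2"
    using bef transverse_sym S unfolding before_def by auto
  have in_C: "L T2 y \<in> C T2" "b T2 \<in> C T2" "r T3 T2 \<in> C T2" "r T1 T2 \<in> C T2"
     "L T1 y \<in> C T1" "b T1 \<in> C T1" "r T2 T1 \<in> C T1"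
    using L_in y S b_in r_in tr by auto
  have "e T2 (b T2) (L T2 y) \<le> \<kappa> + A"
    using common_point[of T2 "b T2" "L T2 y" "r T3 T2"] in_C S bef(2) y unfolding before_def by auto
  then have "A < e T2 (L T2 y) (r T1 T2)"
    using before_far[OF T(1,2) bef(1)] e_tri[of T2 "b T2" "L T2 y" "r T1 T2"] S in_C K \<kappa> by simp
  then have "e T1 (L T1 y) (r T2 T1) \<le> A"
    using L_transverse[OF S(1,2) tr(1) y(1)] by auto
  then show ?thesis
    using common_point[of T1 "L T1 y" "b T1" "r T2 T1" A \<kappa>] in_C S \<kappa> bef(1) unfolding before_def by auto
qed

lemma max_bad_cases:
  assumes "T \<in> max_bad" "T' \<in> max_bad"
  shows "T = T' \<or> T \<bottom> T' \<or> T \<pitchfork> T'"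
  using assms unfolding max_bad_def transverse_def by auto

lemma before_trans:
  assumes T: "T1 \<in> max_bad" "T2 \<in> max_bad" "T3 \<in> max_bad" and bef: "before T1 T2" "before T2 T3"
  shows "before T1 T3"
proof -
  have B: "T1 \<in> bad" "T2 \<in> bad" "T3 \<in> bad" using T max_bad_bad by auto
  then have S: "T1 \<in> S" "T2 \<in> S" "T3 \<in> S" using bad_S by auto
  have tr: "T3 \<pitchfork> T2" using bef transverse_sym S unfolding before_def by auto
  show ?thesis
  proof (cases "T1 \<pitchfork> T3")
    case True
    \<comment> \<open>A point in the product region of \<open>T3\<close>. Its
      \<open>T1\<close>-coordinate is near \<open>r T3 T1\<close> by construction and near that of
      \<open>b\<close> by propagation.\<close>
    obtain y where y: "y \<in> X"
      "\<forall>W\<in>S. (T3 \<sqsubset> W) \<or> transverse (\<sqsubseteq>) (\<bottom>) T3 W \<longrightarrow> e W (L W y) (r T3 W) \<le> A"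
      using partial_realisation[of "{T3}" b] b_in S by auto
    have "e T1 (L T1 y) (b T1) \<le> 2 * \<kappa>" using before_propagates B S bef y tr by blast
    moreover have "e T1 (L T1 y) (r T3 T1) \<le> A" using y True S transverse_sym by auto
    ultimately have "e T1 (b T1) (r T3 T1) \<le> 2 * \<kappa> + A"
      using e_tri[of T1 "b T1" "L T1 y" "r T3 T1"] e_sym[of T1 "b T1" "L T1 y"] S L_in b_in y(1) r_in[of T3 T1]
        transverse_sym[OF S(1,3) True] by auto
    then show ?thesis using before_total[OF B(1,3) True] \<kappa> by simp
  next
    case False
    then have "T1 = T3 \<or> T1 \<bottom> T3" using max_bad_cases T by auto
    then have "\<forall>V\<in>{T1,T3}. \<forall>W\<in>{T1,T3}. V \<noteq> W \<longrightarrow> V \<bottom> W" using orth_sym S by auto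
    \<comment> \<open>This point keeps the \<open>T1\<close>-coordinate of \<open>x\<close> and lies
      in the product region of \<open>T3\<close>. By propagation it agrees with \<open>b\<close> at
      \<open>T1\<close>, so \<open>x\<close> and \<open>b\<close> agree there, although
      \<open>T1\<close> is bad.\<close>
    then obtain y where y: "y \<in> X" "e T1 (L T1 y) (L T1 x) \<le> A"
      "\<forall>W\<in>S. (T3 \<sqsubset> W) \<or> transverse (\<sqsubseteq>) (\<bottom>) T3 W \<longrightarrow> e W (L W y) (r T3 W) \<le> A"
      using partial_realisation[of "{T1,T3}" "\<lambda>V. L V x"] L_in x S by auto
    have "e T1 (L T1 y) (b T1) \<le> 2 * \<kappa>" using before_propagates B S bef y tr by blast
    then have False
      using bad_not_close[OF B(1), of "L T1 y" A "2 * \<kappa>"] y L_in x b_in S e_sym[of T1] K \<kappa> \<kappa>_nonneg by auto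
    then show ?thesis ..
  qed
qed

text \<open>A point \<open>y\<close> in the product region of \<open>T\<close> replaces
  \<open>b\<close>, to which large links does not apply. At a predecessor of \<open>T\<close> it is
  near \<open>b\<close> and hence far from \<open>x\<close>. At a domain properly above a
  predecessor, which is not bad by maximality, both \<open>x\<close> and \<open>y\<close> are at
  bounded distance from \<open>b\<close>.\<close>

lemma card_before:
  assumes T: "T \<in> max_bad"
  shows "finite {T1 \<in> max_bad. before T1 T} \<and>
    card {T1 \<in> max_bad. before T1 T} \<le> link_bound (2 * K + 2 * \<kappa>) ^ n"
proof -
  have TS: "T \<in> S" using T max_bad_S by auto
  obtain y where y: "y \<in> X"
    "\<forall>W\<in>S. (T \<sqsubset> W) \<or> transverse (\<sqsubseteq>) (\<bottom>) T W \<longrightarrow> e W (L W y) (r T W) \<le> A"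
    using partial_realisation[of "{T}" b] b_in TS by auto
  show ?thesis
  proof (rule card_relevant[OF x y(1)])
    fix T1 assume "T1 \<in> {T1 \<in> max_bad. before T1 T}"
    then have T1: "T1 \<in> max_bad" "T1 \<in> bad" "T1 \<in> S" "T1 \<pitchfork> T" "T \<pitchfork> T1" "e T1 (b T1) (r T T1) \<le> \<kappa>"
      using max_bad_bad bad_S transverse_sym TS unfolding before_def by auto
    then have "e T1 (L T1 y) (r T T1) \<le> A" using y by auto
    then have "e T1 (b T1) (L T1 y) \<le> \<kappa> + A"
      using common_point[of T1 "b T1" "L T1 y" "r T T1"] T1 b_in L_in y r_in TS by auto
    then show "A < e T1 (L T1 x) (L T1 y)"
      using bad_not_close[OF T1(2), of "L T1 y" A "\<kappa> + A"] L_in[OF T1(3) y(1)] \<kappa> K \<kappa>_nonneg by fastforce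
    fix W assume W: "W \<in> S" "T1 \<sqsubset> W"
    have nb: "W \<notin> bad" using T1(1) W unfolding max_bad_def by auto
    \<comment> \<open>Since \<open>T1\<close> is nested in \<open>W\<close> and transverse to
      \<open>T\<close>, the domain \<open>W\<close> is neither orthogonal to \<open>T\<close> nor
      nested in it.\<close>
    have TW: "T \<sqsubset> W \<or> T \<pitchfork> W"
    proof -
      have "\<not> T \<bottom> W" using orth_nest[of T1 W T] orth_sym W T1 TS unfolding transverse_def by blast
      moreover have "\<not> W \<sqsubseteq> T" using nest_trans[of T1 W T] W T1 TS unfolding transverse_def by blast
      ultimately show ?thesis using nest_refl TS unfolding transverse_def by blast
    qed
    have "e W (b W) (r T W) \<le> K + \<kappa>" using close_of_not_bad T W nb TW max_bad_bad by blast
    moreover have "e W (L W y) (r T W) \<le> A" using y TW W by blast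
    moreover have in_C: "L W x \<in> C W" "L W y \<in> C W" "b W \<in> C W" "r T W \<in> C W"
      using L_in x y W b_in r_in TS TW by auto
    ultimately have "e W (b W) (L W y) \<le> K + \<kappa> + A"
      using common_point[of W "b W" "L W y" "r T W"] W by auto
    moreover have "e W (L W x) (b W) \<le> K" using nb W unfolding bad_def by auto
    \<comment> \<open>\<open>K\<close> from \<open>x\<close> to \<open>b\<close> and
      \<open>K + \<kappa> + A\<close> from \<open>b\<close> to \<open>y\<close>, with
      \<open>A\<close> at most \<open>\<kappa>\<close>.\<close>
    ultimately show "e W (L W x) (L W y) \<le> 2 * K + 2 * \<kappa>"
      using e_tri[of W "L W x" "b W" "L W y"] in_C W \<kappa> by simp
  next
    fix T1 T2 assume "T1 \<in> {T1 \<in> max_bad. before T1 T}" "T2 \<in> {T1 \<in> max_bad. before T1 T}" "T1 \<sqsubseteq> T2"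
    then show "T1 = T2" unfolding max_bad_def by auto
  qed (use max_bad_S in auto)
qed

text \<open>A domain with the largest number of predecessors is last: by transitivity and
  irreflexivity a successor would have strictly more. The uniform bound on these numbers replaces
  finiteness of \<open>max_bad\<close>.\<close>

lemma exists_last_bad:
  assumes "bad \<noteq> {}"
  obtains T where "T \<in> max_bad" "\<And>T'. T' \<in> max_bad \<Longrightarrow> \<not> before T T'"
proof -
  let ?Z = "\<lambda>T. {T1 \<in> max_bad. before T1 T}"
  obtain T0 where T0: "T0 \<in> max_bad"
  proof -
    obtain T where T: "T \<in> bad" using assms by auto
    have bS: "bad \<subseteq> S" using bad_S by auto
    obtain M where "M \<in> bad" "\<And>V. V \<in> bad \<Longrightarrow> M \<sqsubseteq> V \<Longrightarrow> V = M"
      using maximal_above[OF bS T] by blast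
    then show ?thesis using that unfolding max_bad_def by auto
  qed
  have bound: "\<forall>T. T \<in> max_bad \<longrightarrow> card (?Z T) < Suc (link_bound (2 * K + 2 * \<kappa>) ^ n)"
    using card_before by (simp add: less_Suc_eq_le)
  obtain T where T: "T \<in> max_bad" "\<And>T'. T' \<in> max_bad \<Longrightarrow> card (?Z T') \<le> card (?Z T)"
    using ex_has_greatest_nat[OF T0 bound] by auto
  have "\<not> before T T'" if T': "T' \<in> max_bad" for T'
  proof
    assume bef: "before T T'"
    have "\<not> before T T" unfolding before_def transverse_def by simp
    then have "?Z T \<subset> ?Z T'" using bef before_trans[OF _ T(1) T' _ bef] T(1) by auto
    then have "card (?Z T) < card (?Z T')" using card_before[OF T'] psubset_card_mono by blast
    then show False using T(2)[OF T'] by simp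
  qed
  then show ?thesis using that T(1) by blast
qed

text \<open>Suppose \<open>b\<close> is far from \<open>r T W\<close> for a bad \<open>W\<close>.
  Then consistency places it near \<open>r W T\<close>. Although \<open>W\<close> need not be
  maximal, a maximal bad \<open>W'\<close> above it has \<open>r W' T\<close> close to
  \<open>r W T\<close>, so \<open>T\<close> would come before \<open>W'\<close>.\<close>

lemma last_bad_near_product_region:
  assumes T: "T \<in> max_bad" and last: "\<And>T'. T' \<in> max_bad \<Longrightarrow> \<not> before T T'"
  shows "near_product_region b (K + \<kappa>) T"
  unfolding near_product_region_def
proof (intro ballI impI)
  fix W assume W: "W \<in> S" and TW: "T \<sqsubset> W \<or> T \<pitchfork> W"
  have TB: "T \<in> bad" and TS: "T \<in> S" using T max_bad_bad bad_S by auto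
  show "e W (b W) (r T W) \<le> K + \<kappa>"
  proof (cases "W \<in> bad")
    case False
    then show ?thesis using close_of_not_bad[OF TB W _ TW] by simp
  next
    case True
    then have tr: "T \<pitchfork> W" "W \<pitchfork> T" using T TW transverse_sym TS W unfolding max_bad_def by auto
    show ?thesis
    proof (rule ccontr)
      assume far: "\<not> ?thesis"
      have bT: "e T (b T) (r W T) \<le> \<kappa>"
        using b_transverse[OF TS W tr(1)] far K \<kappa>_nonneg by auto
      have bS: "bad \<subseteq> S" using bad_S by auto
      obtain W' where W': "W' \<in> bad" "W \<sqsubseteq> W'" "\<And>V. V \<in> bad \<Longrightarrow> W' \<sqsubseteq> V \<Longrightarrow> V = W'"
        using maximal_above[OF bS True] by blast
      have W'm: "W' \<in> max_bad" "W' \<in> S" using W' bad_S unfolding max_bad_def by auto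
      have "\<not> T \<bottom> W'" using orth_nest[of W W' T] W' W TS tr W'm orth_sym unfolding transverse_def by blast
      moreover have "T \<noteq> W'" using W' tr unfolding transverse_def by blast
      ultimately have tr': "T \<pitchfork> W'" "W' \<pitchfork> T" using max_bad_cases[OF T W'm(1)] transverse_sym TS W'm by auto
      have "e T (r W T) (r W' T) \<le> A"
        using r_nested[OF W W'm(2) TS W'(2) tr'(2)] tr unfolding transverse_def by auto
      then have "e T (b T) (r W' T) \<le> \<kappa> + A"
        using e_tri[of T "b T" "r W T" "r W' T"] bT TS b_in r_in W W'm tr tr' by auto
      then have "before T W'" using before_total[OF TB W'(1) tr'(1)] \<kappa> \<kappa>_nonneg by simp
      then show False using last W'm by auto
    qed
  qed
qed

end

section \<open>Growing families of product regions until the tuple is realised\<close>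

context coarse_hierarchy
begin

definition product_family :: "('i \<Rightarrow> 'c) \<Rightarrow> real \<Rightarrow> 'i set \<Rightarrow> bool" where
  "product_family b K F \<longleftrightarrow> finite F \<and> F \<subseteq> S \<and> (\<forall>V\<in>F. \<forall>W\<in>F. V \<noteq> W \<longrightarrow> V \<bottom> W) \<and>
     (\<forall>U\<in>F. near_product_region b K U)"

text \<open>The threshold for disagreement is \<open>K + 4 * \<kappa>\<close>: the summand
  \<open>4 * \<kappa>\<close> is required by the order argument, and \<open>K\<close> absorbs the
  error of the old family when the position of the new domain relative to it is determined. The new
  domain is near its product region up to one more \<open>\<kappa>\<close>.\<close>

lemma product_family_step:
  fixes \<kappa> K :: real
  assumes b: "consistent_tuple \<kappa> b" and \<kappa>: "A \<le> \<kappa>" and K: "\<kappa> \<le> K" and F: "product_family b K F"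
  shows "(\<exists>x\<in>X. \<forall>U\<in>S. e U (L U x) (b U) \<le> K + 4 * \<kappa>) \<or>
         (\<exists>F'. product_family b (K + 5 * \<kappa>) F' \<and> sum depth F < sum depth F')"
proof -
  have F': "finite F" "F \<subseteq> S" "\<forall>V\<in>F. \<forall>W\<in>F. V \<noteq> W \<longrightarrow> V \<bottom> W" "\<forall>U\<in>F. near_product_region b K U"
    using F unfolding product_family_def by auto
  have b_in: "\<And>U. U \<in> S \<Longrightarrow> b U \<in> C U" using b unfolding consistent_tuple_def by auto
  obtain x where x: "x \<in> X" "\<forall>V\<in>F. e V (L V x) (b V) \<le> A"
      "\<forall>V\<in>F. \<forall>W\<in>S. V \<sqsubset> W \<or> V \<pitchfork> W \<longrightarrow> e W (L W x) (r V W) \<le> A"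
  proof -
    have "\<forall>V\<in>F. b V \<in> C V" using b_in F'(2) by auto
    from partial_realisation[OF F'(2,3) this] show ?thesis by (elim bexE conjE) (rule that)
  qed
  interpret ar: approximate_realisation X S C e L nest orth r s A n l b \<kappa> "K + 4 * \<kappa>" x
    by unfold_locales (use b \<kappa> K x const in auto)
  show ?thesis
  proof (cases "ar.bad = {}")
    case True
    then show ?thesis using x(1) unfolding ar.bad_def by force
  next
    case False
    then obtain T where T: "T \<in> ar.max_bad" and last: "\<And>T'. T' \<in> ar.max_bad \<Longrightarrow> \<not> ar.before T T'"
      using ar.exists_last_bad by blast
    have TB: "T \<in> ar.bad" and TS: "T \<in> S" using T ar.max_bad_bad ar.bad_S by auto
    have good: "near_product_region b (K + 5 * \<kappa>) T"
      using ar.last_bad_near_product_region[OF T last] by (simp add: algebra_simps)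
    have good': "near_product_region b (K + 5 * \<kappa>) U" if "U \<in> F" for U
      using F'(4) that ar.\<kappa>_nonneg unfolding near_product_region_def by fastforce
    \<comment> \<open>If \<open>U\<close> were properly nested in \<open>T\<close> or transverse to
      it, both \<open>x\<close> and \<open>b\<close> would be near \<open>r U T\<close>, and
      \<open>T\<close> would not be bad.\<close>
    have below: "T \<sqsubset> U \<or> T \<bottom> U" if U: "U \<in> F" for U
    proof -
      have US: "U \<in> S" using U F' by auto
      have "T \<noteq> U" using x(2) U TB K \<kappa> ar.\<kappa>_nonneg unfolding ar.bad_def by force
      moreover have False if rel: "U \<sqsubset> T \<or> U \<pitchfork> T"
      proof -
        have "e T (L T x) (r U T) \<le> A" using x(3) U TS rel by blast
        moreover have "e T (b T) (r U T) \<le> K"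
          using F'(4) U TS rel unfolding near_product_region_def by blast
        ultimately show False
          using ar.bad_not_close[OF TB r_in[OF US TS rel]] \<kappa> ar.\<kappa>_nonneg by force
      qed
      ultimately show ?thesis using orth_sym[OF US TS] unfolding transverse_def by blast
    qed
    show ?thesis
    proof (cases "\<exists>U\<in>F. T \<sqsubset> U")
      case True
      then obtain U where U: "U \<in> F" "T \<sqsubset> U" by auto
      \<comment> \<open>Being nested in \<open>U\<close>, the domain \<open>T\<close> inherits
        orthogonality to all other members.\<close>
      have orth: "T \<bottom> V" if "V \<in> F - {U}" for V
        using orth_nest[of T U V] U that F'(3) subsetD[OF F'(2)] TS by auto
      then have notin: "T \<notin> F - {U}" using orth_irrefl TS by auto
      have "V \<bottom> T" if "V \<in> F - {U}" for V using orth[OF that] orth_sym TS that F'(2) by blast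
      then have "product_family b (K + 5 * \<kappa>) (insert T (F - {U}))"
        unfolding product_family_def using F' TS orth good good' by auto
      moreover have "sum depth F < sum depth (insert T (F - {U}))"
        using sum.remove[OF F'(1) U(1), of depth] depth_less[OF TS _ U(2)] U F' notin by auto
      ultimately show ?thesis by blast
    next
      case False
      then have orth: "\<And>V. V \<in> F \<Longrightarrow> T \<bottom> V" using below by blast
      have orth': "V \<bottom> T" if "V \<in> F" for V using orth[OF that] orth_sym TS that F'(2) by blast
      have "T \<notin> F" using orth orth_irrefl TS by auto
      then have "sum depth F < sum depth (insert T F)" using depth_pos[OF TS] F'(1) by simp
      moreover have "product_family b (K + 5 * \<kappa>) (insert T F)"
        unfolding product_family_def using F' TS orth orth' good good' by auto
      ultimately show ?thesis by blast
    qed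
  qed
qed

text \<open>A failed step yields a family of larger total depth, at the price of
  \<open>5 * \<kappa>\<close> in the error. Starting from the empty family with error
  \<open>\<kappa>\<close>, no failure can occur beyond error
  \<open>5 * (n * n + 1) * \<kappa>\<close>. The stated factor leaves some slack.\<close>

theorem realisation:
  fixes \<kappa> :: real
  assumes b: "consistent_tuple \<kappa> b" and \<kappa>: "A \<le> \<kappa>"
  shows "\<exists>x\<in>X. \<forall>U\<in>S. e U (L U x) (b U) \<le> 5 * (n * n + 2) * \<kappa>"
proof (rule ccontr)
  assume no: "\<not> ?thesis"
  have "\<exists>F. product_family b (\<kappa> + 5 * j * \<kappa>) F \<and> j \<le> sum depth F" if "j \<le> n * n + 1" for j :: nat
    using that
  proof (induction j)
    case 0
    have "product_family b \<kappa> {}" unfolding product_family_def by simp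
    then show ?case by auto
  next
    case (Suc j)
    then obtain F where F: "product_family b (\<kappa> + 5 * j * \<kappa>) F" "j \<le> sum depth F" by auto
    have \<kappa>0: "0 \<le> \<kappa>" using \<kappa> const by simp
    have "real j * \<kappa> \<le> real (n * n) * \<kappa>"
      using Suc.prems \<kappa>0 by (intro mult_right_mono of_nat_mono) auto
    then have "\<kappa> + 5 * j * \<kappa> + 4 * \<kappa> \<le> 5 * (n * n + 2) * \<kappa>"
      using \<kappa>0 by (simp add: algebra_simps)
    then have "\<not> (\<exists>x\<in>X. \<forall>U\<in>S. e U (L U x) (b U) \<le> \<kappa> + 5 * j * \<kappa> + 4 * \<kappa>)"
      using no by (meson order.trans)
    then obtain F' where "product_family b (\<kappa> + 5 * j * \<kappa> + 5 * \<kappa>) F'" "sum depth F < sum depth F'"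
      using product_family_step[OF b \<kappa> _ F(1)] \<kappa>0 by auto
    then show ?case using F(2) by (intro exI[of _ F']) (auto simp: algebra_simps)
  qed
  from this[of "n * n + 1"] obtain F where
    "product_family b (\<kappa> + 5 * (n * n + 1) * \<kappa>) F" "n * n + 1 \<le> sum depth F" by auto
  then show False using sum_depth_orthogonal[of F] unfolding product_family_def by simp
qed

end


section \<open>Quasigeodesic spaces\<close>

lemma ext_metric_subset: "ext_metric M d \<Longrightarrow> N \<subseteq> M \<Longrightarrow> ext_metric N d"
  unfolding ext_metric_def by (simp add: subset_iff)

lemma ext_metric_sym: "\<lbrakk>ext_metric M d; x \<in> M; y \<in> M\<rbrakk> \<Longrightarrow> d x y = d y x"
  unfolding ext_metric_def by blast

lemma ext_metric_refl: "\<lbrakk>ext_metric M d; x \<in> M\<rbrakk> \<Longrightarrow> d x x = 0"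
  unfolding ext_metric_def by blast

lemma ext_metric_triangle:
  assumes "ext_metric M d" "x \<in> M" "y \<in> M" "z \<in> M"
    and "d x y \<le> ennreal p" "d y z \<le> ennreal q" "0 \<le> p" "0 \<le> q"
  shows "d x z \<le> ennreal (p + q)"
proof -
  have "d x z \<le> d x y + d y z" using assms unfolding ext_metric_def by blast
  also have "\<dots> \<le> ennreal p + ennreal q" using assms by (intro add_mono) auto
  finally show ?thesis using assms by simp
qed

lemma le_ennreal_less_top: "x \<le> ennreal t \<Longrightarrow> x < \<infinity>"
  by (metis ennreal_less_top infinity_ennreal_def le_less_trans)

lemma less_top_ennreal:
  assumes "x < (\<infinity>::ennreal)" obtains t where "0 \<le> t" "x = ennreal t"
  using assms by (cases x) auto

lemma affine_bound:
  assumes "z \<le> ennreal a * y + ennreal b" "y \<le> ennreal t" "0 \<le> a" "0 \<le> b" "0 \<le> t"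
  shows "z \<le> ennreal (a * t + b)"
proof -
  have "z \<le> ennreal a * ennreal t + ennreal b"
    using assms by (intro order.trans[OF assms(1)] add_mono mult_left_mono) auto
  then show ?thesis using assms by (simp add: ennreal_mult)
qed

lemma affine_control_bound:
  assumes "affine_control a b A d e f" "x \<in> A" "y \<in> A" "d x y \<le> ennreal t" "0 \<le> a" "0 \<le> b" "0 \<le> t"
  shows "e (f x) (f y) \<le> ennreal (a * t + b)"
proof (rule affine_bound[OF _ assms(4-7)])
  show "e (f x) (f y) \<le> ennreal a * d x y + ennreal b"
    using assms le_ennreal_less_top unfolding affine_control_def by blast
qed

section \<open>Chains of bounded step and paths in graphs\<close>

definition chain_rel :: "'a set \<Rightarrow> ('a \<Rightarrow> 'a \<Rightarrow> ennreal) \<Rightarrow> real \<Rightarrow> ('a \<times> 'a) set" where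
  "chain_rel A d t = {(u, v) \<in> A \<times> A. d u v \<le> ennreal t}"

lemma graph_dist_le: "(x, y) \<in> E ^^ m \<Longrightarrow> graph_dist E x y \<le> ennreal (real m)"
  unfolding graph_dist_def ennreal_of_nat_eq_real_of_nat by (auto intro: INF_lower)

lemma graph_dist_path:
  assumes "graph_dist E x y \<le> ennreal p" "0 \<le> p"
  obtains m where "(x, y) \<in> E ^^ m" "real m \<le> p"
proof -
  define m where "m = (LEAST n. (x, y) \<in> E ^^ n)"
  have "\<exists>n. (x, y) \<in> E ^^ n"
  proof (rule ccontr)
    assume "\<not> ?thesis"
    then have "graph_dist E x y = \<infinity>" unfolding graph_dist_def by simp
    then show False using le_ennreal_less_top[OF assms(1)] by simp
  qed
  then have m: "(x, y) \<in> E ^^ m" unfolding m_def by (rule LeastI_ex)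
  have "ennreal (real m) \<le> graph_dist E x y"
    unfolding graph_dist_def m_def ennreal_of_nat_eq_real_of_nat
    by (intro INF_greatest) (auto intro: Least_le)
  then show ?thesis using that[OF m] assms by (meson ennreal_le_iff order.trans)
qed

lemma relpow_sym: "sym E \<Longrightarrow> (x, y) \<in> E ^^ m \<Longrightarrow> (y, x) \<in> E ^^ m"
proof (induction m arbitrary: y)
  case (Suc m)
  then obtain z where "(x, z) \<in> E ^^ m" "(z, y) \<in> E" by auto
  then have "(y, z) \<in> E" "(z, x) \<in> E ^^ m" using Suc by (auto dest: symD)
  then show ?case by (rule relpow_Suc_I2)
qed simp

text \<open>A short path between the images is lifted vertex by vertex, using coarse density of the
  image. Successive lifts have images at graph distance at most \<open>b + 1 + b\<close>, whence the
  step size \<open>a * (2 * b + 1) + b\<close>.\<close>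

lemma quasigeodesic_chains:
  fixes d :: "'a \<Rightarrow> 'a \<Rightarrow> ennreal"
  assumes "quasigeodesic A d"
  obtains t a b where "0 \<le> t" "0 \<le> a" "0 \<le> b"
    "\<And>x y p. \<lbrakk>x \<in> A; y \<in> A; 0 \<le> p; d x y \<le> ennreal p\<rbrakk> \<Longrightarrow>
       \<exists>m. (x, y) \<in> chain_rel A d t ^^ m \<and> real m \<le> a * p + b"
proof -
  obtain V :: "'a set" and E f a b where E: "E \<subseteq> V \<times> V" "sym E" and f: "f \<in> A \<rightarrow> V"
    and ab: "1 \<le> a" "0 \<le> b"
    and qi: "\<forall>x\<in>A. \<forall>y\<in>A. graph_dist E (f x) (f y) \<le> ennreal a * d x y + ennreal b \<and>
                     d x y \<le> ennreal a * graph_dist E (f x) (f y) + ennreal b"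
    and dense: "\<forall>z\<in>V. \<exists>x\<in>A. graph_dist E z (f x) \<le> ennreal b"
    using assms unfolding quasigeodesic_def quasi_isometry_def by (elim exE conjE bexE)
  have up: "graph_dist E (f x) (f y) \<le> ennreal a * d x y + ennreal b"
    and low: "d x y \<le> ennreal a * graph_dist E (f x) (f y) + ennreal b" if "x \<in> A" "y \<in> A" for x y
    using qi that by auto
  define t where "t = a * (2 * b + 1) + b"
  have t: "0 \<le> t" using ab unfolding t_def by simp
  have short: "(x, y) \<in> chain_rel A d t" if "x \<in> A" "y \<in> A" "(f x, f y) \<in> E ^^ k" "real k \<le> 2 * b + 1" for x y k
  proof -
    have "graph_dist E (f x) (f y) \<le> ennreal (2 * b + 1)"
      using graph_dist_le[OF that(3)] that(4) by (meson ennreal_leI order.trans)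
    then have "d x y \<le> ennreal t"
      unfolding t_def using affine_bound[OF low[OF that(1,2)]] ab by simp
    then show ?thesis using that unfolding chain_rel_def by simp
  qed
  \<comment> \<open>Invariant of the lifting: after \<open>m\<close> edges the path is at the vertex
    \<open>v\<close>, and the chain ends at a point \<open>y\<close> whose image is at most
    \<open>b\<close> edges from \<open>v\<close>.\<close>
  have path: "(x, y) \<in> chain_rel A d t ^^ Suc m"
    if "x \<in> A" "y \<in> A" "(f x, v) \<in> E ^^ m" "(v, f y) \<in> E ^^ k" "real k \<le> b" for x y v m k
    using that
  proof (induction m arbitrary: v y k)
    case 0
    then show ?case using short[of x y k] ab by simp
  next
    case (Suc m)
    then obtain u where u: "(f x, u) \<in> E ^^ m" "(u, v) \<in> E" by auto
    then obtain w where w: "w \<in> A" "graph_dist E u (f w) \<le> ennreal b" using dense E by blast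
    obtain j where j: "(u, f w) \<in> E ^^ j" "real j \<le> b" using graph_dist_path[OF w(2) ab(2)] .
    have "(x, w) \<in> chain_rel A d t ^^ Suc m" using Suc.IH[OF Suc.prems(1) w(1) u(1) j] .
    moreover have "(f w, f y) \<in> E ^^ (j + Suc k)"
      using relpow_sym[OF E(2) j(1)] relpow_Suc_I2[OF u(2) Suc.prems(4)] unfolding relpow_add by auto
    then have "(w, y) \<in> chain_rel A d t"
      using short[OF w(1) Suc.prems(2)] j(2) Suc.prems(5) by fastforce
    ultimately show ?case by (rule relpow_Suc_I)
  qed
  show ?thesis
  proof (rule that[OF t, of a "b + 1"])
    fix x y p assume xy: "x \<in> A" "y \<in> A" "0 \<le> p" "d x y \<le> ennreal p"
    have "graph_dist E (f x) (f y) \<le> ennreal (a * p + b)"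
      using affine_bound[OF up[OF xy(1,2)] xy(4)] ab xy(3) by simp
    then obtain m where m: "(f x, f y) \<in> E ^^ m" "real m \<le> a * p + b"
      using graph_dist_path[of E "f x" "f y" "a * p + b"] ab xy(3) by auto
    have "(x, y) \<in> chain_rel A d t ^^ Suc m"
      by (rule path[OF xy(1,2) m(1), of 0]) (use ab in auto)
    then show "\<exists>m. (x, y) \<in> chain_rel A d t ^^ m \<and> real m \<le> a * p + (b + 1)"
      using m(2) by (intro exI[of _ "Suc m"]) auto
  qed (use ab in auto)
qed

lemma chain_image_dist:
  assumes B: "ext_metric B e" and f: "f \<in> A \<rightarrow> B" and s: "0 \<le> s"
    and step: "\<And>x y. \<lbrakk>x \<in> A; y \<in> A; d x y \<le> ennreal t\<rbrakk> \<Longrightarrow> e (f x) (f y) \<le> ennreal s"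
  shows "\<lbrakk>(x, y) \<in> chain_rel A d t ^^ m; x \<in> A\<rbrakk> \<Longrightarrow> y \<in> A \<and> e (f x) (f y) \<le> ennreal (real m * s)"
proof (induction m arbitrary: y)
  case 0
  then show ?case using ext_metric_refl[OF B, of "f x"] f by auto
next
  case (Suc m)
  then obtain z where z: "(x, z) \<in> chain_rel A d t ^^ m" "(z, y) \<in> chain_rel A d t" by auto
  then have zy: "z \<in> A" "y \<in> A" "d z y \<le> ennreal t" unfolding chain_rel_def by auto
  have "e (f x) (f y) \<le> ennreal (real m * s + s)"
    using ext_metric_triangle[OF B, of "f x" "f z" "f y" "real m * s" s] f zy Suc.prems(2) Suc.IH[OF z(1)] step[OF zy] s by auto
  then show ?case using zy by (simp add: algebra_simps)
qed

text \<open>Only the step size of the chains matters: the number of links is affine in the distance,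
  and the image of each link has length at most \<open>s\<close>.\<close>

lemma coarsely_lipschitz_of_local_control:
  assumes A: "quasigeodesic A d" and B: "ext_metric B e" and f: "f \<in> A \<rightarrow> B"
    and loc: "\<And>t. 0 \<le> t \<Longrightarrow> \<exists>s\<ge>0. \<forall>x\<in>A. \<forall>y\<in>A. d x y \<le> ennreal t \<longrightarrow> e (f x) (f y) \<le> ennreal s"
  shows "coarsely_lipschitz A d B e f"
proof -
  obtain t a b where t: "0 \<le> t" "0 \<le> a" "0 \<le> b"
    and chain: "\<And>x y p. \<lbrakk>x \<in> A; y \<in> A; 0 \<le> p; d x y \<le> ennreal p\<rbrakk> \<Longrightarrow>
       \<exists>m. (x, y) \<in> chain_rel A d t ^^ m \<and> real m \<le> a * p + b"
    using quasigeodesic_chains[OF A] by metis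
  obtain s where s: "0 \<le> s" "\<And>x y. \<lbrakk>x \<in> A; y \<in> A; d x y \<le> ennreal t\<rbrakk> \<Longrightarrow> e (f x) (f y) \<le> ennreal s"
    using loc[OF t(1)] by blast
  have "affine_control (a * s) (b * s) A d e f"
    unfolding affine_control_def
  proof (intro ballI impI)
    fix x y assume xy: "x \<in> A" "y \<in> A" "d x y < \<infinity>"
    obtain p where p: "0 \<le> p" "d x y = ennreal p" using less_top_ennreal[OF xy(3)] .
    obtain m where m: "(x, y) \<in> chain_rel A d t ^^ m" "real m \<le> a * p + b"
      using chain[OF xy(1,2) p(1)] p(2) by auto
    have "e (f x) (f y) \<le> ennreal (real m * s)"
      using chain_image_dist[OF B f s(1) s(2) m(1) xy(1)] by simp
    also have "\<dots> \<le> ennreal ((a * p + b) * s)" using m s by (intro ennreal_leI mult_right_mono) auto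
    also have "\<dots> = ennreal (a * s) * d x y + ennreal (b * s)"
      using p t s by (simp add: ennreal_plus[symmetric] ennreal_mult[symmetric] algebra_simps del: ennreal_plus)
    finally show "e (f x) (f y) \<le> ennreal (a * s) * d x y + ennreal (b * s)" .
  qed
  then show ?thesis unfolding coarsely_lipschitz_def using f t s by (meson mult_nonneg_nonneg)
qed

lemma relpow_reflcl:
  "(x, y) \<in> (E \<union> Id) ^^ m \<Longrightarrow> \<exists>k\<le>m. (x, y) \<in> E ^^ k"
proof (induction m arbitrary: y)
  case (Suc m)
  then obtain z where "(x, z) \<in> (E \<union> Id) ^^ m" "(z, y) \<in> E \<or> z = y" by auto
  moreover then obtain k where "k \<le> m" "(x, z) \<in> E ^^ k" using Suc.IH by blast
  ultimately show ?case by (metis le_SucI not_less_eq_eq relpow_Suc_I)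
qed simp

lemma relpow_image:
  assumes f: "\<And>u v. (u, v) \<in> F \<Longrightarrow> (f u, f v) \<in> G"
  shows "(x, y) \<in> F ^^ m \<Longrightarrow> (f x, f y) \<in> G ^^ m"
proof (induction m arbitrary: y)
  case (Suc m)
  then show ?case using f by (auto intro!: relpow_Suc_I)
qed simp

text \<open>Chains in \<open>A\<close> between points of \<open>A'\<close> are pushed into
  \<open>A'\<close> by \<open>r\<close>. The points of \<open>A'\<close> serve as vertices, with
  edges between distinct points at distance at most \<open>t'\<close>, and the identity is the
  quasi-isometry.\<close>

lemma quasigeodesic_retract:
  fixes d :: "'a \<Rightarrow> 'a \<Rightarrow> ennreal"
  assumes A: "ext_metric A d" "quasigeodesic A d" and retr: "coarse_retraction A d A' r"
  shows "quasigeodesic A' d"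
proof -
  obtain a0 b0 K where sub: "A' \<subseteq> A" and r: "r \<in> A \<rightarrow> A'" and c: "0 \<le> a0" "0 \<le> b0" "0 \<le> K"
    and lip: "affine_control a0 b0 A d d r" and close: "close_on K A' d r (\<lambda>x. x)"
    using retr unfolding coarse_retraction_def coarsely_lipschitz_def by blast
  obtain t a b where t: "0 \<le> t" "0 \<le> a" "0 \<le> b"
    and chain: "\<And>x y p. \<lbrakk>x \<in> A; y \<in> A; 0 \<le> p; d x y \<le> ennreal p\<rbrakk> \<Longrightarrow>
       \<exists>m. (x, y) \<in> chain_rel A d t ^^ m \<and> real m \<le> a * p + b"
    using quasigeodesic_chains[OF A(2)] by metis
  \<comment> \<open>Covers the image of a link, \<open>a0 * t + b0\<close>, as well as the
    corrections of size \<open>K\<close> between an end point and its image under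
    \<open>r\<close>.\<close>
  define t' where "t' = a0 * t + b0 + K"
  have t': "0 \<le> t'" unfolding t'_def using c t by simp
  \<comment> \<open>Loops are removed because the graph must be irreflexive. As \<open>r\<close> may
    collapse links, paths are first built in \<open>E \<union> Id\<close> and then
    shortened.\<close>
  define E where "E = chain_rel A' d t' - Id"
  have A': "ext_metric A' d" using ext_metric_subset A sub by blast
  have E: "E \<subseteq> A' \<times> A'" "irrefl E" "sym E"
    unfolding E_def chain_rel_def irrefl_def sym_def using ext_metric_sym[OF A'] by auto
  have EId: "(u, v) \<in> E \<union> Id" if "u \<in> A'" "v \<in> A'" "d u v \<le> ennreal t'" for u v
    using that unfolding E_def chain_rel_def by auto
  have path: "\<exists>k. (x, y) \<in> E ^^ k \<and> real k \<le> a * p + b + 2"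
    if xy: "x \<in> A'" "y \<in> A'" "0 \<le> p" "d x y \<le> ennreal p" for x y p
  proof -
    obtain m where m: "(x, y) \<in> chain_rel A d t ^^ m" "real m \<le> a * p + b"
      using chain[of x y p] xy sub by auto
    have rxy: "(r x, r y) \<in> (E \<union> Id) ^^ m"
    proof (rule relpow_image[OF _ m(1)])
      fix u v assume "(u, v) \<in> chain_rel A d t"
      then have uv: "u \<in> A" "v \<in> A" "d u v \<le> ennreal t" unfolding chain_rel_def by auto
      have "d (r u) (r v) \<le> ennreal (a0 * t + b0)"
        using affine_control_bound[OF lip uv c(1,2) t(1)] .
      also have "\<dots> \<le> ennreal t'" using c unfolding t'_def by (intro ennreal_leI) auto
      finally show "(r u, r v) \<in> E \<union> Id" using EId r uv by auto
    qed
    have rK: "d (r z) z \<le> ennreal t'" if "z \<in> A'" for z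
    proof -
      have "d (r z) z \<le> ennreal K" using close that unfolding close_on_def by auto
      also have "\<dots> \<le> ennreal t'" using c t unfolding t'_def by (intro ennreal_leI) auto
      finally show ?thesis .
    qed
    have rA: "r z \<in> A'" if "z \<in> A'" for z using r sub that by auto
    have ends: "(x, r x) \<in> E \<union> Id" "(r y, y) \<in> E \<union> Id"
      using EId[of x "r x"] EId[of "r y" y] rK[of x] rK[of y] rA[of x] rA[of y] xy(1,2)
        ext_metric_sym[OF A', of x "r x"] by auto
    obtain k where "k \<le> Suc (Suc m)" "(x, y) \<in> E ^^ k"
      using relpow_reflcl[OF relpow_Suc_I[OF relpow_Suc_I2[OF ends(1) rxy] ends(2)]] by (elim exE conjE)
    then show ?thesis using m(2) by (intro exI[of _ k]) auto
  qed
  \<comment> \<open>\<open>a\<close> serves the upper bound and \<open>t'\<close>, the length of an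
    edge, the lower bound. The 2 in \<open>b1\<close> counts the two end corrections.\<close>
  define a1 where "a1 = a + t' + 1"
  define b1 where "b1 = b + 2"
  have ab1: "1 \<le> a1" "0 \<le> b1" "a \<le> a1" "t' \<le> a1" using t t' unfolding a1_def b1_def by auto
  have up: "graph_dist E x y \<le> ennreal a1 * d x y + ennreal b1" if xy: "x \<in> A'" "y \<in> A'" for x y
  proof (cases "d x y")
    case (real p)
    obtain k where k: "(x, y) \<in> E ^^ k" "real k \<le> a * p + b + 2" using path[OF xy real(1)] real by auto
    have "graph_dist E x y \<le> ennreal (real k)" using graph_dist_le[OF k(1)] .
    also have "\<dots> \<le> ennreal (a1 * p + b1)"
    proof (rule ennreal_leI)
      have "a * p \<le> a1 * p" using ab1 real by (intro mult_right_mono) auto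
      then show "real k \<le> a1 * p + b1" using k(2) unfolding b1_def by simp
    qed
    finally show ?thesis using real ab1 by (simp add: ennreal_mult)
  next
    case top
    then show ?thesis using ab1 by (simp add: ennreal_mult_top)
  qed
  have low: "d x y \<le> ennreal a1 * graph_dist E x y + ennreal b1" if xy: "x \<in> A'" "y \<in> A'" for x y
  proof (cases "graph_dist E x y")
    case (real p)
    then obtain m where m: "(x, y) \<in> E ^^ m" "real m \<le> p" using graph_dist_path[of E x y p] by auto
    have "(x, y) \<in> chain_rel A' d t' ^^ m"
      using relpow_image[of E "\<lambda>x. x", OF _ m(1)] unfolding E_def by auto
    then have "d x y \<le> ennreal (real m * t')"
      using chain_image_dist[of A' d "\<lambda>x. x" A' t' d t' x y m, OF A' _ t'] xy by auto
    also have "\<dots> \<le> ennreal (a1 * p + b1)"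
    proof (rule ennreal_leI)
      have "real m * t' \<le> p * a1" using m(2) ab1 t' real by (intro mult_mono) auto
      then show "real m * t' \<le> a1 * p + b1" using ab1 by (simp add: mult.commute)
    qed
    finally show ?thesis using real ab1 by (simp add: ennreal_mult)
  next
    case top
    then show ?thesis using ab1 by (simp add: ennreal_mult_top)
  qed
  have "graph_dist E z z \<le> ennreal b1" for z
    using graph_dist_le[where E = E and x = z and y = z and m = 0] by simp
  then have "quasi_isometry A' d A' (graph_dist E) (\<lambda>x. x)"
    unfolding quasi_isometry_def using up low ab1(1,2)
    by (intro conjI exI[of _ a1] exI[of _ b1]) auto
  then show ?thesis unfolding quasigeodesic_def using E by blast
qed


section \<open>Coordinates on a hierarchically hyperbolic space\<close>

lemma diam_upper: "\<lbrakk>a \<in> A; b \<in> A; diam f A \<le> k\<rbrakk> \<Longrightarrow> f a b \<le> k"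
  unfolding diam_def by (auto simp: SUP_le_iff)

lemma linf_dist_le_iff: "linf_dist f g p q \<le> k \<longleftrightarrow> f (fst p) (fst q) \<le> k \<and> g (snd p) (snd q) \<le> k"
  unfolding linf_dist_def by simp

locale hhs_coordinates = hierarchically_hyperbolic_space +
  fixes lam :: "'b \<Rightarrow> 'a \<Rightarrow> 'c" and \<epsilon> :: real
  assumes lam: "\<And>U x. \<lbrakk>U \<in> S; x \<in> X\<rbrakk> \<Longrightarrow> lam U x \<in> \<pi> U x"
    and \<epsilon>: "0 \<le> \<epsilon>"
    and lam_consistent: "\<And>U V x. \<lbrakk>U \<in> S; V \<in> S; U \<noteq> V; x \<in> X\<rbrakk> \<Longrightarrow>
       (lam U x, lam V x) \<in> consistent_pairs C d (\<sqsubseteq>) (\<bottom>) \<rho> \<rho>m \<epsilon> U V"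
begin

abbreviation R where "R \<equiv> consistent_pairs C d (\<sqsubseteq>) (\<bottom>) \<rho> \<rho>m \<epsilon>"

section \<open>Real distances and representative points\<close>

definition e :: "'b \<Rightarrow> 'c \<Rightarrow> 'c \<Rightarrow> real" where "e U p q = enn2real (d U p q)"
definition rpt :: "'b \<Rightarrow> 'b \<Rightarrow> 'c" where "rpt V W = (SOME p. p \<in> \<rho> V W)"
definition spt :: "'b \<Rightarrow> 'b \<Rightarrow> 'c \<Rightarrow> 'c" where "spt W V p = (SOME q. q \<in> \<rho>m W V p)"
text \<open>Dominates all errors of the passage to representatives: one of \<open>\<kappa>0\<close>,
  \<open>\<epsilon>\<close>, \<open>E\<close>, \<open>\<alpha>0\<close> together with
  \<open>2 * \<xi> + 1\<close>, plus \<open>K0\<close> where density of the projections is used. It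
  is not optimised.\<close>

definition A0 :: real where "A0 = K0 + \<kappa>0 + \<epsilon> + 3 * \<xi> + E + \<alpha>0 + 3"

lemma nonneg: "0 \<le> \<xi>" "0 \<le> K0" "0 \<le> \<kappa>0" "0 \<le> \<alpha>0" "0 \<le> \<epsilon>" "0 \<le> E"
  using constants \<epsilon> by auto

lemma metric: "U \<in> S \<Longrightarrow> ext_metric (C U) (d U)"
  using hyperbolic unfolding hyperbolic_geodesic_space_def by blast

lemma geodesic:
  assumes "U \<in> S" "p \<in> C U" "q \<in> C U"
  obtains L \<gamma> where "geodesic_seg (C U) (d U) L \<gamma>" "\<gamma> 0 = p" "\<gamma> L = q"
  using hyperbolic[OF assms(1)] assms(2,3)
  unfolding hyperbolic_geodesic_space_def geodesic_image_between_def by blast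

text \<open>Points of a factor space are joined by geodesics of finite length, so the passage to
  real distances loses nothing.\<close>

lemma d_eq: assumes "U \<in> S" "p \<in> C U" "q \<in> C U" shows "d U p q = ennreal (e U p q)"
proof -
  obtain L \<gamma> where g: "geodesic_seg (C U) (d U) L \<gamma>" "\<gamma> 0 = p" "\<gamma> L = q"
    using geodesic[OF assms] .
  then have "d U p q = ennreal \<bar>0 - L\<bar>" unfolding geodesic_seg_def by force
  then show ?thesis unfolding e_def by simp
qed

lemma e_nonneg: "0 \<le> e U p q" unfolding e_def by simp

lemma d_le_iff: "\<lbrakk>U \<in> S; p \<in> C U; q \<in> C U; 0 \<le> t\<rbrakk> \<Longrightarrow> d U p q \<le> ennreal t \<longleftrightarrow> e U p q \<le> t"
  using d_eq by simp

lemma e_sym: "\<lbrakk>U \<in> S; p \<in> C U; q \<in> C U\<rbrakk> \<Longrightarrow> e U p q = e U q p"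
  unfolding e_def using ext_metric_sym[OF metric] by metis

lemma e_tri: assumes "U \<in> S" "p \<in> C U" "q \<in> C U" "t \<in> C U" shows "e U p t \<le> e U p q + e U q t"
  using ext_metric_triangle[OF metric[OF assms(1)] assms(2-4), of "e U p q" "e U q t"]
    d_eq assms e_nonneg by (simp add: d_le_iff flip: ennreal_plus)

text \<open>The diameters account for \<open>2 * \<xi>\<close>. The extra 1 is there because the
  infimum in \<open>dist_sets\<close> need not be attained.\<close>

lemma dist_sets_near:
  assumes U: "U \<in> S" and A: "A \<subseteq> C U" "diam (d U) A \<le> ennreal \<xi>" "a \<in> A"
    and B: "B \<subseteq> C U" "diam (d U) B \<le> ennreal \<xi>" "b \<in> B"
    and k: "dist_sets (d U) A B \<le> ennreal k" "0 \<le> k"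
  shows "e U a b \<le> k + 2 * \<xi> + 1"
proof -
  have "dist_sets (d U) A B < ennreal (k + 1)"
    using k by (meson ennreal_less_iff le_less_trans less_add_one)
  then obtain a' b' where ab: "a' \<in> A" "b' \<in> B" "d U a' b' < ennreal (k + 1)"
    unfolding dist_sets_def by (auto simp: INF_less_iff)
  have dA: "d U a a' \<le> ennreal \<xi>" using diam_upper[OF A(3) ab(1) A(2)] .
  have dB: "d U b' b \<le> ennreal \<xi>" using diam_upper[OF ab(2) B(3) B(2)] .
  have inC: "a \<in> C U" "a' \<in> C U" "b \<in> C U" "b' \<in> C U" using A B ab by auto
  have "e U a a' \<le> \<xi>" "e U b' b \<le> \<xi>" "e U a' b' \<le> k + 1"
    using dA dB ab(3) U inC nonneg k by (auto simp: d_le_iff[symmetric])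
  then show ?thesis using e_tri[OF U inC(1,2,3)] e_tri[OF U inC(2,4,3)] by simp
qed

lemma diam_singleton: "\<lbrakk>U \<in> S; p \<in> C U\<rbrakk> \<Longrightarrow> diam (d U) {p} \<le> ennreal \<xi>"
  unfolding diam_def using ext_metric_refl[OF metric] by auto

lemma proj: "\<lbrakk>U \<in> S; x \<in> X\<rbrakk> \<Longrightarrow> \<pi> U x \<subseteq> C U \<and> diam (d U) (\<pi> U x) \<le> ennreal \<xi>"
  using projections(1) by blast

lemma lam_in: "\<lbrakk>U \<in> S; x \<in> X\<rbrakk> \<Longrightarrow> lam U x \<in> C U"
  using proj lam by blast

lemma rho:
  assumes "V \<in> S" "W \<in> S" "(V \<sqsubseteq> W \<and> V \<noteq> W) \<or> transverse (\<sqsubseteq>) (\<bottom>) V W"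
  shows "rpt V W \<in> \<rho> V W" "\<rho> V W \<subseteq> C W" "diam (d W) (\<rho> V W) \<le> ennreal \<xi>" "rpt V W \<in> C W"
proof -
  have *: "\<rho> V W \<noteq> {} \<and> \<rho> V W \<subseteq> C W \<and> diam (d W) (\<rho> V W) \<le> ennreal \<xi>"
    using assms nesting(5) transversality by blast
  then show "rpt V W \<in> \<rho> V W" "\<rho> V W \<subseteq> C W" "diam (d W) (\<rho> V W) \<le> ennreal \<xi>"
    unfolding rpt_def by (auto simp: some_in_eq)
  then show "rpt V W \<in> C W" by auto
qed

lemma spt:
  assumes "V \<in> S" "W \<in> S" "V \<sqsubseteq> W" "V \<noteq> W" "p \<in> C W"
  shows "spt W V p \<in> \<rho>m W V p" "spt W V p \<in> C V"
proof -
  show "spt W V p \<in> \<rho>m W V p"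
    using nesting(6)[OF assms] unfolding spt_def by (simp add: some_in_eq)
  then show "spt W V p \<in> C V" using nesting(6)[OF assms] by blast
qed

lemma near_rho:
  assumes "V \<in> S" "W \<in> S" "(V \<sqsubseteq> W \<and> V \<noteq> W) \<or> transverse (\<sqsubseteq>) (\<bottom>) V W"
    and "p \<in> C W" "dist_sets (d W) {p} (\<rho> V W) \<le> ennreal k" "0 \<le> k"
  shows "e W p (rpt V W) \<le> k + 2 * \<xi> + 1"
  using dist_sets_near[OF assms(2), of "{p}" p "\<rho> V W" "rpt V W" k] rho[OF assms(1-3)]
    diam_singleton assms by auto

lemma R_in: "(p, q) \<in> R V W \<Longrightarrow> p \<in> C V \<and> q \<in> C W"
  unfolding consistent_pairs_def by auto

lemma R_transverse:
  assumes "V \<in> S" "W \<in> S" "transverse (\<sqsubseteq>) (\<bottom>) V W" "transverse (\<sqsubseteq>) (\<bottom>) W V" "(p, q) \<in> R V W"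
  shows "e W q (rpt V W) \<le> A0 \<or> e V p (rpt W V) \<le> A0"
proof -
  have "dist_sets (d V) {p} (\<rho> W V) \<le> ennreal \<epsilon> \<or> dist_sets (d W) {q} (\<rho> V W) \<le> ennreal \<epsilon>"
    using assms unfolding consistent_pairs_def by (auto simp: min_le_iff_disj)
  then show ?thesis
    using near_rho[of V W q \<epsilon>] near_rho[of W V p \<epsilon>] assms R_in[OF assms(5)] nonneg
    unfolding A0_def by fastforce
qed

lemma R_nested:
  assumes "V \<in> S" "W \<in> S" "V \<sqsubseteq> W" "V \<noteq> W" "(p, q) \<in> R V W"
  shows "e W q (rpt V W) \<le> A0 \<or> e V p (spt W V q) \<le> A0"
proof -
  have pq: "p \<in> C V" "q \<in> C W" using R_in[OF assms(5)] by auto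
  have "dist_sets (d W) {q} (\<rho> V W) \<le> ennreal \<epsilon> \<or> diam (d V) ({p} \<union> \<rho>m W V q) \<le> ennreal \<epsilon>"
    using assms unfolding consistent_pairs_def by (auto simp: min_le_iff_disj)
  then show ?thesis
  proof
    assume "dist_sets (d W) {q} (\<rho> V W) \<le> ennreal \<epsilon>"
    then show ?thesis using near_rho[of V W q \<epsilon>] assms pq nonneg unfolding A0_def by fastforce
  next
    assume "diam (d V) ({p} \<union> \<rho>m W V q) \<le> ennreal \<epsilon>"
    then have "d V p (spt W V q) \<le> ennreal \<epsilon>"
      using diam_upper[of p "{p} \<union> \<rho>m W V q" "spt W V q"] spt[OF assms(1-4) pq(2)] by blast
    then show ?thesis using d_le_iff[of V p "spt W V q" \<epsilon>] spt[OF assms(1-4) pq(2)] assms pq nonneg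
      unfolding A0_def by auto
  qed
qed

lemma transverse_sym: "\<lbrakk>V \<in> S; W \<in> S; transverse (\<sqsubseteq>) (\<bottom>) V W\<rbrakk> \<Longrightarrow> transverse (\<sqsubseteq>) (\<bottom>) W V"
  unfolding transverse_def using orthogonality(1) by (auto dest: symp_onD)

lemma coordinates_approximate_hierarchy:
  "coarse_hierarchy X S C e lam (\<sqsubseteq>) (\<bottom>) rpt spt A0 n l"
proof
  show "0 \<le> A0" "0 \<le> l" using nonneg constants unfolding A0_def by auto
  show "e U p q = e U q p" if "U \<in> S" "p \<in> C U" "q \<in> C U" for U p q using e_sym that .
  show "e U p t \<le> e U p q + e U q t" if "U \<in> S" "p \<in> C U" "q \<in> C U" "t \<in> C U" for U p q t
    using e_tri that .
  show "lam U x \<in> C U" if "U \<in> S" "x \<in> X" for U x using lam_in that .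
  show "V \<sqsubseteq> V" if "V \<in> S" for V using nesting(1) that by (auto dest: reflp_onD)
  show "V = W" if "V \<in> S" "W \<in> S" "V \<sqsubseteq> W" "W \<sqsubseteq> V" for V W
    using antisymp_onD[OF nesting(2)] that by blast
  show "U \<sqsubseteq> W" if "U \<in> S" "V \<in> S" "W \<in> S" "U \<sqsubseteq> V" "V \<sqsubseteq> W" for U V W
    using transp_onD[OF nesting(3), of U V W] that by blast
  show "M = M'" if "M \<in> S" "M' \<in> S" "\<forall>V\<in>S. M \<sqsubseteq> V \<longrightarrow> V = M" "\<forall>V\<in>S. M' \<sqsubseteq> V \<longrightarrow> V = M'" for M M'
    using nesting(4) that by blast
  show "W \<bottom> V" if "V \<in> S" "W \<in> S" "V \<bottom> W" for V W
    using symp_onD[OF orthogonality(1), of V W] that by blast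
  show "\<not> V \<bottom> V" if "V \<in> S" for V
    using irreflp_onD[OF orthogonality(2), of V] that by blast
  show "V \<bottom> U" if "V \<in> S" "W \<in> S" "U \<in> S" "V \<sqsubseteq> W" "W \<bottom> U" for V W U
    using orthogonality(3) that .
  show "\<exists>W\<in>S. W \<sqsubseteq> T \<and> W \<noteq> T \<and> (\<forall>V\<in>S. V \<bottom> U \<and> V \<sqsubseteq> T \<longrightarrow> V \<sqsubseteq> W)"
    if "T \<in> S" "U \<in> S" "U \<sqsubseteq> T" "V \<in> S" "V \<sqsubseteq> T" "V \<bottom> U" for T U V
    using orthogonality(4)[of T U] that by blast
  show "\<not> V \<sqsubseteq> W \<and> \<not> W \<sqsubseteq> V" if "V \<in> S" "W \<in> S" "V \<bottom> W" for V W
    using orthogonality(5) that .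
  show "rpt V W \<in> C W" if "V \<in> S" "W \<in> S" "(V \<sqsubseteq> W \<and> V \<noteq> W) \<or> transverse (\<sqsubseteq>) (\<bottom>) V W" for V W
    using rho that by blast
  show "spt W V p \<in> C V" if "V \<in> S" "W \<in> S" "V \<sqsubseteq> W" "V \<noteq> W" "p \<in> C W" for V W p
    using spt that by blast
  show "e W (lam W x) (rpt V W) \<le> A0 \<or> e V (lam V x) (rpt W V) \<le> A0"
    if "V \<in> S" "W \<in> S" "transverse (\<sqsubseteq>) (\<bottom>) V W" "x \<in> X" for V W x
    using R_transverse[OF that(1-3) transverse_sym[OF that(1-3)]] lam_consistent[of V W x] that
    unfolding transverse_def by blast
  show "e W (lam W x) (rpt V W) \<le> A0 \<or> e V (lam V x) (spt W V (lam W x)) \<le> A0"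
    if "V \<in> S" "W \<in> S" "V \<sqsubseteq> W" "V \<noteq> W" "x \<in> X" for V W x
    using R_nested[OF that(1-4)] lam_consistent[of V W x] that by blast
  show "e W (rpt U W) (rpt V W) \<le> A0"
    if UVW: "U \<in> S" "V \<in> S" "W \<in> S" "U \<sqsubseteq> V" "transverse (\<sqsubseteq>) (\<bottom>) V W" "\<not> W \<bottom> U" for U V W
  proof -
    have "\<not> W \<sqsubseteq> U" using transp_onD[OF nesting(3), of W U V] UVW unfolding transverse_def by blast
    moreover have "W \<sqsubseteq> W" using nesting(1) UVW(3) by (auto dest: reflp_onD)
    ultimately have UW: "(U \<sqsubseteq> W \<and> U \<noteq> W) \<or> transverse (\<sqsubseteq>) (\<bottom>) U W"
      using UVW symp_onD[OF orthogonality(1), of U W] unfolding transverse_def by blast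
    have "e W (rpt U W) (rpt V W) \<le> \<kappa>0 + 2 * \<xi> + 1"
      using dist_sets_near[OF UVW(3)] rho[OF UVW(1,3) UW] rho[OF UVW(2,3)] consistency(3)[of U V W] UVW nonneg
      by blast
    then show ?thesis using nonneg unfolding A0_def by simp
  qed
  show "finite B \<and> card B \<le> n" if "B \<subseteq> S" "\<forall>V\<in>B. \<forall>W\<in>B. V \<sqsubseteq> W \<or> W \<sqsubseteq> V" for B
    using finite_complexity that .
  show "\<exists>\<T>. \<T> \<subseteq> {V \<in> S. V \<sqsubseteq> W} - {W} \<and> finite \<T> \<and> card \<T> \<le> nat \<lfloor>l * D + l\<rfloor> \<and>
      (\<forall>T\<in>{V \<in> S. V \<sqsubseteq> W} - {W}. A0 < e T (lam T x) (lam T x') \<longrightarrow> (\<exists>T'\<in>\<T>. T \<sqsubseteq> T'))"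
    if W: "W \<in> S" "x \<in> X" "x' \<in> X" "e W (lam W x) (lam W x') \<le> D" for W x x' D
  proof -
    let ?N = "l * enn2real (dist_sets (d W) (\<pi> W x) (\<pi> W x')) + l"
    obtain \<T> where \<T>: "\<T> \<subseteq> {V \<in> S. V \<sqsubseteq> W} - {W}" "finite \<T>" "int (card \<T>) \<le> \<lfloor>?N\<rfloor>"
      "\<forall>T\<in>{V \<in> S. V \<sqsubseteq> W} - {W}. (\<exists>T'\<in>\<T>. T \<sqsubseteq> T') \<or> dist_sets (d T) (\<pi> T x) (\<pi> T x') < ennreal E"
      using large_links[OF W(1-3) refl] by blast
    \<comment> \<open>The axiom counts links by the distance of the projection sets, which is at
      most that of the chosen representatives.\<close>
    have "dist_sets (d W) (\<pi> W x) (\<pi> W x') \<le> d W (lam W x) (lam W x')"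
      unfolding dist_sets_def using lam W by (meson INF_lower2 order_refl)
    then have "enn2real (dist_sets (d W) (\<pi> W x) (\<pi> W x')) \<le> e W (lam W x) (lam W x')"
      using d_eq[OF W(1) lam_in lam_in] W e_nonneg by (metis enn2real_leI)
    then have "?N \<le> l * D + l" using W(4) constants(5) by (simp add: mult_left_mono)
    then have "\<lfloor>?N\<rfloor> \<le> \<lfloor>l * D + l\<rfloor>" by (rule floor_mono)
    then have card: "card \<T> \<le> nat \<lfloor>l * D + l\<rfloor>" using \<T>(3) by linarith
    have "\<exists>T'\<in>\<T>. T \<sqsubseteq> T'"
      if T: "T \<in> {V \<in> S. V \<sqsubseteq> W} - {W}" "A0 < e T (lam T x) (lam T x')" for T
    proof (rule ccontr)
      assume "\<not> ?thesis"
      then have "dist_sets (d T) (\<pi> T x) (\<pi> T x') \<le> ennreal E" using \<T>(4) T(1) by fastforce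
      then have "e T (lam T x) (lam T x') \<le> E + 2 * \<xi> + 1"
        using dist_sets_near[of T "\<pi> T x" "lam T x" "\<pi> T x'" "lam T x'" E] proj lam W T(1) nonneg by auto
      then show False using T(2) nonneg unfolding A0_def by simp
    qed
    then show ?thesis using \<T>(1,2) card by blast
  qed
  show "e W p (rpt V W) \<le> e W p q + A0 \<or> e V (spt W V p) (spt W V q) \<le> A0"
    if V: "V \<in> S" "W \<in> S" "V \<sqsubseteq> W" "V \<noteq> W" and pq: "p \<in> C W" "q \<in> C W" for V W p q
  proof -
    \<comment> \<open>Along a geodesic from \<open>p\<close> to \<open>q\<close>, a point near
      \<open>\<rho> V W\<close> has distance at most \<open>e W p q\<close> from \<open>p\<close>.
      This gives the first alternative.\<close>
    obtain L \<gamma> where g: "geodesic_seg (C W) (d W) L \<gamma>" "\<gamma> 0 = p" "\<gamma> L = q"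
      using geodesic[OF V(2) pq] .
    have L: "0 \<le> L" and gd: "\<And>s t. s \<in> {0..L} \<Longrightarrow> t \<in> {0..L} \<Longrightarrow> d W (\<gamma> s) (\<gamma> t) = ennreal \<bar>s - t\<bar>"
      and gC: "\<And>t. t \<in> {0..L} \<Longrightarrow> \<gamma> t \<in> C W"
      using g(1) unfolding geodesic_seg_def by auto
    have eL: "e W p q = L" using gd[of 0 L] L g unfolding e_def by simp
    show ?thesis
      using bounded_geodesic_image[OF V g(1)]
    proof
      assume dm: "diam (d V) (\<Union>t\<in>{0..L}. \<rho>m W V (\<gamma> t)) \<le> ennreal E"
      have "spt W V p \<in> (\<Union>t\<in>{0..L}. \<rho>m W V (\<gamma> t))" "spt W V q \<in> (\<Union>t\<in>{0..L}. \<rho>m W V (\<gamma> t))"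
        using spt[OF V pq(1)] spt[OF V pq(2)] g L by force+
      from diam_upper[OF this dm] have "e V (spt W V p) (spt W V q) \<le> E"
        using d_le_iff[OF V(1)] spt[OF V pq(1)] spt[OF V pq(2)] nonneg by auto
      then show ?thesis using nonneg unfolding A0_def by simp
    next
      assume "\<exists>t\<in>{0..L}. dist_sets (d W) {\<gamma> t} (\<rho> V W) \<le> ennreal E"
      then obtain t where t: "t \<in> {0..L}" "dist_sets (d W) {\<gamma> t} (\<rho> V W) \<le> ennreal E" by auto
      have "e W (\<gamma> t) (rpt V W) \<le> E + 2 * \<xi> + 1"
        using near_rho[OF V(1,2) _ gC[OF t(1)] t(2)] V nonneg by auto
      moreover have "e W p (\<gamma> t) \<le> L" using gd[of 0 t] t(1) L g unfolding e_def by simp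
      moreover have "e W p (rpt V W) \<le> e W p (\<gamma> t) + e W (\<gamma> t) (rpt V W)"
        using e_tri[OF V(2) pq(1) gC[OF t(1)]] rho V by blast
      ultimately show ?thesis using eL nonneg unfolding A0_def by simp
    qed
  qed
  show "\<exists>x\<in>X. (\<forall>V\<in>F. e V (lam V x) (p V) \<le> A0) \<and>
      (\<forall>V\<in>F. \<forall>W\<in>S. (V \<sqsubseteq> W \<and> V \<noteq> W) \<or> transverse (\<sqsubseteq>) (\<bottom>) V W \<longrightarrow> e W (lam W x) (rpt V W) \<le> A0)"
    if F: "F \<subseteq> S" "\<forall>V\<in>F. \<forall>W\<in>F. V \<noteq> W \<longrightarrow> V \<bottom> W" "\<forall>V\<in>F. p V \<in> C V" for F p
  proof -
    \<comment> \<open>The axiom realises only points in the images of the projections, so density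
      first replaces \<open>p V\<close> by such a point at distance at most
      \<open>K0\<close>.\<close>
    have "\<forall>V\<in>F. \<exists>q. q \<in> (\<Union>x\<in>X. \<pi> V x) \<and> d V (p V) q \<le> ennreal K0"
      using projections(3) F(1,3) by blast
    then obtain q where q: "\<forall>V\<in>F. q V \<in> (\<Union>x\<in>X. \<pi> V x) \<and> d V (p V) (q V) \<le> ennreal K0" by metis
    have "\<forall>V\<in>F. q V \<in> (\<Union>x\<in>X. \<pi> V x)" using q by simp
    from partial_realisation[OF F(1,2) this] obtain x where x: "x \<in> X" "\<forall>V\<in>F. dist_sets (d V) (\<pi> V x) {q V} \<le> ennreal \<alpha>0"
      "\<forall>V\<in>F. \<forall>W\<in>S. (V \<sqsubseteq> W \<and> V \<noteq> W) \<or> transverse (\<sqsubseteq>) (\<bottom>) W V \<longrightarrow>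
                dist_sets (d W) (\<pi> W x) (\<rho> V W) \<le> ennreal \<alpha>0"
      by (elim bexE conjE)
    have "e V (lam V x) (p V) \<le> A0" if "V \<in> F" for V
    proof -
      have V: "V \<in> S" "p V \<in> C V" "q V \<in> C V" using that F q proj by blast+
      have "e V (lam V x) (q V) \<le> \<alpha>0 + 2 * \<xi> + 1"
        using dist_sets_near[of V "\<pi> V x" "lam V x" "{q V}" "q V" \<alpha>0] V x that proj lam diam_singleton nonneg
        by auto
      moreover have "e V (q V) (p V) \<le> K0"
        using q that d_le_iff[OF V nonneg(2)] e_sym[OF V(1,3,2)] by simp
      ultimately show ?thesis
        using e_tri[of V "lam V x" "q V" "p V"] V x lam_in nonneg unfolding A0_def by simp
    qed
    moreover have "e W (lam W x) (rpt V W) \<le> A0"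
      if V: "V \<in> F" "W \<in> S" "(V \<sqsubseteq> W \<and> V \<noteq> W) \<or> transverse (\<sqsubseteq>) (\<bottom>) V W" for V W
    proof -
      have "V \<in> S" using V F by auto
      then have "dist_sets (d W) (\<pi> W x) (\<rho> V W) \<le> ennreal \<alpha>0"
        using x(3) V transverse_sym[of V W] by blast
      then have "e W (lam W x) (rpt V W) \<le> \<alpha>0 + 2 * \<xi> + 1"
        using dist_sets_near[OF V(2)] proj[OF V(2) x(1)] lam[OF V(2) x(1)] rho[OF \<open>V \<in> S\<close> V(2,3)] nonneg
        by blast
      then show ?thesis using nonneg unfolding A0_def by simp
    qed
    ultimately show ?thesis using x(1) by blast
  qed
qed

text \<open>\<open>K\<close> is chosen before \<open>b\<close>. This makes it possible to realise a
  whole family of tuples, one for each point of a space, with a common error.\<close>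

lemma coarse_realisation:
  assumes c: "0 \<le> c"
  shows "\<exists>K\<ge>0. \<forall>b. (\<forall>U\<in>S. b U \<in> C U) \<longrightarrow>
      (\<forall>U\<in>S. \<forall>V\<in>S. U \<noteq> V \<longrightarrow> (\<exists>q\<in>R U V. linf_dist (d U) (d V) (b U, b V) q \<le> ennreal c)) \<longrightarrow>
      (\<exists>x\<in>X. \<forall>U\<in>S. d U (lam U x) (b U) \<le> ennreal K)"
proof -
  interpret coarse: coarse_hierarchy X S C e lam "(\<sqsubseteq>)" "(\<bottom>)" rpt spt A0 n l
    by (rule coordinates_approximate_hierarchy)
  \<comment> \<open>The worst case is nesting: \<open>c\<close> from \<open>b V\<close> to
    \<open>p\<close>, one \<open>A0\<close> from consistency of \<open>(p, q)\<close> and another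
    for changing \<open>q\<close> into \<open>b W\<close> inside \<open>spt\<close>.\<close>
  define \<kappa> where "\<kappa> = 2 * A0 + c"
  have A0: "0 \<le> A0" using coarse.const by simp
  have \<kappa>: "A0 \<le> \<kappa>" "0 \<le> \<kappa>" using A0 c unfolding \<kappa>_def by auto
  define K where "K = 5 * (n * n + 2) * \<kappa>"
  show ?thesis
  proof (intro exI[of _ K] conjI allI impI)
    show K: "0 \<le> K" using \<kappa> unfolding K_def by simp
    fix b assume b: "\<forall>U\<in>S. b U \<in> C U"
      "\<forall>U\<in>S. \<forall>V\<in>S. U \<noteq> V \<longrightarrow> (\<exists>q\<in>R U V. linf_dist (d U) (d V) (b U, b V) q \<le> ennreal c)"
    have approx: "\<exists>p q. (p, q) \<in> R V W \<and> p \<in> C V \<and> q \<in> C W \<and> e V (b V) p \<le> c \<and> e W (b W) q \<le> c"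
      if V: "V \<in> S" "W \<in> S" "V \<noteq> W" for V W
    proof -
      obtain p q where pq: "(p, q) \<in> R V W" "linf_dist (d V) (d W) (b V, b W) (p, q) \<le> ennreal c"
        using b(2) V by (metis surj_pair)
      then show ?thesis using R_in[OF pq(1)] b(1) V c d_le_iff unfolding linf_dist_def by auto
    qed
    have "coarse.consistent_tuple \<kappa> b"
      unfolding coarse.consistent_tuple_def
    proof (intro conjI ballI impI)
      fix V W assume V: "V \<in> S" "W \<in> S" and tr: "transverse (\<sqsubseteq>) (\<bottom>) V W"
      obtain p q where pq: "(p, q) \<in> R V W" "p \<in> C V" "q \<in> C W" "e V (b V) p \<le> c" "e W (b W) q \<le> c"
        using approx[of V W] V tr unfolding transverse_def by blast
      show "e W (b W) (rpt V W) \<le> \<kappa> \<or> e V (b V) (rpt W V) \<le> \<kappa>"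
        using R_transverse[OF V tr transverse_sym[OF V tr] pq(1)] pq V b(1) A0 c
          e_tri[of W "b W" q "rpt V W"] e_tri[of V "b V" p "rpt W V"]
          rho(4)[OF V] rho(4)[OF V(2,1)] tr transverse_sym[OF V tr] unfolding \<kappa>_def by fastforce
    next
      fix V W assume V: "V \<in> S" "W \<in> S" and nest: "V \<sqsubseteq> W \<and> V \<noteq> W"
      obtain p q where pq: "(p, q) \<in> R V W" "p \<in> C V" "q \<in> C W" "e V (b V) p \<le> c" "e W (b W) q \<le> c"
        using approx[of V W] V nest by blast
      have bC: "b V \<in> C V" "b W \<in> C W" using b V by auto
      have s: "spt W V q \<in> C V" "spt W V (b W) \<in> C V" using spt V nest pq bC by blast+
      have r: "rpt V W \<in> C W" using rho V nest by blast
      have "e W q (rpt V W) \<le> A0 \<or> e V p (spt W V q) \<le> A0" using R_nested V nest pq(1) by blast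
      then show "e W (b W) (rpt V W) \<le> \<kappa> \<or> e V (b V) (spt W V (b W)) \<le> \<kappa>"
      proof
        assume "e W q (rpt V W) \<le> A0"
        then show ?thesis using e_tri[OF V(2) bC(2) pq(3) r] pq(5) A0 unfolding \<kappa>_def by simp
      next
        assume ps: "e V p (spt W V q) \<le> A0"
        \<comment> \<open>The map \<open>spt W V\<close> is not assumed coarsely Lipschitz. Bounded
          geodesic image allows its argument to be changed, except near \<open>rpt V W\<close>,
          where the other alternative of consistency holds.\<close>
        have "e W (b W) (rpt V W) \<le> e W (b W) q + A0 \<or> e V (spt W V (b W)) (spt W V q) \<le> A0"
          using coarse.bounded_geodesic_image[OF V _ _ bC(2) pq(3)] nest by blast
        then show ?thesis
          using pq(4,5) ps A0 e_tri[OF V(1) bC(1) pq(2) s(1)] e_tri[OF V(1) bC(1) s] e_sym[OF V(1) s]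
          unfolding \<kappa>_def by linarith
      qed
    qed (use b in auto)
    from coarse.realisation[OF this \<kappa>(1)]
    show "\<exists>x\<in>X. \<forall>U\<in>S. d U (lam U x) (b U) \<le> ennreal K"
      unfolding K_def[symmetric] using d_le_iff[OF _ lam_in _ K] b(1) by blast
  qed
qed

lemma e_trans:
  "\<lbrakk>e U p q \<le> u; e U q t \<le> v; U \<in> S; p \<in> C U; q \<in> C U; t \<in> C U\<rbrakk> \<Longrightarrow> e U p t \<le> u + v"
  using e_tri[of U p q t] by simp

lemma close_on_iff:
  assumes "U \<in> S" "0 \<le> \<kappa>" "\<And>x. x \<in> D \<Longrightarrow> f x \<in> C U" "\<And>x. x \<in> D \<Longrightarrow> g x \<in> C U"
  shows "close_on \<kappa> D (d U) f g \<longleftrightarrow> (\<forall>x\<in>D. e U (f x) (g x) \<le> \<kappa>)"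
  unfolding close_on_def using d_le_iff[OF assms(1) assms(3,4) assms(2)] by simp

lemma lam_lipschitz:
  assumes U: "U \<in> S" and x: "x \<in> X" "y \<in> X" and p: "dX x y \<le> ennreal p" "0 \<le> p"
  shows "e U (lam U x) (lam U y) \<le> K0 * p + (K0 + 2 * \<xi> + 1)"
proof -
  have "dist_sets (d U) (\<pi> U x) (\<pi> U y) \<le> ennreal (K0 * p + K0)"
    using affine_bound[OF projections(2)[OF U x] p(1)] nonneg p by simp
  then have "e U (lam U x) (lam U y) \<le> (K0 * p + K0) + 2 * \<xi> + 1"
    using dist_sets_near[of U "\<pi> U x" "lam U x" "\<pi> U y" "lam U y" "K0 * p + K0"] U x proj lam nonneg p
    by auto
  then show ?thesis by simp
qed

text \<open>The uniqueness axiom read backwards, at level \<open>\<kappa> + 1\<close>, which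
  coordinates at distance \<open>\<kappa>\<close> cannot reach. The maximum with 0 takes care of
  negative values of \<open>\<theta>\<close>.\<close>

lemma close_of_close_coordinates:
  assumes "0 \<le> \<kappa>"
  obtains t where "0 \<le> t"
    "\<And>x y. \<lbrakk>x \<in> X; y \<in> X; \<And>U. U \<in> S \<Longrightarrow> e U (lam U x) (lam U y) \<le> \<kappa>\<rbrakk> \<Longrightarrow> dX x y \<le> ennreal t"
proof (rule that[of "max 0 (\<theta> (\<kappa> + 1))"])
  fix x y assume x: "x \<in> X" "y \<in> X" and close: "\<And>U. U \<in> S \<Longrightarrow> e U (lam U x) (lam U y) \<le> \<kappa>"
  have "\<not> ennreal (\<theta> (\<kappa> + 1)) \<le> dX x y"
  proof
    assume "ennreal (\<theta> (\<kappa> + 1)) \<le> dX x y"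
    then obtain V where V: "V \<in> S" "ennreal (\<kappa> + 1) \<le> dist_sets (d V) (\<pi> V x) (\<pi> V y)"
      using uniqueness[of "\<kappa> + 1" x y] x assms by auto
    have "dist_sets (d V) (\<pi> V x) (\<pi> V y) \<le> d V (lam V x) (lam V y)"
      unfolding dist_sets_def using lam V x by (meson INF_lower2 order_refl)
    also have "\<dots> \<le> ennreal \<kappa>"
      using d_le_iff[OF V(1) lam_in lam_in assms] V(1) x close by simp
    finally have "ennreal (\<kappa> + 1) \<le> ennreal \<kappa>" using V(2) by simp
    then show False using assms by simp
  qed
  then show "dX x y \<le> ennreal (max 0 (\<theta> (\<kappa> + 1)))"
    by (metis ennreal_leI linorder_le_cases max.cobounded2 order.trans)
qed simp

text \<open>Coordinates bound \<open>dX\<close> at each scale separately, through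
  \<open>\<theta>\<close>. The quasigeodesic domain \<open>W\<close> upgrades this to affine
  control.\<close>

lemma coarsely_lipschitz_of_coordinates:
  assumes W: "quasigeodesic W dW" and f: "f \<in> W \<rightarrow> X"
    and \<mu>: "\<And>U. U \<in> S \<Longrightarrow> \<mu> U \<in> W \<rightarrow> C U"
    and lip: "0 \<le> a" "0 \<le> b" "\<And>U. U \<in> S \<Longrightarrow> affine_control a b W dW (d U) (\<mu> U)"
    and close: "0 \<le> \<kappa>" "\<And>U w. \<lbrakk>U \<in> S; w \<in> W\<rbrakk> \<Longrightarrow> e U (\<mu> U w) (lam U (f w)) \<le> \<kappa>"
  shows "coarsely_lipschitz W dW X dX f"
proof (rule coarsely_lipschitz_of_local_control[OF W space(1) f])
  fix t :: real assume t: "0 \<le> t"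
  have "0 \<le> \<kappa> + (a * t + b) + \<kappa>" using lip(1,2) close(1) t by simp
  then obtain s where s: "0 \<le> s"
    "\<And>x y. \<lbrakk>x \<in> X; y \<in> X; \<And>U. U \<in> S \<Longrightarrow> e U (lam U x) (lam U y) \<le> \<kappa> + (a * t + b) + \<kappa>\<rbrakk> \<Longrightarrow> dX x y \<le> ennreal s"
    using close_of_close_coordinates by metis
  have "dX (f w) (f w') \<le> ennreal s" if w: "w \<in> W" "w' \<in> W" "dW w w' \<le> ennreal t" for w w'
  proof (rule s(2))
    show "f w \<in> X" "f w' \<in> X" using f w by auto
    fix U assume U: "U \<in> S"
    have inC: "\<mu> U w \<in> C U" "\<mu> U w' \<in> C U" "lam U (f w) \<in> C U" "lam U (f w') \<in> C U"
      using \<mu>[OF U] w f lam_in[OF U] by auto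
    have "e U (\<mu> U w) (\<mu> U w') \<le> a * t + b"
      using affine_control_bound[OF lip(3)[OF U] w lip(1,2) t] d_le_iff[OF U inC(1,2)] lip t
      by (simp del: ennreal_plus)
    moreover have "e U (lam U (f w)) (\<mu> U w) \<le> \<kappa>" using close(2)[OF U w(1)] e_sym[OF U inC(1,3)] by simp
    moreover have "e U (\<mu> U w') (lam U (f w')) \<le> \<kappa>" using close(2)[OF U w(2)] .
    ultimately show "e U (lam U (f w)) (lam U (f w')) \<le> \<kappa> + (a * t + b) + \<kappa>"
      using e_trans U inC by meson
  qed
  then show "\<exists>s\<ge>0. \<forall>x\<in>W. \<forall>y\<in>W. dW x y \<le> ennreal t \<longrightarrow> dX (f x) (f y) \<le> ennreal s"
    using s(1) by blast
qed

lemma R_swap: "\<lbrakk>U \<in> S; V \<in> S\<rbrakk> \<Longrightarrow> (p, q) \<in> R U V \<Longrightarrow> (q, p) \<in> R V U"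
  using transverse_sym[of V U] unfolding consistent_pairs_def by (auto simp: min.commute)

end



section \<open>Induced retractions\<close>

locale hhs_retractions = hhs_coordinates +
  fixes C' :: "'b \<Rightarrow> 'c set" and \<alpha> :: "'b \<Rightarrow> 'c \<Rightarrow> 'c" and a b K c :: real
  assumes control_nonneg: "0 \<le> a" "0 \<le> b" "0 \<le> K" "0 \<le> c"
    and C'_sub: "\<And>U. U \<in> S \<Longrightarrow> C' U \<subseteq> C U"
    and \<alpha>_in: "\<And>U p. \<lbrakk>U \<in> S; p \<in> C U\<rbrakk> \<Longrightarrow> \<alpha> U p \<in> C' U"
    and \<alpha>_lipschitz: "\<And>U. U \<in> S \<Longrightarrow> affine_control a b (C U) (d U) (d U) (\<alpha> U)"
    and \<alpha>_close: "\<And>U p. \<lbrakk>U \<in> S; p \<in> C' U\<rbrakk> \<Longrightarrow> d U (\<alpha> U p) p \<le> ennreal K"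
    and \<alpha>_consistent: "\<And>U V p q. \<lbrakk>U \<in> S; V \<in> S; U \<noteq> V; (p, q) \<in> R U V\<rbrakk> \<Longrightarrow>
       \<exists>z\<in>R U V. linf_dist (d U) (d V) (\<alpha> U p, \<alpha> V q) z \<le> ennreal c"
begin

abbreviation R' where "R' \<equiv> image_constraints \<alpha> R"
abbreviation induced where "induced \<equiv> induced_retraction X dX S d R lam C' \<alpha>"

section \<open>The constraint sets of the retracted factors\<close>

lemma \<alpha>_in_C: "\<lbrakk>U \<in> S; p \<in> C U\<rbrakk> \<Longrightarrow> \<alpha> U p \<in> C U"
  using \<alpha>_in C'_sub by blast

lemma \<alpha>_bound:
  assumes "e U p q \<le> t" "U \<in> S" "p \<in> C U" "q \<in> C U"
  shows "e U (\<alpha> U p) (\<alpha> U q) \<le> a * t + b"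
proof -
  have t: "0 \<le> t" using assms(1) e_nonneg[of U p q] by linarith
  have "d U p q \<le> ennreal t" using d_le_iff assms t by simp
  from affine_control_bound[OF \<alpha>_lipschitz[OF assms(2)] assms(3,4) this control_nonneg(1,2) t]
  show ?thesis using d_le_iff \<alpha>_in_C assms control_nonneg t by (simp del: ennreal_plus)
qed

lemma \<alpha>_fixes: "\<lbrakk>U \<in> S; p \<in> C' U\<rbrakk> \<Longrightarrow> e U (\<alpha> U p) p \<le> K"
  using \<alpha>_close d_le_iff[of U "\<alpha> U p" p K] \<alpha>_in_C C'_sub control_nonneg by blast

lemma R'_subset: "\<lbrakk>U \<in> S; V \<in> S\<rbrakk> \<Longrightarrow> R' U V \<subseteq> C' U \<times> C' V"
  unfolding image_constraints_def using R_in \<alpha>_in by force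

text \<open>Brings pairs that satisfy the retracted constraints back to \<open>R\<close>, so that
  realisation in \<open>X\<close> applies to cones over the retracted diagram.\<close>

lemma R'_near_R:
  assumes "U \<in> S" "V \<in> S" "U \<noteq> V" "z \<in> R' U V"
  obtains p q where "(p, q) \<in> R U V" "e U (fst z) p \<le> c" "e V (snd z) q \<le> c"
proof -
  obtain p0 q0 where z: "z = (\<alpha> U p0, \<alpha> V q0)" "(p0, q0) \<in> R U V"
    using assms(4) unfolding image_constraints_def by auto
  obtain p q where pq: "(p, q) \<in> R U V" "linf_dist (d U) (d V) z (p, q) \<le> ennreal c"
    using \<alpha>_consistent[OF assms(1-3) z(2)] z(1) by auto
  have "p \<in> C U" "q \<in> C V" "fst z \<in> C U" "snd z \<in> C V"
    using R_in[OF pq(1)] R_in[OF z(2)] \<alpha>_in_C assms(1,2) z(1) by auto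
  then show ?thesis using that[OF pq(1)] pq(2) d_le_iff assms(1,2) control_nonneg by (simp add: linf_dist_le_iff)
qed

lemma R'_swap:
  assumes "U \<in> S" "V \<in> S" shows "R' V U = prod.swap ` R' U V"
proof -
  have "prod.swap z \<in> R' V U" if "z \<in> R' U V" "U \<in> S" "V \<in> S" for z U V
    using that R_swap unfolding image_constraints_def by (force simp: image_iff)
  then show ?thesis using assms by (metis (no_types, lifting) image_eqI image_subsetI subsetI subset_antisym swap_swap)
qed

lemma total_diagram: "total_diagram S C' d R'"
  unfolding total_diagram_def
proof (intro conjI ballI impI)
  fix U assume "U \<in> S" then show "ext_metric (C' U) (d U)"
    using ext_metric_subset[OF metric C'_sub] by blast
next
  fix U V assume "U \<in> S" "V \<in> S"
  then show "R' U V \<subseteq> C' U \<times> C' V" "R' V U = prod.swap ` R' U V"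
    using R'_subset R'_swap by blast+
qed

lemma \<alpha>_lam_control:
  assumes "U \<in> S" "D \<subseteq> X"
  shows "affine_control (a * K0) (a * (K0 + 2 * \<xi> + 1) + b) D dX (d U) (\<lambda>x. \<alpha> U (lam U x))"
  unfolding affine_control_def
proof (intro ballI impI)
  fix x y assume xy: "x \<in> D" "y \<in> D" "dX x y < \<infinity>"
  then obtain p where p: "0 \<le> p" "dX x y = ennreal p" using less_top_ennreal by blast
  have inX: "x \<in> X" "y \<in> X" using xy assms by auto
  have "e U (\<alpha> U (lam U x)) (\<alpha> U (lam U y)) \<le> a * (K0 * p + (K0 + 2 * \<xi> + 1)) + b"
    using \<alpha>_bound[OF lam_lipschitz[OF assms(1) inX, of p]] p assms(1) lam_in inX by simp
  then have "d U (\<alpha> U (lam U x)) (\<alpha> U (lam U y)) \<le> ennreal (a * K0 * p + (a * (K0 + 2 * \<xi> + 1) + b))"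
    using d_eq[OF assms(1) \<alpha>_in_C \<alpha>_in_C] assms(1) lam_in inX by (simp add: ennreal_leI algebra_simps)
  also have "\<dots> = ennreal (a * K0) * dX x y + ennreal (a * (K0 + 2 * \<xi> + 1) + b)"
    using p control_nonneg nonneg by (simp add: ennreal_plus[symmetric] ennreal_mult[symmetric] del: ennreal_plus)
  finally show "d U (\<alpha> U (lam U x)) (\<alpha> U (lam U y)) \<le>
    ennreal (a * K0) * dX x y + ennreal (a * (K0 + 2 * \<xi> + 1) + b)" .
qed

theorem induced_retraction_exists: "\<exists>X' r lam' lam2'. induced X' r lam' lam2'"
proof -
  obtain K1 where K1: "0 \<le> K1" and realise: "\<forall>b. (\<forall>U\<in>S. b U \<in> C U) \<longrightarrow>
      (\<forall>U\<in>S. \<forall>V\<in>S. U \<noteq> V \<longrightarrow> (\<exists>q\<in>R U V. linf_dist (d U) (d V) (b U, b V) q \<le> ennreal c)) \<longrightarrow>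
      (\<exists>x\<in>X. \<forall>U\<in>S. d U (lam U x) (b U) \<le> ennreal K1)"
    using coarse_realisation[OF control_nonneg(4)] by (elim exE conjE)
  have "\<forall>x\<in>X. \<exists>y. y \<in> X \<and> (\<forall>U\<in>S. d U (lam U y) (\<alpha> U (lam U x)) \<le> ennreal K1)"
  proof
    fix x assume x: "x \<in> X"
    have "\<exists>y\<in>X. \<forall>U\<in>S. d U (lam U y) (\<alpha> U (lam U x)) \<le> ennreal K1"
    proof (rule realise[rule_format])
      show "\<alpha> U (lam U x) \<in> C U" if "U \<in> S" for U using x lam_in \<alpha>_in_C that by simp
      show "\<exists>q\<in>R U V. linf_dist (d U) (d V) (\<alpha> U (lam U x), \<alpha> V (lam V x)) q \<le> ennreal c"
        if "U \<in> S" "V \<in> S" "U \<noteq> V" for U V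
        using \<alpha>_consistent[OF that lam_consistent[OF that x]] .
    qed
    then show "\<exists>y. y \<in> X \<and> (\<forall>U\<in>S. d U (lam U y) (\<alpha> U (lam U x)) \<le> ennreal K1)" by blast
  qed
  then obtain r where r: "\<forall>x\<in>X. r x \<in> X \<and> (\<forall>U\<in>S. d U (lam U (r x)) (\<alpha> U (lam U x)) \<le> ennreal K1)"
    by metis
  have rX: "r x \<in> X" if "x \<in> X" for x using r that by blast
  have re: "e U (lam U (r x)) (\<alpha> U (lam U x)) \<le> K1" "e U (\<alpha> U (lam U x)) (lam U (r x)) \<le> K1"
    if "U \<in> S" "x \<in> X" for U x
  proof -
    have inC: "lam U (r x) \<in> C U" "\<alpha> U (lam U x) \<in> C U" using that lam_in \<alpha>_in_C rX by auto
    show "e U (lam U (r x)) (\<alpha> U (lam U x)) \<le> K1" using r that d_le_iff[OF that(1) inC K1] by blast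
    then show "e U (\<alpha> U (lam U x)) (lam U (r x)) \<le> K1" using e_sym[OF that(1) inC] by simp
  qed
  define X' where "X' = r ` X"
  have X': "X' \<subseteq> X" "\<And>x. x \<in> X \<Longrightarrow> r x \<in> X'" using rX unfolding X'_def by auto
  \<comment> \<open>On \<open>X'\<close> the coordinates \<open>lam\<close> are only close to
    \<open>C' U\<close>. Composing with \<open>\<alpha> U\<close> makes the legs land in
    \<open>C' U\<close>, and their pairs in \<open>R' U V\<close>, exactly.\<close>
  define lam' where "lam' = (\<lambda>U y. \<alpha> U (lam U y))"
  define lam2' where "lam2' = (\<lambda>U V y. (\<alpha> U (lam U y), \<alpha> V (lam V y)))"
  define K2 where "K2 = (a * K1 + b) + K + K1"
  have K2: "0 \<le> K2" using control_nonneg K1 unfolding K2_def by simp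
  \<comment> \<open>For \<open>y = r x\<close> the coordinate \<open>lam U y\<close> is within
    \<open>K1\<close> of a point of \<open>C' U\<close>. That point is moved by at most
    \<open>K\<close> under \<open>\<alpha> U\<close>, which enlarges \<open>K1\<close> to at most
    \<open>a * K1 + b\<close>.\<close>
  have fixed: "e U (\<alpha> U (lam U y)) (lam U y) \<le> K2" if U: "U \<in> S" and y: "y \<in> X'" for U y
  proof -
    obtain x where x: "x \<in> X" "y = r x" using y unfolding X'_def by auto
    have inC: "lam U x \<in> C U" "lam U y \<in> C U" "\<alpha> U (lam U x) \<in> C U" "\<alpha> U (lam U y) \<in> C U"
      "\<alpha> U (\<alpha> U (lam U x)) \<in> C U" "\<alpha> U (lam U x) \<in> C' U"
      using U x lam_in rX \<alpha>_in_C \<alpha>_in by auto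
    have "e U (\<alpha> U (lam U y)) (\<alpha> U (\<alpha> U (lam U x))) \<le> a * K1 + b"
      using \<alpha>_bound re(1)[OF U x(1)] U inC x(2) by simp
    moreover have "e U (\<alpha> U (\<alpha> U (lam U x))) (\<alpha> U (lam U x)) \<le> K" using \<alpha>_fixes U inC by simp
    moreover have "e U (\<alpha> U (lam U x)) (lam U y) \<le> K1" using re(2)[OF U x(1)] x(2) by simp
    ultimately show ?thesis unfolding K2_def using e_trans U inC by meson
  qed
  have lip: "coarsely_lipschitz X dX X dX r"
  proof (rule coarsely_lipschitz_of_coordinates[OF space(3), of _ "\<lambda>U x. \<alpha> U (lam U x)"
        "a * K0" "a * (K0 + 2 * \<xi> + 1) + b" K1])
    show "0 \<le> a * K0" "0 \<le> a * (K0 + 2 * \<xi> + 1) + b" using control_nonneg nonneg by auto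
  qed (use rX re K1 \<alpha>_in_C lam_in \<alpha>_lam_control in auto)
  have "0 \<le> K1 + K2" using K1 K2 by simp
  then obtain t where t: "0 \<le> t"
    "\<And>x y. \<lbrakk>x \<in> X; y \<in> X; \<And>U. U \<in> S \<Longrightarrow> e U (lam U x) (lam U y) \<le> K1 + K2\<rbrakk> \<Longrightarrow> dX x y \<le> ennreal t"
    using close_of_close_coordinates by metis
  have "close_on t X' dX r (\<lambda>x. x)"
    unfolding close_on_def
  proof
    fix y assume y: "y \<in> X'"
    then have yX: "y \<in> X" using X' by auto
    show "dX (r y) y \<le> ennreal t"
    proof (rule t(2)[OF rX[OF yX] yX])
      fix U assume U: "U \<in> S"
      show "e U (lam U (r y)) (lam U y) \<le> K1 + K2"
        using e_trans[OF re(1)[OF U yX] fixed[OF U y] U] lam_in \<alpha>_in_C U yX rX by simp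
    qed
  qed
  then have retr: "coarse_retraction X dX X' r"
    unfolding coarse_retraction_def using X' lip t(1) unfolding coarsely_lipschitz_def by auto
  have cone: "qg_uc_cone S C' d R' X' dX lam' lam2'"
    unfolding qg_uc_cone_def
  proof (intro conjI ballI impI)
    show "ext_metric X' dX" using ext_metric_subset[OF space(1) X'(1)] .
    show "quasigeodesic X' dX" using quasigeodesic_retract[OF space(1,3) retr] .
    show "lam' U \<in> X' \<rightarrow> C' U" if "U \<in> S" for U
      using that lam_in X' \<alpha>_in unfolding lam'_def by auto
    show "lam2' U V \<in> X' \<rightarrow> R' U V" if "U \<in> S" "V \<in> S" "U \<noteq> V" for U V
      using that lam_consistent X' unfolding lam2'_def image_constraints_def by force
    show "lam2' V U w = prod.swap (lam2' U V w)" for U V w unfolding lam2'_def by simp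
    have control: "affine_control (a * K0) (a * (K0 + 2 * \<xi> + 1) + b) X' dX (d U) (lam' U)" if "U \<in> S" for U
      using \<alpha>_lam_control[OF that X'(1)] unfolding lam'_def .
    have "affine_control (a * K0) (a * (K0 + 2 * \<xi> + 1) + b) X' dX (linf_dist (d U) (d V)) (lam2' U V)"
      if "U \<in> S" "V \<in> S" for U V
      using control that unfolding affine_control_def lam'_def lam2'_def by (simp add: linf_dist_le_iff)
    moreover have "0 \<le> a * K0" "0 \<le> a * (K0 + 2 * \<xi> + 1) + b" using control_nonneg nonneg by auto
    ultimately show "\<exists>a\<ge>0. \<exists>b\<ge>0. (\<forall>U\<in>S. affine_control a b X' dX (d U) (lam' U)) \<and>
        (\<forall>U\<in>S. \<forall>V\<in>S. U \<noteq> V \<longrightarrow> affine_control a b X' dX (linf_dist (d U) (d V)) (lam2' U V))"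
      using control by blast
    have "d U (lam' U w) (lam' U w) \<le> ennreal 0" if "U \<in> S" "w \<in> X'" for U w
      using ext_metric_refl[OF metric[OF that(1)]] \<alpha>_in_C lam_in that X' unfolding lam'_def by auto
    then show "\<exists>\<kappa>\<ge>0. \<forall>U\<in>S. \<forall>V\<in>S. U \<noteq> V \<longrightarrow>
        close_on \<kappa> X' (d U) (fst \<circ> lam2' U V) (lam' U) \<and> close_on \<kappa> X' (d V) (snd \<circ> lam2' U V) (lam' V)"
      unfolding close_on_def lam2'_def lam'_def by (intro exI[of _ 0]) auto
  qed
  have "close_on (K2 + K1) X (d U) (lam' U \<circ> r) (\<alpha> U \<circ> lam U)" if U: "U \<in> S" for U
  proof -
    have "e U (\<alpha> U (lam U (r x))) (\<alpha> U (lam U x)) \<le> K2 + K1" if x: "x \<in> X" for x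
      using e_trans[OF fixed[OF U X'(2)[OF x]] re(1)[OF U x] U] lam_in \<alpha>_in_C U x rX by simp
    then show ?thesis
      using close_on_iff[OF U, of "K2 + K1" X] K1 K2 lam_in \<alpha>_in_C U rX unfolding lam'_def by simp
  qed
  moreover have "close_on K2 X' (d U) (lam U) (lam' U)" if U: "U \<in> S" for U
  proof -
    have "e U (lam U y) (\<alpha> U (lam U y)) \<le> K2" if y: "y \<in> X'" for y
      using fixed[OF U y] e_sym[OF U] lam_in[OF U] \<alpha>_in_C[OF U] y X'(1) by (metis subsetD)
    then show ?thesis
      using close_on_iff[OF U K2, of X' "lam U" "\<lambda>y. \<alpha> U (lam U y)"] lam_in[OF U] \<alpha>_in_C[OF U]
        subsetD[OF X'(1)] unfolding lam'_def by simp
  qed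
  ultimately have "induced X' r lam' lam2'"
    unfolding induced_retraction_def using retr cone K1 K2 by (meson add_nonneg_nonneg)
  then show ?thesis by blast
qed

lemma induced_coordinates:
  assumes "induced X' r lam' lam2'"
  shows "\<exists>\<kappa>1 \<kappa>2. 0 \<le> \<kappa>1 \<and> 0 \<le> \<kappa>2 \<and> X' \<subseteq> X \<and> (\<forall>x\<in>X. r x \<in> X') \<and>
    (\<forall>U\<in>S. \<forall>y\<in>X'. lam' U y \<in> C' U) \<and>
    (\<forall>U\<in>S. \<forall>x\<in>X. e U (lam' U (r x)) (\<alpha> U (lam U x)) \<le> \<kappa>1) \<and>
    (\<forall>U\<in>S. \<forall>y\<in>X'. e U (lam U y) (lam' U y) \<le> \<kappa>2)"
proof -
  have sub: "X' \<subseteq> X" and r: "\<And>x. x \<in> X \<Longrightarrow> r x \<in> X'"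
    using assms unfolding induced_retraction_def coarse_retraction_def coarsely_lipschitz_def by auto
  have lam': "lam' U y \<in> C' U" if "U \<in> S" "y \<in> X'" for U y
    using assms that unfolding induced_retraction_def qg_uc_cone_def by auto
  obtain \<kappa>1 where \<kappa>1: "0 \<le> \<kappa>1" "\<forall>U\<in>S. close_on \<kappa>1 X (d U) (lam' U \<circ> r) (\<alpha> U \<circ> lam U)"
    using assms unfolding induced_retraction_def by blast
  obtain \<kappa>2 where \<kappa>2: "0 \<le> \<kappa>2" "\<forall>U\<in>S. close_on \<kappa>2 X' (d U) (lam U) (lam' U)"
    using assms unfolding induced_retraction_def by blast
  have C: "lam' U y \<in> C U" if "U \<in> S" "y \<in> X'" for U y using lam' that C'_sub by blast
  have "e U (lam' U (r x)) (\<alpha> U (lam U x)) \<le> \<kappa>1" if "U \<in> S" "x \<in> X" for U x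
    using \<kappa>1 that close_on_iff[OF that(1) \<kappa>1(1), of X "lam' U \<circ> r" "\<alpha> U \<circ> lam U"] C r \<alpha>_in_C lam_in by auto
  moreover have "e U (lam U y) (lam' U y) \<le> \<kappa>2" if "U \<in> S" "y \<in> X'" for U y
    using \<kappa>2 that close_on_iff[OF that(1) \<kappa>2(1), of X' "lam U" "lam' U"] C lam_in[OF that(1)] subsetD[OF sub]
    by blast
  ultimately show ?thesis
    using \<kappa>1(1) \<kappa>2(1) sub r lam' by (intro exI[of _ \<kappa>1] exI[of _ \<kappa>2] conjI ballI)
qed

text \<open>Both retractions have coordinates near \<open>\<alpha> U (lam U x)\<close>. They are
  compared in \<open>X\<close>, since the two subspaces may differ.\<close>

theorem induced_retraction_unique:
  assumes "induced X1 r1 lam1 lam2_1" "induced X2 r2 lam2 lam2_2"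
  shows "\<exists>\<kappa>\<ge>0. close_on \<kappa> X dX r1 r2"
proof -
  obtain \<kappa>1 \<kappa>2 where 1: "0 \<le> \<kappa>1" "0 \<le> \<kappa>2" "X1 \<subseteq> X" "\<forall>x\<in>X. r1 x \<in> X1"
    "\<forall>U\<in>S. \<forall>y\<in>X1. lam1 U y \<in> C' U"
    "\<forall>U\<in>S. \<forall>x\<in>X. e U (lam1 U (r1 x)) (\<alpha> U (lam U x)) \<le> \<kappa>1"
    "\<forall>U\<in>S. \<forall>y\<in>X1. e U (lam U y) (lam1 U y) \<le> \<kappa>2"
    using induced_coordinates[OF assms(1)] by (elim exE conjE)
  note 1 = 1[rule_format]
  obtain \<kappa>3 \<kappa>4 where 2: "0 \<le> \<kappa>3" "0 \<le> \<kappa>4" "X2 \<subseteq> X" "\<forall>x\<in>X. r2 x \<in> X2"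
    "\<forall>U\<in>S. \<forall>y\<in>X2. lam2 U y \<in> C' U"
    "\<forall>U\<in>S. \<forall>x\<in>X. e U (lam2 U (r2 x)) (\<alpha> U (lam U x)) \<le> \<kappa>3"
    "\<forall>U\<in>S. \<forall>y\<in>X2. e U (lam U y) (lam2 U y) \<le> \<kappa>4"
    using induced_coordinates[OF assms(2)] by (elim exE conjE)
  note 2 = 2[rule_format]
  let ?k = "(\<kappa>2 + \<kappa>1) + (\<kappa>4 + \<kappa>3)"
  have "0 \<le> ?k" using 1 2 by simp
  then obtain t where t: "0 \<le> t"
    "\<And>x y. \<lbrakk>x \<in> X; y \<in> X; \<And>U. U \<in> S \<Longrightarrow> e U (lam U x) (lam U y) \<le> ?k\<rbrakk> \<Longrightarrow> dX x y \<le> ennreal t"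
    using close_of_close_coordinates by metis
  have "dX (r1 x) (r2 x) \<le> ennreal t" if x: "x \<in> X" for x
  proof (rule t(2))
    show rX: "r1 x \<in> X" "r2 x \<in> X" using 1(3,4) 2(3,4) x by auto
    fix U assume U: "U \<in> S"
    have inC: "lam U (r1 x) \<in> C U" "lam U (r2 x) \<in> C U" "\<alpha> U (lam U x) \<in> C U"
      "lam1 U (r1 x) \<in> C U" "lam2 U (r2 x) \<in> C U"
      using U rX x lam_in \<alpha>_in_C subsetD[OF C'_sub[OF U] 1(5)[OF U 1(4)]]
        subsetD[OF C'_sub[OF U] 2(5)[OF U 2(4)]] by auto
    have "e U (lam U (r1 x)) (\<alpha> U (lam U x)) \<le> \<kappa>2 + \<kappa>1"
      using e_trans[OF 1(7)[OF U 1(4)[OF x]] 1(6)[OF U x] U] inC by simp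
    moreover have "e U (lam U (r2 x)) (\<alpha> U (lam U x)) \<le> \<kappa>4 + \<kappa>3"
      using e_trans[OF 2(7)[OF U 2(4)[OF x]] 2(6)[OF U x] U] inC by simp
    ultimately show "e U (lam U (r1 x)) (lam U (r2 x)) \<le> ?k"
      using e_trans[of U "lam U (r1 x)" "\<alpha> U (lam U x)" "\<kappa>2 + \<kappa>1" "lam U (r2 x)" "\<kappa>4 + \<kappa>3"]
        e_sym[OF U inC(2,3)] U inC by simp
  qed
  then show ?thesis using t(1) unfolding close_on_def by blast
qed

theorem induced_retraction_universal:
  assumes ind: "induced X' r lam' lam2'"
  shows "universal_qg_uc_cone TYPE('w) S C' d R' X' dX lam' lam2'"
  unfolding universal_qg_uc_cone_def
proof (intro conjI allI impI)
  show "total_diagram S C' d R'" by (rule total_diagram)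
  show cone': "qg_uc_cone S C' d R' X' dX lam' lam2'"
    using ind unfolding induced_retraction_def by blast
  obtain \<kappa>1 \<kappa>2 where 1: "0 \<le> \<kappa>1" "0 \<le> \<kappa>2" "X' \<subseteq> X" "\<forall>x\<in>X. r x \<in> X'"
    "\<forall>U\<in>S. \<forall>y\<in>X'. lam' U y \<in> C' U"
    "\<forall>U\<in>S. \<forall>x\<in>X. e U (lam' U (r x)) (\<alpha> U (lam U x)) \<le> \<kappa>1"
    "\<forall>U\<in>S. \<forall>y\<in>X'. e U (lam U y) (lam' U y) \<le> \<kappa>2"
    using induced_coordinates[OF ind] by (elim exE conjE)
  note 1 = 1[rule_format]
  have lam'C: "lam' U y \<in> C U" if "U \<in> S" "y \<in> X'" for U y
    using subsetD[OF C'_sub 1(5)] that by simp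
  have lamC: "lam U y \<in> C U" if "U \<in> S" "y \<in> X'" for U y
    using lam_in subsetD[OF 1(3)] that by simp
  fix W :: "'w set" and dW \<mu> \<mu>2 assume cone: "qg_uc_cone S C' d R' W dW \<mu> \<mu>2"
  have W: "quasigeodesic W dW" using cone unfolding qg_uc_cone_def by blast
  have \<mu>: "\<mu> U w \<in> C' U" "\<mu> U w \<in> C U" if "U \<in> S" "w \<in> W" for U w
  proof -
    have "\<forall>U\<in>S. \<mu> U \<in> W \<rightarrow> C' U" using cone unfolding qg_uc_cone_def by (elim conjE)
    then show "\<mu> U w \<in> C' U" using that by auto
    then show "\<mu> U w \<in> C U" using C'_sub that by blast
  qed
  {
    \<comment> \<open>Uniqueness of the factorisation: on \<open>X'\<close> the legs
      \<open>lam'\<close> are close to the coordinates \<open>lam\<close>, so \<open>f\<close> and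
      \<open>g\<close> both have coordinates near the legs \<open>\<mu>\<close> and are close in
      \<open>dX\<close>.\<close>
    fix f g assume f: "cone_factorisation S d X' dX lam' lam2' W dW \<mu> \<mu>2 f"
      and g: "cone_factorisation S d X' dX lam' lam2' W dW \<mu> \<mu>2 g"
    have in_X': "f w \<in> X'" "g w \<in> X'" if "w \<in> W" for w
      using f g that unfolding cone_factorisation_def coarsely_lipschitz_def by auto
    obtain \<kappa>f where \<kappa>f: "0 \<le> \<kappa>f" "\<forall>U\<in>S. close_on \<kappa>f W (d U) (\<mu> U) (lam' U \<circ> f)"
      "\<forall>U\<in>S. \<forall>V\<in>S. U \<noteq> V \<longrightarrow>
         close_on \<kappa>f W (linf_dist (d U) (d V)) (\<mu>2 U V) (lam2' U V \<circ> f)"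
      using f[unfolded cone_factorisation_def, THEN conjunct2] by (elim exE conjE)
    obtain \<kappa>g where \<kappa>g: "0 \<le> \<kappa>g" "\<forall>U\<in>S. close_on \<kappa>g W (d U) (\<mu> U) (lam' U \<circ> g)"
      "\<forall>U\<in>S. \<forall>V\<in>S. U \<noteq> V \<longrightarrow>
         close_on \<kappa>g W (linf_dist (d U) (d V)) (\<mu>2 U V) (lam2' U V \<circ> g)"
      using g[unfolded cone_factorisation_def, THEN conjunct2] by (elim exE conjE)
    let ?k = "(\<kappa>f + \<kappa>2) + (\<kappa>g + \<kappa>2)"
    have "0 \<le> ?k" using 1 \<kappa>f \<kappa>g by simp
    then obtain t where t: "0 \<le> t"
      "\<And>x y. \<lbrakk>x \<in> X; y \<in> X; \<And>U. U \<in> S \<Longrightarrow> e U (lam U x) (lam U y) \<le> ?k\<rbrakk> \<Longrightarrow> dX x y \<le> ennreal t"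
      using close_of_close_coordinates by metis
    have near: "e U (\<mu> U w) (lam U (h w)) \<le> \<kappa> + \<kappa>2"
      if "close_on \<kappa> W (d U) (\<mu> U) (lam' U \<circ> h)" "0 \<le> \<kappa>" "U \<in> S" "w \<in> W" "h w \<in> X'" for \<kappa> U w h
    proof -
      have "e U (\<mu> U w) (lam' U (h w)) \<le> \<kappa>"
        using that d_le_iff[OF that(3) \<mu>(2)[OF that(3,4)] lam'C[OF that(3,5)] that(2)]
        unfolding close_on_def by auto
      moreover have "e U (lam' U (h w)) (lam U (h w)) \<le> \<kappa>2"
        using 1(7)[OF that(3,5)] e_sym[OF that(3) lam'C[OF that(3,5)] lamC[OF that(3,5)]] by simp
      ultimately show ?thesis
        using e_trans[OF _ _ that(3) \<mu>(2)[OF that(3,4)] lam'C[OF that(3,5)] lamC[OF that(3,5)]] by blast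
    qed
    have "dX (f w) (g w) \<le> ennreal t" if w: "w \<in> W" for w
    proof (rule t(2))
      show "f w \<in> X" "g w \<in> X" using in_X' w 1(3) by auto
      fix U assume U: "U \<in> S"
      have "e U (\<mu> U w) (lam U (f w)) \<le> \<kappa>f + \<kappa>2"
        by (rule near) (use \<kappa>f U w in_X' in auto)
      moreover have "e U (\<mu> U w) (lam U (g w)) \<le> \<kappa>g + \<kappa>2"
        by (rule near) (use \<kappa>g U w in_X' in auto)
      ultimately show "e U (lam U (f w)) (lam U (g w)) \<le> ?k"
        using e_tri[of U "lam U (f w)" "\<mu> U w" "lam U (g w)"] e_sym[of U "\<mu> U w" "lam U (f w)"]
          U w \<mu> lamC in_X' by simp
    qed
    then show "\<exists>\<kappa>\<ge>0. close_on \<kappa> W dX f g" using t(1) unfolding close_on_def by blast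
  }
  obtain a' b' where ab': "0 \<le> a'" "0 \<le> b'" "\<forall>U\<in>S. affine_control a' b' W dW (d U) (\<mu> U)"
      "\<forall>U\<in>S. \<forall>V\<in>S. U \<noteq> V \<longrightarrow> affine_control a' b' W dW (linf_dist (d U) (d V)) (\<mu>2 U V)"
    using cone[unfolded qg_uc_cone_def, THEN conjunct2, THEN conjunct2, THEN conjunct2, THEN conjunct2, THEN conjunct1]
    by (elim exE conjE)
  obtain \<kappa> where \<kappa>: "0 \<le> \<kappa>" "\<forall>U\<in>S. \<forall>V\<in>S. U \<noteq> V \<longrightarrow>
      close_on \<kappa> W (d U) (fst \<circ> \<mu>2 U V) (\<mu> U) \<and> close_on \<kappa> W (d V) (snd \<circ> \<mu>2 U V) (\<mu> V)"
    using cone[unfolded qg_uc_cone_def, THEN conjunct2, THEN conjunct2, THEN conjunct2, THEN conjunct2, THEN conjunct2]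
    by (elim exE conjE)
  obtain \<kappa>' where \<kappa>': "0 \<le> \<kappa>'" "\<forall>U\<in>S. \<forall>V\<in>S. U \<noteq> V \<longrightarrow>
      close_on \<kappa>' X' (d U) (fst \<circ> lam2' U V) (lam' U) \<and> close_on \<kappa>' X' (d V) (snd \<circ> lam2' U V) (lam' V)"
    using cone'[unfolded qg_uc_cone_def, THEN conjunct2, THEN conjunct2, THEN conjunct2, THEN conjunct2, THEN conjunct2]
    by (elim exE conjE)
  have \<mu>2: "\<mu>2 U V w \<in> R' U V" if "U \<in> S" "V \<in> S" "U \<noteq> V" "w \<in> W" for U V w
    using cone[unfolded qg_uc_cone_def, THEN conjunct2, THEN conjunct2, THEN conjunct2, THEN conjunct1] that
    by blast
  have lam2': "lam2' U V y \<in> R' U V" if "U \<in> S" "V \<in> S" "U \<noteq> V" "y \<in> X'" for U V y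
    using cone'[unfolded qg_uc_cone_def, THEN conjunct2, THEN conjunct2, THEN conjunct2, THEN conjunct1] that
    by blast
  have R'C: "fst z \<in> C U" "snd z \<in> C V" if "z \<in> R' U V" "U \<in> S" "V \<in> S" for z U V
    using R'_subset[OF that(2,3)] that C'_sub by fastforce+
  have \<mu>2_close: "e U (fst (\<mu>2 U V w)) (\<mu> U w) \<le> \<kappa>" "e V (snd (\<mu>2 U V w)) (\<mu> V w) \<le> \<kappa>"
    if "U \<in> S" "V \<in> S" "U \<noteq> V" "w \<in> W" for U V w
    using \<kappa>(2) that d_le_iff[OF that(1) R'C(1)[OF \<mu>2[OF that] that(1,2)] \<mu>(2)[OF that(1,4)] \<kappa>(1)]
      d_le_iff[OF that(2) R'C(2)[OF \<mu>2[OF that] that(1,2)] \<mu>(2)[OF that(2,4)] \<kappa>(1)]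
    unfolding close_on_def by auto
  have lam2'_close: "e U (fst (lam2' U V y)) (lam' U y) \<le> \<kappa>'" "e V (snd (lam2' U V y)) (lam' V y) \<le> \<kappa>'"
    if "U \<in> S" "V \<in> S" "U \<noteq> V" "y \<in> X'" for U V y
    using \<kappa>'(2) that d_le_iff[OF that(1) R'C(1)[OF lam2'[OF that] that(1,2)] lam'C[OF that(1,4)] \<kappa>'(1)]
      d_le_iff[OF that(2) R'C(2)[OF lam2'[OF that] that(1,2)] lam'C[OF that(2,4)] \<kappa>'(1)]
    unfolding close_on_def by auto
  have \<kappa>c: "0 \<le> \<kappa> + c" using \<kappa> control_nonneg by simp
  obtain K1 where K1: "0 \<le> K1" and realise: "\<forall>b. (\<forall>U\<in>S. b U \<in> C U) \<longrightarrow>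
      (\<forall>U\<in>S. \<forall>V\<in>S. U \<noteq> V \<longrightarrow>
         (\<exists>q\<in>R U V. linf_dist (d U) (d V) (b U, b V) q \<le> ennreal (\<kappa> + c))) \<longrightarrow>
      (\<exists>x\<in>X. \<forall>U\<in>S. d U (lam U x) (b U) \<le> ennreal K1)"
    using coarse_realisation[OF \<kappa>c] by (elim exE conjE)
  have "\<exists>x\<in>X. \<forall>U\<in>S. d U (lam U x) (\<mu> U w) \<le> ennreal K1" if w: "w \<in> W" for w
  proof (rule realise[rule_format])
    show "\<mu> U w \<in> C U" if "U \<in> S" for U using \<mu>(2)[OF that w] .
    \<comment> \<open>The pair is within \<open>\<kappa>\<close> of \<open>\<mu>2 U V w\<close>, an
      element of \<open>R' U V\<close>, which in turn is within \<open>c\<close> of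
      \<open>R U V\<close>.\<close>
    show "\<exists>q\<in>R U V. linf_dist (d U) (d V) (\<mu> U w, \<mu> V w) q \<le> ennreal (\<kappa> + c)"
      if UV: "U \<in> S" "V \<in> S" "U \<noteq> V" for U V
    proof -
      note z = R'C[OF \<mu>2[OF UV w] UV(1,2)]
      obtain p q where pq: "(p, q) \<in> R U V" "e U (fst (\<mu>2 U V w)) p \<le> c" "e V (snd (\<mu>2 U V w)) q \<le> c"
        using R'_near_R[OF UV \<mu>2[OF UV w]] .
      have C: "p \<in> C U" "q \<in> C V" using R_in[OF pq(1)] by auto
      have "e U (\<mu> U w) p \<le> \<kappa> + c"
        using e_tri[OF UV(1) \<mu>(2)[OF UV(1) w] z(1) C(1)] e_sym[OF UV(1) z(1) \<mu>(2)[OF UV(1) w]]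
          \<mu>2_close(1)[OF UV w] pq(2) by simp
      moreover have "e V (\<mu> V w) q \<le> \<kappa> + c"
        using e_tri[OF UV(2) \<mu>(2)[OF UV(2) w] z(2) C(2)] e_sym[OF UV(2) z(2) \<mu>(2)[OF UV(2) w]]
          \<mu>2_close(2)[OF UV w] pq(3) by simp
      ultimately show "\<exists>q\<in>R U V. linf_dist (d U) (d V) (\<mu> U w, \<mu> V w) q \<le> ennreal (\<kappa> + c)"
        using pq(1) d_le_iff UV \<mu>(2) w C \<kappa>c by (intro bexI[of _ "(p, q)"]) (auto simp: linf_dist_le_iff)
    qed
  qed
  then obtain f0 where f0: "\<And>w. w \<in> W \<Longrightarrow> f0 w \<in> X"
    "\<And>w U. w \<in> W \<Longrightarrow> U \<in> S \<Longrightarrow> d U (lam U (f0 w)) (\<mu> U w) \<le> ennreal K1"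
    by metis
  define f where "f = (\<lambda>w. r (f0 w))"
  have f: "f w \<in> X'" if "w \<in> W" for w using 1(4) f0(1) that unfolding f_def by simp
  \<comment> \<open>\<open>K\<close> because \<open>\<mu> U w\<close> lies in \<open>C' U\<close>
    and is nearly fixed by \<open>\<alpha> U\<close>, \<open>a * K1 + b\<close> for the realisation
    error after \<open>\<alpha> U\<close>, and \<open>\<kappa>1\<close> for the coordinates of
    \<open>r\<close>.\<close>
  define \<kappa>3 where "\<kappa>3 = K + (a * K1 + b) + \<kappa>1"
  have \<kappa>3: "0 \<le> \<kappa>3" using control_nonneg K1 1 unfolding \<kappa>3_def by simp
  have \<mu>f: "e U (\<mu> U w) (lam' U (f w)) \<le> \<kappa>3" if U: "U \<in> S" and w: "w \<in> W" for U w
  proof -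
    have inC: "\<mu> U w \<in> C U" "lam U (f0 w) \<in> C U" "\<alpha> U (\<mu> U w) \<in> C U" "\<alpha> U (lam U (f0 w)) \<in> C U"
      "lam' U (f w) \<in> C U"
      using \<mu> U w f0(1) lam_in \<alpha>_in_C lam'C f by auto
    have "e U (\<mu> U w) (lam U (f0 w)) \<le> K1"
      using f0(2)[OF w U] d_le_iff[OF U inC(2,1) K1] e_sym[OF U inC(1,2)] by simp
    then have "e U (\<alpha> U (\<mu> U w)) (\<alpha> U (lam U (f0 w))) \<le> a * K1 + b" using \<alpha>_bound U inC by simp
    moreover have "e U (\<mu> U w) (\<alpha> U (\<mu> U w)) \<le> K"
      using \<alpha>_fixes[OF U \<mu>(1)[OF U w]] e_sym[OF U inC(1,3)] by simp
    moreover have "e U (\<alpha> U (lam U (f0 w))) (lam' U (f w)) \<le> \<kappa>1"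
      using 1(6)[OF U f0(1)[OF w]] e_sym[OF U inC(4,5)] unfolding f_def by simp
    ultimately show ?thesis
      using e_tri[OF U inC(1,3,4)] e_tri[OF U inC(1,4,5)] unfolding \<kappa>3_def by linarith
  qed
  have "coarsely_lipschitz W dW X dX f"
  proof (rule coarsely_lipschitz_of_coordinates[OF W _ _ ab'(1,2) ab'(3)[rule_format]])
    show "f \<in> W \<rightarrow> X" using f 1(3) by auto
    show "\<And>U. U \<in> S \<Longrightarrow> \<mu> U \<in> W \<rightarrow> C U" using \<mu> by auto
    show "0 \<le> \<kappa>3 + \<kappa>2" using \<kappa>3 1 by simp
    show "e U (\<mu> U w) (lam U (f w)) \<le> \<kappa>3 + \<kappa>2" if "U \<in> S" "w \<in> W" for U w
      using e_tri[OF that(1) \<mu>(2)[OF that] lam'C[OF that(1) f[OF that(2)]] lamC[OF that(1) f[OF that(2)]]]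
        \<mu>f[OF that] 1(7)[OF that(1) f[OF that(2)]]
        e_sym[OF that(1) lam'C[OF that(1) f[OF that(2)]] lamC[OF that(1) f[OF that(2)]]] by simp
  qed
  then have lip: "coarsely_lipschitz W dW X' dX f"
    unfolding coarsely_lipschitz_def using f by auto
  define \<kappa>4 where "\<kappa>4 = \<kappa> + \<kappa>3 + \<kappa>'"
  have \<kappa>4: "0 \<le> \<kappa>4" "\<kappa>3 \<le> \<kappa>4" using \<kappa> \<kappa>3 \<kappa>' unfolding \<kappa>4_def by auto
  have "close_on \<kappa>4 W (d U) (\<mu> U) (lam' U \<circ> f)" if U: "U \<in> S" for U
    using close_on_iff[OF U \<kappa>4(1), of W "\<mu> U" "lam' U \<circ> f"] \<mu>(2) lam'C f U \<mu>f \<kappa>4(2) order.trans by fastforce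
  \<comment> \<open>In both cones the legs to the constraint sets are close to the pairs of primary
    legs, so the estimate for the latter suffices, at the cost of the two cone errors
    \<open>\<kappa>\<close> and \<open>\<kappa>'\<close>.\<close>
  moreover have "close_on \<kappa>4 W (linf_dist (d U) (d V)) (\<mu>2 U V) (lam2' U V \<circ> f)"
    if UV: "U \<in> S" "V \<in> S" "U \<noteq> V" for U V
    unfolding close_on_def linf_dist_le_iff comp_def
  proof (intro ballI conjI)
    fix w assume w: "w \<in> W"
    note z = R'C[OF \<mu>2[OF UV w] UV(1,2)] and z' = R'C[OF lam2'[OF UV f[OF w]] UV(1,2)]
    have combine: "d T p q \<le> ennreal \<kappa>4"
      if T: "T \<in> S" and p: "p \<in> C T" "q \<in> C T" "e T p (\<mu> T w) \<le> \<kappa>" "e T q (lam' T (f w)) \<le> \<kappa>'" for T p q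
    proof -
      have inC: "\<mu> T w \<in> C T" "lam' T (f w) \<in> C T" using \<mu>(2) lam'C f T w by auto
      have "e T p q \<le> \<kappa>4"
        using e_tri[OF T p(1) inC] e_tri[OF T p(1) inC(2) p(2)] e_sym[OF T p(2) inC(2)] p(3,4) \<mu>f[OF T w]
        unfolding \<kappa>4_def by simp
      then show ?thesis using d_le_iff[OF T p(1,2) \<kappa>4(1)] by simp
    qed
    show "d U (fst (\<mu>2 U V w)) (fst (lam2' U V (f w))) \<le> ennreal \<kappa>4"
      using combine[OF UV(1) z(1) z'(1) \<mu>2_close(1)[OF UV w] lam2'_close(1)[OF UV f[OF w]]] .
    show "d V (snd (\<mu>2 U V w)) (snd (lam2' U V (f w))) \<le> ennreal \<kappa>4"
      using combine[OF UV(2) z(2) z'(2) \<mu>2_close(2)[OF UV w] lam2'_close(2)[OF UV f[OF w]]] .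
  qed
  ultimately have "cone_factorisation S d X' dX lam' lam2' W dW \<mu> \<mu>2 f"
    unfolding cone_factorisation_def using lip \<kappa>4(1) by blast
  then show "\<exists>f. cone_factorisation S d X' dX lam' lam2' W dW \<mu> \<mu>2 f" by blast
qed

end

theorem theorem1p13:
  fixes X :: "'x set" and dX :: "'x \<Rightarrow> 'x \<Rightarrow> ennreal"
    and S :: "'i set" and C C' :: "'i \<Rightarrow> 'c set" and d :: "'i \<Rightarrow> 'c \<Rightarrow> 'c \<Rightarrow> ennreal"
    and \<pi> :: "'i \<Rightarrow> 'x \<Rightarrow> 'c set" and nest orth :: "'i \<Rightarrow> 'i \<Rightarrow> bool"
    and \<rho> :: "'i \<Rightarrow> 'i \<Rightarrow> 'c set" and \<rho>m :: "'i \<Rightarrow> 'i \<Rightarrow> 'c \<Rightarrow> 'c set"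
    and \<delta> \<xi> K0 \<kappa>0 l E \<alpha>0 \<epsilon> :: real and n :: nat and \<theta> :: "real \<Rightarrow> real"
    and lam :: "'i \<Rightarrow> 'x \<Rightarrow> 'c" and \<alpha> :: "'i \<Rightarrow> 'c \<Rightarrow> 'c"
    and R :: "'i \<Rightarrow> 'i \<Rightarrow> ('c \<times> 'c) set"
  assumes hhs: "hierarchically_hyperbolic_space X dX S \<delta> C d \<pi> nest orth \<rho> \<rho>m \<xi> K0 \<kappa>0 n l E \<alpha>0 \<theta>"
    and lam: "\<forall>U\<in>S. \<forall>x\<in>X. lam U x \<in> \<pi> U x"
    and R: "R = consistent_pairs C d nest orth \<rho> \<rho>m \<epsilon>"
    and error: "0 \<le> \<epsilon>" "\<forall>U\<in>S. \<forall>V\<in>S. U \<noteq> V \<longrightarrow> (\<forall>x\<in>X. (lam U x, lam V x) \<in> R U V)"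
    and retractions: "uniform_coarse_retractions S C d C' \<alpha>"
    and consistent: "consistent_up_to_error S d R \<alpha>"
  shows
    "(\<exists>X' r lam' lam2'. induced_retraction X dX S d R lam C' \<alpha> X' r lam' lam2') \<and>
     (\<forall>X' r lam' lam2'. induced_retraction X dX S d R lam C' \<alpha> X' r lam' lam2' \<longrightarrow>
        universal_qg_uc_cone TYPE('w) S C' d (image_constraints \<alpha> R) X' dX lam' lam2') \<and>
     (\<forall>X\<^sub>1 r\<^sub>1 lam\<^sub>1 lam2\<^sub>1 X\<^sub>2 r\<^sub>2 lam\<^sub>2 lam2\<^sub>2.
        induced_retraction X dX S d R lam C' \<alpha> X\<^sub>1 r\<^sub>1 lam\<^sub>1 lam2\<^sub>1 \<longrightarrow>
        induced_retraction X dX S d R lam C' \<alpha> X\<^sub>2 r\<^sub>2 lam\<^sub>2 lam2\<^sub>2 \<longrightarrow>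
        (\<exists>\<kappa>\<ge>0. close_on \<kappa> X dX r\<^sub>1 r\<^sub>2))"
proof -
  obtain a b where ab: "0 \<le> a" "0 \<le> b" "\<forall>U\<in>S. affine_control a b (C U) (d U) (d U) (\<alpha> U)"
    using retractions unfolding uniform_coarse_retractions_def by blast
  obtain K where K: "0 \<le> K" "\<forall>U\<in>S. close_on K (C' U) (d U) (\<alpha> U) (\<lambda>x. x)"
    using retractions unfolding uniform_coarse_retractions_def by blast
  have sub: "\<forall>U\<in>S. C' U \<subseteq> C U \<and> \<alpha> U \<in> C U \<rightarrow> C' U"
    using retractions unfolding uniform_coarse_retractions_def by blast
  obtain c where c: "0 \<le> c" "\<forall>U\<in>S. \<forall>V\<in>S. U \<noteq> V \<longrightarrow>
        (\<forall>(x, y)\<in>R U V. \<exists>q\<in>R U V. linf_dist (d U) (d V) (\<alpha> U x, \<alpha> V y) q \<le> ennreal c)"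
    using consistent unfolding consistent_up_to_error_def by blast
  interpret hierarchically_hyperbolic_space X dX S \<delta> C d \<pi> nest orth \<rho> \<rho>m \<xi> K0 \<kappa>0 n l E \<alpha>0 \<theta>
    by (rule hhs)
  interpret ret: hhs_retractions X dX S \<delta> C d \<pi> nest orth \<rho> \<rho>m \<xi> K0 \<kappa>0 n l E \<alpha>0 \<theta> lam \<epsilon> C' \<alpha> a b K c
  proof
    show "\<exists>z\<in>consistent_pairs C d nest orth \<rho> \<rho>m \<epsilon> U V. linf_dist (d U) (d V) (\<alpha> U p, \<alpha> V q) z \<le> ennreal c"
      if "U \<in> S" "V \<in> S" "U \<noteq> V" "(p, q) \<in> consistent_pairs C d nest orth \<rho> \<rho>m \<epsilon> U V" for U V p q
      using c(2) that unfolding R by blast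
  qed (use lam error ab K sub c in \<open>auto simp: R close_on_def\<close>)
  show ?thesis
    unfolding R
    by (intro conjI allI impI ret.induced_retraction_exists ret.induced_retraction_universal
        ret.induced_retraction_unique)
qed

end
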